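(* Let $k\ge1$ be an integer. Suppose the standing assumptions on the equation (existence and uniqueness conditions (i)--(iii), given in the context) and the conditions $(A_1)$, $(A_2)$, $(A_3)$ hold, that $\theta(\cdot)\in\Theta_{k+1}(L)$, and that $\varphi_\epsilon=\epsilon^{\frac1{k+2}}$. Then, for $0<a\le b<T$, $$\limsup_{\epsilon\to0}\ \sup_{\theta(\cdot)\in\Theta_{k+1}(L)}\ \sup_{a\le t\le b}E_\theta\big(|\widehat\theta_tX_t-\theta(t)x_t|^2\big)\,\epsilon^{-\frac{2(k+1)}{k+2}}<\infty .$$
   Context: Setting. Let $T>0$, let $\{W_t,t\ge 0\}$ be a standard Brownian motion, and let $\{Y_t,t\ge0\}$ be a continuous process adapted to the filtration generated by $W$. For small $\epsilon>0$, let $\{X_t,0\le t\le T\}$ (depending on $\epsilon$ and $\theta$) be the unique strong solution of $$dX_t=\theta(t)X_t\,dt+\epsilon\,\sigma_1(t,X_t)\sigma_2(t,Y_t)\,dW_t,\qquad X_0=x_0\in\mathbb R,\ 0\le t\le T,$$ where $\theta(\cdot)$ is an unknown function (the linear multiplier). Let $x_t=x_0\exp\{\int_0^t\theta(s)ds\}$, the solution of $dx_t/dt=\theta(t)x_t$ with initial value $x_0$ (the case $\epsilon=0$). $E_\theta$ denotes expectation when $\theta(\cdot)$ is the linear multiplier. Standing assumptions (guaranteeing a unique strong solution), with $a(t,x)=\theta(t)x$: (i) there is $K>0$ with $|\sigma_1(t,x)|^2+|a(t,x)|^2\le K(1+|x|^2)$ for $t\ge0$, $x\in\mathbb R$; (ii)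 for every integer $N\ge1$ there is $K_N>0$ with $|a(t,x)-a(t,y)|+|\sigma_1(t,x)-\sigma_1(t,y)|\le K_N|x-y|$ for all $t\ge0$, $|x|\le N$, $|y|\le N$; (iii) for every integer $N\ge1$ there is $C_N>0$ with $\sup_{s\ge0}\sup_{|x|\le N}|\sigma_2(s,x)|\le C_N$. Condition $(A_1)$: (i) $\theta(t)$ is bounded on $[0,T]$ by a constant $L$ (i.e. $|\theta(t)|\le L$); (ii) $\sigma_2(t,x)$ is bounded for $t\ge0$, $x\in\mathbb R$; (iii) there is $K>0$ with $|\sigma_1(t,x)|^2\le K(1+|x|^2)$ for $t\ge0$, $x\in\mathbb R$. Condition $(A_2)$: $G$ is a bounded function with compact support $[A,B]$, $A<0<B$, and $\int_A^B G(u)\,du=1$. Condition $(A_3)$: $\int_{-\infty}^\infty u^jG(u)\,du=0$ for $j=1,2,\dots,k$. For an integer $m\ge1$, $\Theta_m(L)$ is the class of all functions $\theta(\cdot)$ which are uniformly bounded by the same constant $L$, are $m$ times differentiable, and satisfy $|\theta^{(m)}(x)-\theta^{(m)}(y)|\le L_1|x-y|$ for $x,y\in\mathbb R$, for some constant $L_1>0$ (fixed for the class), where $\theta^{(m)}$ is the $m$-th derivative. Estimator: with a normalizing function $\varphi_\epsilon>0$, the kernel type estimator $\widehat\theta_t$ is defined by $$\widehat\theta_t X_t=\frac1{\varphi_\epsilon}\int_0^T G\Big(\frac{\tau-t}{\varphi_\epsilon}\Big)dX_\tau .$$ *)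

theory Defs
  imports "HOL-Probability.Probability"
begin

section \<open>Brownian motion and its filtration\<close>

definition natural_filtration :: "'a measure \<Rightarrow> (real \<Rightarrow> 'a \<Rightarrow> real) \<Rightarrow> real \<Rightarrow> 'a measure" where
  "natural_filtration M W t =
     sigma (space M) (\<Union>s\<in>{0..t}. {W s -` B \<inter> space M | B. B \<in> sets borel})"

text \<open>The usual augmentation: strong solutions are adapted to the filtration generated by the
  Brownian motion together with the null sets.\<close>

definition brownian_filtration :: "'a measure \<Rightarrow> (real \<Rightarrow> 'a \<Rightarrow> real) \<Rightarrow> real \<Rightarrow> 'a measure" where
  "brownian_filtration M W t = sigma (space M) (sets (natural_filtration M W t) \<union> null_sets M)"

definition brownian_motion :: "'a measure \<Rightarrow> (real \<Rightarrow> 'a \<Rightarrow> real) \<Rightarrow> bool" where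
  "brownian_motion M W \<longleftrightarrow>
     prob_space M \<and>
     (\<forall>t\<ge>0. W t \<in> borel_measurable M) \<and>
     (AE \<omega> in M. W 0 \<omega> = 0) \<and>
     (\<forall>s\<ge>0. \<forall>t>s.
        distributed M lborel (\<lambda>\<omega>. W t \<omega> - W s \<omega>) (normal_density 0 (sqrt (t - s))) \<and>
        prob_space.indep_set M (sets (natural_filtration M W s))
          (sets (vimage_algebra (space M) (\<lambda>\<omega>. W t \<omega> - W s \<omega>) borel))) \<and>
     (AE \<omega> in M. continuous_on {0..} (\<lambda>t. W t \<omega>))"

definition adapted_on :: "(real \<Rightarrow> 'a measure) \<Rightarrow> real set \<Rightarrow> (real \<Rightarrow> 'a \<Rightarrow> real) \<Rightarrow> bool" where
  "adapted_on F S Y \<longleftrightarrow> (\<forall>t\<in>S. Y t \<in> borel_measurable (F t))"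

definition progressive :: "(real \<Rightarrow> 'a measure) \<Rightarrow> real \<Rightarrow> (real \<Rightarrow> 'a \<Rightarrow> real) \<Rightarrow> bool" where
  "progressive F T H \<longleftrightarrow>
     (\<forall>t\<in>{0..T}. (\<lambda>(s, \<omega>). H s \<omega>) \<in> borel_measurable (restrict_space borel {0..t} \<Otimes>\<^sub>M F t))"

definition continuous_paths_on :: "'a measure \<Rightarrow> real set \<Rightarrow> (real \<Rightarrow> 'a \<Rightarrow> real) \<Rightarrow> bool" where
  "continuous_paths_on M S Y \<longleftrightarrow> (AE \<omega> in M. continuous_on S (\<lambda>t. Y t \<omega>))"

section \<open>The Ito integral\<close>

definition tendsto_in_prob :: "'a measure \<Rightarrow> (nat \<Rightarrow> 'a \<Rightarrow> real) \<Rightarrow> ('a \<Rightarrow> real) \<Rightarrow> bool" where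
  "tendsto_in_prob M Z z \<longleftrightarrow>
     (\<forall>\<delta>>0. (\<lambda>n. measure M {\<omega>\<in>space M. \<delta> < \<bar>Z n \<omega> - z \<omega>\<bar>}) \<longlonglongrightarrow> 0)"

text \<open>A simple integrand on \<open>{0..T}\<close> is a triple \<open>(n, p, \<xi>)\<close> standing for the process that equals
  \<open>\<xi> i\<close> on the interval \<open>{p i<..p (Suc i)}\<close>, for \<open>i < n\<close>.\<close>

type_synonym 'a simple = "nat \<times> (nat \<Rightarrow> real) \<times> (nat \<Rightarrow> 'a \<Rightarrow> real)"

definition simple_integrand :: "'a measure \<Rightarrow> (real \<Rightarrow> 'a measure) \<Rightarrow> real \<Rightarrow> 'a simple \<Rightarrow> bool" where
  "simple_integrand M F T = (\<lambda>(n, p, \<xi>).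
     p 0 = 0 \<and> p n = T \<and> (\<forall>i<n. p i < p (Suc i)) \<and>
     (\<forall>i<n. \<xi> i \<in> borel_measurable (F (p i)) \<and> (\<exists>C. \<forall>\<omega>\<in>space M. \<bar>\<xi> i \<omega>\<bar> \<le> C)))"

definition simple_process :: "'a simple \<Rightarrow> real \<Rightarrow> 'a \<Rightarrow> real" where
  "simple_process = (\<lambda>(n, p, \<xi>) s \<omega>. \<Sum>i<n. \<xi> i \<omega> * indicator {p i<..p (Suc i)} s)"

definition simple_ito_integral :: "(real \<Rightarrow> 'a \<Rightarrow> real) \<Rightarrow> 'a simple \<Rightarrow> real \<Rightarrow> 'a \<Rightarrow> real" where
  "simple_ito_integral W = (\<lambda>(n, p, \<xi>) t \<omega>.
     \<Sum>i<n. \<xi> i \<omega> * (W (min (p (Suc i)) t) \<omega> - W (min (p i) t) \<omega>))"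

text \<open>\<open>has_ito_integral M F W T H I\<close>: the process \<open>I\<close> is a continuous version of
  \<open>t \<mapsto> \<integral>\<^sub>0\<^sup>t H dW\<close> on \<open>{0..T}\<close>, where the integrand is progressively measurable with almost surely
  square integrable paths (no moment condition). The integral is determined by \<open>H\<close> only up to
  indistinguishability, whence a relation and not a function.\<close>

definition has_ito_integral ::
  "'a measure \<Rightarrow> (real \<Rightarrow> 'a measure) \<Rightarrow> (real \<Rightarrow> 'a \<Rightarrow> real) \<Rightarrow> real \<Rightarrow>
   (real \<Rightarrow> 'a \<Rightarrow> real) \<Rightarrow> (real \<Rightarrow> 'a \<Rightarrow> real) \<Rightarrow> bool" where
  "has_ito_integral M F W T H I \<longleftrightarrow>
     progressive F T H \<and>
     (AE \<omega> in M. set_integrable lborel {0..T} (\<lambda>s. (H s \<omega>)\<^sup>2)) \<and>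
     adapted_on F {0..T} I \<and> continuous_paths_on M {0..T} I \<and>
     (\<exists>h. (\<forall>n. simple_integrand M F T (h n)) \<and>
          tendsto_in_prob M
            (\<lambda>n \<omega>. LBINT s:{0..T}. (simple_process (h n) s \<omega> - H s \<omega>)\<^sup>2) (\<lambda>\<omega>. 0) \<and>
          (\<forall>t\<in>{0..T}. tendsto_in_prob M (\<lambda>n. simple_ito_integral W (h n) t) (I t)))"

text \<open>\<open>X\<close> is an Ito process on \<open>{0..T}\<close> with \<open>dX\<^sub>t = u\<^sub>t dt + v\<^sub>t dW\<^sub>t\<close>.\<close>

definition has_ito_differential ::
  "'a measure \<Rightarrow> (real \<Rightarrow> 'a measure) \<Rightarrow> (real \<Rightarrow> 'a \<Rightarrow> real) \<Rightarrow> real \<Rightarrow>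
   (real \<Rightarrow> 'a \<Rightarrow> real) \<Rightarrow> (real \<Rightarrow> 'a \<Rightarrow> real) \<Rightarrow> (real \<Rightarrow> 'a \<Rightarrow> real) \<Rightarrow> bool" where
  "has_ito_differential M F W T X u v \<longleftrightarrow>
     adapted_on F {0..T} X \<and> continuous_paths_on M {0..T} X \<and>
     progressive F T u \<and> (AE \<omega> in M. set_integrable lborel {0..T} (\<lambda>s. u s \<omega>)) \<and>
     (\<exists>I. has_ito_integral M F W T v I \<and>
          (AE \<omega> in M. \<forall>t\<in>{0..T}. X t \<omega> = X 0 \<omega> + (LBINT s:{0..t}. u s \<omega>) + I t \<omega>))"

text \<open>\<open>Z = \<integral>\<^sub>0\<^sup>T g(s) dX\<^sub>s\<close> almost surely, for a deterministic \<open>g\<close> and an Ito process \<open>X\<close>, that is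
  \<open>Z = \<integral>\<^sub>0\<^sup>T g u ds + \<integral>\<^sub>0\<^sup>T g v dW\<close> if \<open>dX = u dt + v dW\<close>. The differential is unique, so that \<open>Z\<close>
  depends (almost surely) on \<open>g\<close> and \<open>X\<close> only.\<close>

definition has_integral_wrt_process ::
  "'a measure \<Rightarrow> (real \<Rightarrow> 'a measure) \<Rightarrow> (real \<Rightarrow> 'a \<Rightarrow> real) \<Rightarrow> real \<Rightarrow>
   (real \<Rightarrow> 'a \<Rightarrow> real) \<Rightarrow> (real \<Rightarrow> real) \<Rightarrow> ('a \<Rightarrow> real) \<Rightarrow> bool" where
  "has_integral_wrt_process M F W T X g Z \<longleftrightarrow>
     Z \<in> borel_measurable M \<and>
     (\<exists>u v I. has_ito_differential M F W T X u v \<and>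
        (AE \<omega> in M. set_integrable lborel {0..T} (\<lambda>s. g s * u s \<omega>)) \<and>
        has_ito_integral M F W T (\<lambda>s \<omega>. g s * v s \<omega>) I \<and>
        (AE \<omega> in M. Z \<omega> = (LBINT s:{0..T}. g s * u s \<omega>) + I T \<omega>))"

section \<open>The model\<close>

definition linear_sde_solution ::
  "'a measure \<Rightarrow> (real \<Rightarrow> 'a \<Rightarrow> real) \<Rightarrow> (real \<Rightarrow> 'a \<Rightarrow> real) \<Rightarrow> real \<Rightarrow>
   (real \<Rightarrow> real \<Rightarrow> real) \<Rightarrow> (real \<Rightarrow> real \<Rightarrow> real) \<Rightarrow> real \<Rightarrow>
   real \<Rightarrow> (real \<Rightarrow> real) \<Rightarrow> (real \<Rightarrow> 'a \<Rightarrow> real) \<Rightarrow> bool" where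
  "linear_sde_solution M W Y T \<sigma>1 \<sigma>2 x0 \<epsilon> \<theta> X \<longleftrightarrow>
     (AE \<omega> in M. X 0 \<omega> = x0) \<and>
     has_ito_differential M (brownian_filtration M W) W T X
       (\<lambda>t \<omega>. \<theta> t * X t \<omega>) (\<lambda>t \<omega>. \<epsilon> * \<sigma>1 t (X t \<omega>) * \<sigma>2 t (Y t \<omega>))"

definition ode_solution :: "real \<Rightarrow> (real \<Rightarrow> real) \<Rightarrow> real \<Rightarrow> real" where
  "ode_solution x0 \<theta> t = x0 * exp (LBINT s:{0..t}. \<theta> s)"

definition existence_conditions ::
  "(real \<Rightarrow> real \<Rightarrow> real) \<Rightarrow> (real \<Rightarrow> real \<Rightarrow> real) \<Rightarrow> (real \<Rightarrow> real \<Rightarrow> real) \<Rightarrow> bool" where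
  "existence_conditions a \<sigma>1 \<sigma>2 \<longleftrightarrow>
     (\<exists>K>0. \<forall>t\<ge>0. \<forall>x. \<bar>\<sigma>1 t x\<bar>\<^sup>2 + \<bar>a t x\<bar>\<^sup>2 \<le> K * (1 + \<bar>x\<bar>\<^sup>2)) \<and>
     (\<forall>N::nat. N \<ge> 1 \<longrightarrow> (\<exists>K>0. \<forall>t\<ge>0. \<forall>x y. \<bar>x\<bar> \<le> real N \<longrightarrow> \<bar>y\<bar> \<le> real N \<longrightarrow>
        \<bar>a t x - a t y\<bar> + \<bar>\<sigma>1 t x - \<sigma>1 t y\<bar> \<le> K * \<bar>x - y\<bar>)) \<and>
     (\<forall>N::nat. N \<ge> 1 \<longrightarrow> (\<exists>C>0. \<forall>s\<ge>0. \<forall>x. \<bar>x\<bar> \<le> real N \<longrightarrow> \<bar>\<sigma>2 s x\<bar> \<le> C))"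

definition cond_A1 ::
  "real \<Rightarrow> real \<Rightarrow> (real \<Rightarrow> real) \<Rightarrow> (real \<Rightarrow> real \<Rightarrow> real) \<Rightarrow> (real \<Rightarrow> real \<Rightarrow> real) \<Rightarrow> bool" where
  "cond_A1 T L \<theta> \<sigma>1 \<sigma>2 \<longleftrightarrow>
     (\<forall>t\<in>{0..T}. \<bar>\<theta> t\<bar> \<le> L) \<and>
     (\<exists>C. \<forall>t\<ge>0. \<forall>x. \<bar>\<sigma>2 t x\<bar> \<le> C) \<and>
     (\<exists>K>0. \<forall>t\<ge>0. \<forall>x. \<bar>\<sigma>1 t x\<bar>\<^sup>2 \<le> K * (1 + \<bar>x\<bar>\<^sup>2))"

text \<open>An integral equal to \<open>1\<close> forces \<open>G\<close> to be integrable on \<open>{A..B}\<close>, hence Borel measurable.\<close>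

definition cond_A2 :: "real \<Rightarrow> real \<Rightarrow> (real \<Rightarrow> real) \<Rightarrow> bool" where
  "cond_A2 A B G \<longleftrightarrow>
     (\<exists>C. \<forall>u. \<bar>G u\<bar> \<le> C) \<and> (\<forall>u. u \<notin> {A..B} \<longrightarrow> G u = 0) \<and> A < 0 \<and> 0 < B \<and>
     (LBINT u:{A..B}. G u) = 1"

definition cond_A3 :: "nat \<Rightarrow> (real \<Rightarrow> real) \<Rightarrow> bool" where
  "cond_A3 k G \<longleftrightarrow> (\<forall>j\<in>{1..k}. (LBINT u. u ^ j * G u) = 0)"

definition Theta_class :: "nat \<Rightarrow> real \<Rightarrow> real \<Rightarrow> (real \<Rightarrow> real) set" where
  "Theta_class m L L1 =
     {\<theta>. (\<forall>x. \<bar>\<theta> x\<bar> \<le> L) \<and>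
         (\<forall>j<m. \<forall>x. (deriv ^^ j) \<theta> differentiable (at x)) \<and>
         (\<forall>x y. \<bar>(deriv ^^ m) \<theta> x - (deriv ^^ m) \<theta> y\<bar> \<le> L1 * \<bar>x - y\<bar>)}"

text \<open>\<open>Z\<close> is (a version of) the random variable denoted \<open>\<theta>\<^sub>t X\<^sub>t\<close> with a hat on \<open>\<theta>\<^sub>t\<close>. The estimator is
  defined through this product, which is meaningful also where \<open>X\<^sub>t\<close> vanishes.\<close>

definition kernel_estimate ::
  "'a measure \<Rightarrow> (real \<Rightarrow> 'a \<Rightarrow> real) \<Rightarrow> real \<Rightarrow> (real \<Rightarrow> real) \<Rightarrow> real \<Rightarrow>
   (real \<Rightarrow> 'a \<Rightarrow> real) \<Rightarrow> real \<Rightarrow> ('a \<Rightarrow> real) \<Rightarrow> bool" where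
  "kernel_estimate M W T G \<phi> X t Z \<longleftrightarrow>
     (\<exists>J. has_integral_wrt_process M (brownian_filtration M W) W T X (\<lambda>\<tau>. G ((\<tau> - t) / \<phi>)) J \<and>
          Z = (\<lambda>\<omega>. 1 / \<phi> * J \<omega>))"

end

theory Submission
  imports Defs
begin

text \<open>
  Write \<open>X\<close> for the solution, \<open>x\<close> for the deterministic limit, \<open>v = \<epsilon> \<sigma>\<^sub>1 \<sigma>\<^sub>2\<close> for the diffusion coefficient
  along the path and \<open>h = \<phi>\<^sub>\<epsilon>\<close>, so that \<open>\<epsilon> = h\<^bsup>k+2\<^esup>\<close>. Since \<open>dX = \<theta> X dt + v dW\<close>, the error of the
  estimator at \<open>t\<close> is the sum of

  \<^item> the drift error \<open>(1/h) \<integral> G((s - t)/h) \<theta>(s) (X\<^sub>s - x\<^sub>s) ds\<close>,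
  \<^item> the noise \<open>(1/h) \<integral> G((s - t)/h) v\<^sub>s dW\<^sub>s\<close>,
  \<^item> the bias \<open>(1/h) \<integral> G((s - t)/h) \<theta>(s) x\<^sub>s ds - \<theta>(t) x\<^sub>t\<close>.

  The second moment of \<open>X\<^sub>s - x\<^sub>s\<close> is \<open>O(\<epsilon>\<^sup>2)\<close> by Gronwall's inequality (\<open>linear_sde_deviation_bound\<close>).
  Hence the drift error has second moment \<open>O(\<epsilon>\<^sup>2) = O(h\<^bsup>2k+4\<^esup>)\<close>, and the noise, whose kernel lives on a
  window of length proportional to \<open>h\<close>, has second moment \<open>O(\<epsilon>\<^sup>2/h) = O(h\<^bsup>2k+3\<^esup>)\<close>
  (\<open>stochastic_error_bound\<close>). The function \<open>\<theta> x\<close> has \<open>k + 1\<close> bounded derivatives, and \<open>G\<close> kills the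
  monomials of degree \<open>1, \<dots>, k\<close>, so Taylor's formula makes the bias \<open>O(h\<^bsup>k+1\<^esup>)\<close> (\<open>kernel_bias\<close>). The
  squared bias has the largest of these three bounds, and
  \<open>h\<^bsup>2k+2\<^esup> = \<epsilon>\<^bsup>2(k+1)/(k+2)\<^esup>\<close> is the rate claimed.

  The constants must be uniform in \<open>\<theta>\<close>. A function bounded by \<open>L\<close> whose derivative of order \<open>m\<close> is
  Lipschitz with constant \<open>L\<^sub>1\<close> has all derivatives up to order \<open>m\<close> bounded in terms of \<open>m\<close>, \<open>L\<close> and
  \<open>L\<^sub>1\<close> alone (\<open>derivatives_uniformly_bounded\<close>).

  The Ito integral comes without moment conditions, so second moments of the noise cannot simply be
  computed. The substitute for the Ito isometry is \<open>ito_limit_cutoff_inequality\<close>,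
  \<open>E [I\<^sup>2; \<integral> H\<^sup>2 ds < c] \<le> E min c (\<integral> H\<^sup>2 ds)\<close> for \<open>I = \<integral> H dW\<close>. For elementary integrands it follows from
  the isometry after the integrand is switched off as soon as its square integral would pass \<open>c\<close>, and
  it survives limits almost everywhere by Fatou's lemma. It takes the place of stopping times in the
  moment bound: with \<open>m(t) = E min c (\<integral>\<^sub>0\<^sup>t v\<^sup>2 ds)\<close>, a finite quantity, the deviation restricted to the
  event \<open>\<integral>\<^sub>0\<^sup>t v\<^sup>2 ds < c\<close> satisfies a closed Gronwall inequality whose constants do not depend on \<open>c\<close>.

  Finally, the integral of \<open>G((s - t)/h)\<close> against \<open>X\<close> refers to some Ito differential of \<open>X\<close>, not
  necessarily to the coefficients of the equation. For a step function \<open>g\<close> the integral \<open>\<integral> g dX\<close> is a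
  finite sum of increments of \<open>X\<close>, the same for every differential, and bounded Borel functions are
  limits of step functions almost everywhere. This gives the noise bound with the coefficients of the
  equation (\<open>integral_wrt_process_residual\<close>).
\<close>

section \<open>Brownian motion relative to its augmented filtration\<close>

lemma space_natural_filtration [simp]: "space (natural_filtration M W t) = space M"
  by (simp add: natural_filtration_def space_measure_of_conv)

lemma space_brownian_filtration [simp]: "space (brownian_filtration M W t) = space M"
  by (simp add: brownian_filtration_def space_measure_of_conv)

lemma sets_natural_filtration:
  "sets (natural_filtration M W t) =
     sigma_sets (space M) (\<Union>s\<in>{0..t}. {W s -` B \<inter> space M | B. B \<in> sets borel})"
  unfolding natural_filtration_def by (rule sets_measure_of) auto

lemma sets_brownian_filtration:
  "sets (brownian_filtration M W t) =
     sigma_sets (space M) (sets (natural_filtration M W t) \<union> null_sets M)"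
proof -
  have "sets (natural_filtration M W t) \<subseteq> Pow (space M)"
    using sets.space_closed[of "natural_filtration M W t"] by simp
  moreover have "null_sets M \<subseteq> Pow (space M)"
    using sets.space_closed[of M] by (auto simp: null_sets_def)
  ultimately show ?thesis
    unfolding brownian_filtration_def by (intro sets_measure_of) auto
qed

lemma natural_filtration_subset:
  assumes "\<And>s. 0 \<le> s \<Longrightarrow> W s \<in> borel_measurable M"
  shows "sets (natural_filtration M W t) \<subseteq> sets M"
  unfolding sets_natural_filtration
  by (rule sets.sigma_sets_subset) (use assms in \<open>auto intro: measurable_sets\<close>)

text \<open>Every set of the augmented sigma-algebra agrees with a set of the original one outside a null set,
  and this property is stable under complements and countable unions.\<close>
lemma independent_of_null_augmentation:
  assumes "prob_space M" and "N \<subseteq> sets M" and "sigma_algebra (space M) N"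
    and "prob_space.indep_set M N E"
  shows "prob_space.indep_set M (sigma_sets (space M) (N \<union> null_sets M)) E"
proof -
  interpret prob_space M by fact
  interpret N: sigma_algebra "space M" N by fact
  have close: "A \<in> sets M \<and> (\<exists>B\<in>N. AE \<omega> in M. \<omega> \<in> A \<longleftrightarrow> \<omega> \<in> B)"
    if "A \<in> sigma_sets (space M) (N \<union> null_sets M)" for A
    using that
  proof induction
    case (Basic a)
    then show ?case
    proof
      assume "a \<in> N" then show ?thesis using assms(2) by auto
    next
      assume a: "a \<in> null_sets M"
      then have "AE \<omega> in M. \<omega> \<in> a \<longleftrightarrow> \<omega> \<in> {}" using AE_not_in[OF a] by simp
      then show ?thesis using a N.empty_sets by blast
    qed
  next
    case Empty
    then show ?case by (auto intro!: bexI[of _ "{}"])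
  next
    case (Compl a)
    then obtain B where "B \<in> N" "AE \<omega> in M. \<omega> \<in> a \<longleftrightarrow> \<omega> \<in> B" by auto
    then have "AE \<omega> in M. \<omega> \<in> space M - a \<longleftrightarrow> \<omega> \<in> space M - B" by auto
    then show ?case using Compl \<open>B \<in> N\<close> by (auto intro!: bexI[of _ "space M - B"])
  next
    case (Union a)
    then have "\<forall>i. \<exists>B\<in>N. AE \<omega> in M. \<omega> \<in> a i \<longleftrightarrow> \<omega> \<in> B" by auto
    then obtain B where B: "\<And>i. B i \<in> N" "\<And>i. AE \<omega> in M. \<omega> \<in> a i \<longleftrightarrow> \<omega> \<in> B i" by metis
    have "AE \<omega> in M. \<forall>i::nat. \<omega> \<in> a i \<longleftrightarrow> \<omega> \<in> B i" using B(2) by (simp add: AE_all_countable)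
    then have "AE \<omega> in M. \<omega> \<in> (\<Union>i. a i) \<longleftrightarrow> \<omega> \<in> (\<Union>i. B i)" by auto
    moreover have "(\<Union>i. B i) \<in> N" using B by auto
    ultimately show ?case using Union by blast
  qed
  have E: "E \<subseteq> sets M" and ind: "\<And>A C. A \<in> N \<Longrightarrow> C \<in> E \<Longrightarrow> prob (A \<inter> C) = prob A * prob C"
    using assms(4) unfolding indep_sets2_eq by auto
  show ?thesis unfolding indep_sets2_eq
  proof (intro conjI ballI)
    show "sigma_sets (space M) (N \<union> null_sets M) \<subseteq> sets M" using close by auto
    show "E \<subseteq> sets M" by (rule E)
    fix A C assume A: "A \<in> sigma_sets (space M) (N \<union> null_sets M)" and C: "C \<in> E"
    obtain B where B: "B \<in> N" "AE \<omega> in M. \<omega> \<in> A \<longleftrightarrow> \<omega> \<in> B" and As: "A \<in> sets M" using close[OF A] by auto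
    have Bs: "B \<in> sets M" and Cs: "C \<in> sets M" using B assms(2) E C by auto
    have "prob (A \<inter> C) = prob (B \<inter> C)"
      by (rule finite_measure_eq_AE) (use B As Bs Cs in auto)
    moreover have "prob A = prob B"
      by (rule finite_measure_eq_AE) (use B As Bs Cs in auto)
    ultimately show "prob (A \<inter> C) = prob A * prob C" using ind[OF B(1) C] by simp
  qed
qed

text \<open>An abstract filtration, because the natural one and its augmentation by null sets share these
  properties, and the elementary integral sees only them.\<close>
locale filtered_brownian = prob_space M for M :: "'a measure" +
  fixes F :: "real \<Rightarrow> 'a measure" and W :: "real \<Rightarrow> 'a \<Rightarrow> real"
  assumes space_F [simp]: "space (F t) = space M"
    and F_subset: "sets (F t) \<subseteq> sets M"
    and F_mono: "s \<le> t \<Longrightarrow> sets (F s) \<subseteq> sets (F t)"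
    and W_adapted: "0 \<le> t \<Longrightarrow> W t \<in> borel_measurable (F t)"
    and W_increment: "0 \<le> s \<Longrightarrow> s < t \<Longrightarrow>
      distributed M lborel (\<lambda>\<omega>. W t \<omega> - W s \<omega>) (normal_density 0 (sqrt (t - s)))"
    and W_independent: "0 \<le> s \<Longrightarrow> s < t \<Longrightarrow>
      indep_set (sets (F s)) (sets (vimage_algebra (space M) (\<lambda>\<omega>. W t \<omega> - W s \<omega>) borel))"

lemma filtered_brownian_augmented:
  assumes "brownian_motion M W"
  shows "filtered_brownian M (brownian_filtration M W) W"
proof -
  interpret prob_space M using assms by (simp add: brownian_motion_def)
  have W: "\<And>t. 0 \<le> t \<Longrightarrow> W t \<in> borel_measurable M" using assms by (simp add: brownian_motion_def)
  note N = natural_filtration_subset[of W M, OF W]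
  have Nm: "sets (natural_filtration M W s) \<subseteq> sets (natural_filtration M W t)" if "s \<le> t" for s t
    unfolding sets_natural_filtration
    by (rule sigma_sets_mono') (use that in force)
  show ?thesis
  proof
    fix s t :: real
    show "sets (brownian_filtration M W t) \<subseteq> sets M"
      unfolding sets_brownian_filtration
      by (rule sets.sigma_sets_subset) (use N in auto)
    show "sets (brownian_filtration M W s) \<subseteq> sets (brownian_filtration M W t)" if "s \<le> t"
      unfolding sets_brownian_filtration by (rule sigma_sets_mono') (use Nm[OF that] in auto)
    show "W t \<in> borel_measurable (brownian_filtration M W t)" if "0 \<le> t"
    proof (rule measurableI)
      fix B :: "real set" assume B: "B \<in> sets borel"
      have "W t -` B \<inter> space M \<in> sets (natural_filtration M W t)"
        unfolding sets_natural_filtration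
        by (rule sigma_sets.Basic) (use that B in \<open>auto intro!: bexI[of _ t]\<close>)
      then show "W t -` B \<inter> space (brownian_filtration M W t) \<in> sets (brownian_filtration M W t)"
        unfolding sets_brownian_filtration by (auto intro: sigma_sets.Basic)
    qed auto
    assume st: "0 \<le> s" "s < t"
    then show "distributed M lborel (\<lambda>\<omega>. W t \<omega> - W s \<omega>) (normal_density 0 (sqrt (t - s)))"
      using assms by (auto simp: brownian_motion_def)
    have "indep_set (sets (natural_filtration M W s))
        (sets (vimage_algebra (space M) (\<lambda>\<omega>. W t \<omega> - W s \<omega>) borel))"
      using assms st by (auto simp: brownian_motion_def)
    then show "indep_set (sets (brownian_filtration M W s))
        (sets (vimage_algebra (space M) (\<lambda>\<omega>. W t \<omega> - W s \<omega>) borel))"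
      unfolding sets_brownian_filtration
      using independent_of_null_augmentation[OF prob_space_axioms N[of s]]
        sets.sigma_algebra_axioms[of "natural_filtration M W s"]
      by simp
  qed simp
qed

context filtered_brownian
begin

lemma F_measurable: "f \<in> borel_measurable (F s) \<Longrightarrow> s \<le> t \<Longrightarrow> f \<in> borel_measurable (F t)"
  using F_mono[of s t] by (auto simp: measurable_def)

lemma F_measurable_M: "f \<in> borel_measurable (F s) \<Longrightarrow> f \<in> borel_measurable M"
  using F_subset[of s] by (auto simp: measurable_def)

lemma W_measurable: "0 \<le> t \<Longrightarrow> W t \<in> borel_measurable M"
  by (rule F_measurable_M[OF W_adapted])

lemma increment_moments:
  assumes "0 \<le> s" "s < t"
  shows "integrable M (\<lambda>\<omega>. W t \<omega> - W s \<omega>)" "expectation (\<lambda>\<omega>. W t \<omega> - W s \<omega>) = 0"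
    "integrable M (\<lambda>\<omega>. (W t \<omega> - W s \<omega>)\<^sup>2)" "expectation (\<lambda>\<omega>. (W t \<omega> - W s \<omega>)\<^sup>2) = t - s"
proof -
  note D = W_increment[OF assms]
  define \<sigma> where "\<sigma> = sqrt (t - s)"
  have \<sigma>: "\<sigma> > 0" "\<sigma>\<^sup>2 = t - s" using assms by (auto simp: \<sigma>_def)
  note D = D[folded \<sigma>_def]
  have nd: "\<And>x. 0 \<le> normal_density 0 \<sigma> x" using \<sigma> by (simp add: normal_density_nonneg)
  have 1: "integrable lborel (\<lambda>x. normal_density 0 \<sigma> x * x)"
    using integrable_normal_moment[OF \<sigma>(1), of 0 1] by simp
  have 2: "integrable lborel (\<lambda>x. normal_density 0 \<sigma> x * x\<^sup>2)"
    using integrable_normal_moment[OF \<sigma>(1), of 0 2] by simp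
  show "integrable M (\<lambda>\<omega>. W t \<omega> - W s \<omega>)"
    using distributed_integrable[OF D, of "\<lambda>x. x"] 1 nd by simp
  show "integrable M (\<lambda>\<omega>. (W t \<omega> - W s \<omega>)\<^sup>2)"
    using distributed_integrable[OF D, of "\<lambda>x. x\<^sup>2"] 2 nd by simp
  have "expectation (\<lambda>\<omega>. W t \<omega> - W s \<omega>) = (\<integral>x. normal_density 0 \<sigma> x * x \<partial>lborel)"
    by (rule distributed_integral[OF D, of "\<lambda>x. x", symmetric]) (use nd in auto)
  also have "\<dots> = 0" using integral_normal_moment_nz_1[OF \<sigma>(1), of 0] by simp
  finally show "expectation (\<lambda>\<omega>. W t \<omega> - W s \<omega>) = 0" .
  have "expectation (\<lambda>\<omega>. (W t \<omega> - W s \<omega>)\<^sup>2) = (\<integral>x. normal_density 0 \<sigma> x * x\<^sup>2 \<partial>lborel)"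
    by (rule distributed_integral[OF D, of "\<lambda>x. x\<^sup>2", symmetric]) (use nd in auto)
  also have "\<dots> = t - s" using integral_normal_moment_even[OF \<sigma>(1), of 0 1] \<sigma> by simp
  finally show "expectation (\<lambda>\<omega>. (W t \<omega> - W s \<omega>)\<^sup>2) = t - s" .
qed

text \<open>The transformation \<open>f\<close> is there for the square of the increment, whose independence of the past
  gives the diagonal terms of the isometry.\<close>
lemma increment_independent:
  fixes f :: "real \<Rightarrow> real"
  assumes "0 \<le> s" "s < t" and X: "X \<in> borel_measurable (F s)" and f: "f \<in> borel_measurable borel"
  shows "indep_var borel X borel (\<lambda>\<omega>. f (W t \<omega> - W s \<omega>))"
proof -
  have XM: "X \<in> borel_measurable M" by (rule F_measurable_M[OF X])
  have WM: "W t \<in> borel_measurable M" "W s \<in> borel_measurable M" using assms by (auto intro: W_measurable)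
  note fm[measurable] = f
  have fM: "(\<lambda>\<omega>. f (W t \<omega> - W s \<omega>)) \<in> borel_measurable M" using WM by measurable
  have "sigma_sets (space M) {X -` A \<inter> space M | A. A \<in> sets borel} \<subseteq> sets (F s)"
    using sets.sigma_sets_subset[of "{X -` A \<inter> space M | A. A \<in> sets borel}" "F s"]
      measurable_sets[OF X] by auto
  moreover have "sigma_sets (space M) {(\<lambda>\<omega>. f (W t \<omega> - W s \<omega>)) -` A \<inter> space M | A. A \<in> sets borel}
     \<subseteq> sets (vimage_algebra (space M) (\<lambda>\<omega>. W t \<omega> - W s \<omega>) borel)"
  proof -
    have "{(\<lambda>\<omega>. f (W t \<omega> - W s \<omega>)) -` A \<inter> space M | A. A \<in> sets borel}
       \<subseteq> sets (vimage_algebra (space M) (\<lambda>\<omega>. W t \<omega> - W s \<omega>) borel)"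
    proof safe
      fix A :: "real set" assume "A \<in> sets borel"
      then have "f -` A \<in> sets borel" using measurable_sets[OF f, of A] by simp
      moreover have "(\<lambda>\<omega>. f (W t \<omega> - W s \<omega>)) -` A \<inter> space M = (\<lambda>\<omega>. W t \<omega> - W s \<omega>) -` (f -` A) \<inter> space M"
        by auto
      ultimately show "(\<lambda>\<omega>. f (W t \<omega> - W s \<omega>)) -` A \<inter> space M
        \<in> sets (vimage_algebra (space M) (\<lambda>\<omega>. W t \<omega> - W s \<omega>) borel)"
        by (metis in_vimage_algebra)
    qed
    then show ?thesis
      using sets.sigma_sets_subset[of _ "vimage_algebra (space M) (\<lambda>\<omega>. W t \<omega> - W s \<omega>) borel"] by simp
  qed
  ultimately show ?thesis
    unfolding indep_var_eq using W_independent[OF assms(1,2)] XM fM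
    unfolding indep_sets2_eq by blast
qed

end

section \<open>Grids and step integrands\<close>

definition grid :: "real \<Rightarrow> nat \<Rightarrow> (nat \<Rightarrow> real) \<Rightarrow> bool" where
  "grid T n q \<longleftrightarrow> q 0 = 0 \<and> q n = T \<and> (\<forall>i<n. q i < q (Suc i))"

lemma grid_less:
  assumes "grid T n q" "i < j" "j \<le> n" shows "q i < q j"
proof -
  have "j \<le> n \<longrightarrow> q i < q j" using assms(2)
  proof (induction j)
    case (Suc j)
    show ?case
    proof
      assume j: "Suc j \<le> n"
      then have "q j < q (Suc j)" using assms(1) by (auto simp: grid_def)
      then show "q i < q (Suc j)" using Suc j by (cases "i = j") auto
    qed
  qed simp
  then show ?thesis using assms by simp
qed

lemma grid_le: "grid T n q \<Longrightarrow> i \<le> j \<Longrightarrow> j \<le> n \<Longrightarrow> q i \<le> q j"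
  using grid_less[of T n q i j] by (cases "i = j") auto

lemma grid_bounds: "grid T n q \<Longrightarrow> i \<le> n \<Longrightarrow> 0 \<le> q i \<and> q i \<le> T"
  using grid_le[of T n q 0 i] grid_le[of T n q i n] by (auto simp: grid_def)

lemma grid_inj: "grid T n q \<Longrightarrow> i \<le> n \<Longrightarrow> j \<le> n \<Longrightarrow> q i \<le> q j \<longleftrightarrow> i \<le> j"
  using grid_le[of T n q i j] grid_less[of T n q j i] by linarith

lemma grid_cover:
  assumes "grid T n q" "0 < s" "s \<le> T"
  shows "\<exists>i<n. s \<in> {q i<..q (Suc i)}"
proof -
  define i where "i = (LEAST i. s \<le> q i)"
  have ex: "s \<le> q n" using assms by (simp add: grid_def)
  have i: "s \<le> q i" "i \<le> n" unfolding i_def using ex by (rule LeastI, rule Least_le)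
  have "i \<noteq> 0" using i assms by (cases "i = 0") (simp_all add: grid_def)
  then obtain j where j: "i = Suc j" by (cases i) auto
  then have "\<not> s \<le> q j" using i_def not_less_Least[of j "\<lambda>i. s \<le> q i"] by simp
  then show ?thesis using i j by (intro exI[of _ j]) auto
qed

lemma grid_interval_unique:
  assumes "grid T n q" "i < n" "j < n" "s \<in> {q i<..q (Suc i)}" "s \<in> {q j<..q (Suc j)}"
  shows "i = j"
proof (rule ccontr)
  assume "i \<noteq> j"
  then consider "Suc i \<le> j" | "Suc j \<le> i" by linarith
  then show False
    by cases (use grid_le[OF assms(1), of "Suc i" j] grid_le[OF assms(1), of "Suc j" i] assms in auto)
qed

lemma grid_of_finite_set:
  assumes "finite P" "P \<subseteq> {0..T}" "0 \<in> P" "T \<in> P"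
  shows "\<exists>n q. grid T n q \<and> q ` {..n} = P"
proof -
  define l where "l = sorted_list_of_set P"
  have l: "sorted l" "distinct l" "set l = P" using assms by (auto simp: l_def)
  have ne: "l \<noteq> []" using l assms by auto
  define n where "n = length l - 1"
  have n: "i \<le> n \<longleftrightarrow> i < length l" for i using ne by (cases l) (auto simp: n_def less_Suc_eq_le)
  have im: "(!) l ` {..n} = P" using l n by (auto simp: set_conv_nth image_def)
  have st: "l ! i < l ! j" if "i < j" "j \<le> n" for i j
    using that l n[of i] n[of j] sorted_nth_mono[of l i j] nth_eq_iff_index_eq[of l i j]
    by (simp add: less_le)
  obtain i0 where "i0 \<le> n" "l ! i0 = 0" using assms(3) im by (auto simp: image_iff)
  moreover have "l ! 0 \<ge> 0" using im assms(2) by fastforce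
  ultimately have "l ! 0 = 0" using st[of 0 i0] by (cases i0) auto
  moreover obtain i1 where "i1 \<le> n" "l ! i1 = T" using assms(4) im by (auto simp: image_iff)
  moreover have "l ! n \<le> T" using im assms(2) by fastforce
  ultimately have "l ! n = T" "l ! 0 = 0" using st[of i1 n] by (cases "i1 = n", auto)+
  then have "grid T n ((!) l)" using st unfolding grid_def by simp
  then show ?thesis using im by blast
qed

definition constant_between :: "nat \<Rightarrow> (nat \<Rightarrow> real) \<Rightarrow> (real \<Rightarrow> 'b) \<Rightarrow> bool" where
  "constant_between n q f \<longleftrightarrow> (\<forall>i<n. \<forall>s\<in>{q i<..q (Suc i)}. f s = f (q (Suc i)))"

lemma constant_betweenD:
  "constant_between n q f \<Longrightarrow> i < n \<Longrightarrow> q i < s \<Longrightarrow> s \<le> q (Suc i) \<Longrightarrow> f s = f (q (Suc i))"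
  unfolding constant_between_def by (meson greaterThanAtMost_iff)

text \<open>The value of \<open>f\<close> on the interval \<open>{q i<..q (Suc i)}\<close> is read off at its right end, so that the sum
  is determined by the function \<open>f\<close> and the grid, without a separate list of coefficients. This makes
  refinement and linear combination of step integrands statements about functions.\<close>
definition grid_sum :: "nat \<Rightarrow> (nat \<Rightarrow> real) \<Rightarrow> (real \<Rightarrow> real) \<Rightarrow> (real \<Rightarrow> real) \<Rightarrow> real" where
  "grid_sum n q f w = (\<Sum>i<n. f (q (Suc i)) * (w (q (Suc i)) - w (q i)))"

text \<open>No point of the coarse grid lies inside an interval of the fine grid.\<close>
lemma finer_grid_interval:
  assumes q: "grid T n q" and r: "grid T m r" and sub: "q ` {..n} \<subseteq> r ` {..m}" and i: "i < m"
  shows "\<exists>j<n. q j \<le> r i \<and> r (Suc i) \<le> q (Suc j)"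
proof -
  have b: "0 < r (Suc i)" "r (Suc i) \<le> T"
    using grid_bounds[OF r, of i] grid_bounds[OF r, of "Suc i"] grid_less[OF r, of i "Suc i"] i by auto
  obtain j where j: "j < n" "q j < r (Suc i)" "r (Suc i) \<le> q (Suc j)"
    using grid_cover[OF q b] by auto
  have "q j \<in> r ` {..m}" using subsetD[OF sub, of "q j"] j by simp
  then obtain l where l: "l \<le> m" "q j = r l" by auto
  have "\<not> r (Suc i) \<le> r l" using j l by simp
  then have "l \<le> i" using grid_inj[OF r, of "Suc i" l] l i by linarith
  then have "q j \<le> r i" using grid_le[OF r, of l i] l i by simp
  then show ?thesis using j by auto
qed

lemma constant_between_refine:
  assumes q: "grid T n q" and r: "grid T m r" and sub: "q ` {..n} \<subseteq> r ` {..m}"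
    and c: "constant_between n q f"
  shows "constant_between m r f"
  unfolding constant_between_def
proof (intro allI impI ballI)
  fix i s assume i: "i < m" and s: "s \<in> {r i<..r (Suc i)}"
  obtain j where j: "j < n" "q j \<le> r i" "r (Suc i) \<le> q (Suc j)"
    using finer_grid_interval[OF q r sub i] by auto
  then have "f s = f (q (Suc j))" using constant_betweenD[OF c, of j s] s by simp
  moreover have "f (r (Suc i)) = f (q (Suc j))"
    using constant_betweenD[OF c, of j "r (Suc i)"] j grid_less[OF r, of i "Suc i"] i by simp
  ultimately show "f s = f (r (Suc i))" by simp
qed

text \<open>The increments of \<open>w\<close> over the fine intervals that make up one coarse interval telescope, and \<open>f\<close> is
  constant there.\<close>
lemma grid_sum_refine:
  assumes q: "grid T n q" and r: "grid T m r" and sub: "q ` {..n} \<subseteq> r ` {..m}"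
    and c: "constant_between n q f"
  shows "grid_sum m r f w = grid_sum n q f w"
proof -
  have "\<forall>j\<in>{..n}. \<exists>l. l \<le> m \<and> q j = r l"
  proof
    fix j assume "j \<in> {..n}"
    then have "q j \<in> r ` {..m}" using sub by blast
    then show "\<exists>l. l \<le> m \<and> q j = r l" by auto
  qed
  then have "\<exists>k. \<forall>j\<in>{..n}. k j \<le> m \<and> q j = r (k j)" by (rule bchoice)
  then obtain k where k: "\<And>j. j \<le> n \<Longrightarrow> k j \<le> m \<and> q j = r (k j)" by auto
  have kle: "k i \<le> k j" if "i \<le> j" "j \<le> n" for i j
    using grid_inj[OF r, of "k i" "k j"] grid_le[OF q that] k[of i] k[of j] that by auto
  have k0: "k 0 = 0" using grid_inj[OF r, of "k 0" 0] k[of 0] q r by (auto simp: grid_def)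
  have kn: "k n = m" using grid_inj[OF r, of m "k n"] k[of n] q r by (auto simp: grid_def)
  define g where "g i = f (r (Suc i)) * (w (r (Suc i)) - w (r i))" for i
  have block: "(\<Sum>i=k j..<k (Suc j). g i) = f (q (Suc j)) * (w (q (Suc j)) - w (q j))" if j: "j < n" for j
  proof -
    have "g i = f (q (Suc j)) * (w (r (Suc i)) - w (r i))" if i: "i \<in> {k j..<k (Suc j)}" for i
    proof -
      have "q j \<le> r i" "r (Suc i) \<le> q (Suc j)" "i < m"
        using i k[of j] k[of "Suc j"] j grid_le[OF r, of "k j" i] grid_le[OF r, of "Suc i" "k (Suc j)"] by auto
      moreover have "r i < r (Suc i)" using r \<open>i < m\<close> by (auto simp: grid_def)
      ultimately have "f (r (Suc i)) = f (q (Suc j))"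
        using constant_betweenD[OF c, of j "r (Suc i)"] j by simp
      then show ?thesis by (simp add: g_def)
    qed
    then have "(\<Sum>i=k j..<k (Suc j). g i) = f (q (Suc j)) * (\<Sum>i=k j..<k (Suc j). w (r (Suc i)) - w (r i))"
      by (simp add: sum_distrib_left)
    also have "(\<Sum>i=k j..<k (Suc j). w (r (Suc i)) - w (r i)) = w (r (k (Suc j))) - w (r (k j))"
      using sum_Suc_diff'[of "k j" "k (Suc j)" "\<lambda>i. w (r i)"] kle[of j "Suc j"] j by simp
    finally show ?thesis using k[of j] k[of "Suc j"] j by simp
  qed
  have "j \<le> n \<longrightarrow> (\<Sum>i<k j. g i) = grid_sum j q f w" for j
  proof (induction j)
    case 0 then show ?case by (simp add: k0 grid_sum_def)
  next
    case (Suc j)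
    show ?case
    proof
      assume j: "Suc j \<le> n"
      have "{..<k (Suc j)} = {..<k j} \<union> {k j..<k (Suc j)}" using kle[of j "Suc j"] j by auto
      then have "(\<Sum>i<k (Suc j). g i) = (\<Sum>i<k j. g i) + (\<Sum>i=k j..<k (Suc j). g i)"
        by (simp add: sum.union_disjoint ivl_disj_int)
      then show "(\<Sum>i<k (Suc j). g i) = grid_sum (Suc j) q f w"
        using Suc block[of j] j by (simp add: grid_sum_def)
    qed
  qed
  from this[of n] show ?thesis by (simp add: kn grid_sum_def g_def)
qed

lemma common_refinement:
  assumes "grid T n q" "grid T m r" and "finite P" "P \<subseteq> {0..T}"
  shows "\<exists>l s. grid T l s \<and> q ` {..n} \<subseteq> s ` {..l} \<and> r ` {..m} \<subseteq> s ` {..l} \<and> P \<subseteq> s ` {..l}"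
proof -
  let ?P = "q ` {..n} \<union> r ` {..m} \<union> P"
  have "?P \<subseteq> {0..T}" using assms grid_bounds[OF assms(1)] grid_bounds[OF assms(2)] by auto
  moreover have "0 \<in> q ` {..n}" "T \<in> q ` {..n}"
    using assms(1) image_eqI[of 0 q 0 "{..n}"] image_eqI[of T q n "{..n}"] by (simp_all add: grid_def)
  moreover have "finite ?P" using assms by auto
  ultimately have "\<exists>l s. grid T l s \<and> s ` {..l} = ?P" by (intro grid_of_finite_set) auto
  then obtain l s where "grid T l s" "s ` {..l} = ?P" by blast
  then show ?thesis by blast
qed

lemma sum_grid_indicator:
  fixes u :: "nat \<Rightarrow> real"
  assumes q: "grid T n q" and j: "j < n" "s \<in> {q j<..q (Suc j)}"
  shows "(\<Sum>i<n. u i * indicator {q i<..q (Suc i)} s) = u j"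
proof -
  have "u i * indicator {q i<..q (Suc i)} s = (if i = j then u j else 0)" if "i < n" for i
  proof (cases "i = j")
    case True
    then show ?thesis using j(2) by simp
  next
    case False
    then have "s \<notin> {q i<..q (Suc i)}" using grid_interval_unique[OF q that j(1) _ j(2)] by blast
    then show ?thesis using False by simp
  qed
  then have "(\<Sum>i<n. u i * indicator {q i<..q (Suc i)} s) = (\<Sum>i<n. if i = j then u j else 0)"
    by (intro sum.cong) auto
  then show ?thesis using j(1) by simp
qed

text \<open>The nonnegative summands are kept as long as the partial sum including the current one is at most
  \<open>c\<close>. The sum kept is the last such partial sum, or the whole sum.\<close>
lemma cutoff_partial_sum_le:
  fixes x :: "nat \<Rightarrow> real"
  assumes "\<And>i. 0 \<le> x i" "0 \<le> c"
  shows "(\<Sum>i<n. if (\<Sum>j\<le>i. x j) \<le> c then x i else 0) \<le> min c (\<Sum>i<n. x i)"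
proof (induction n)
  case (Suc n)
  show ?case
  proof (cases "(\<Sum>j\<le>n. x j) \<le> c")
    case True
    then show ?thesis using Suc by (simp add: lessThan_Suc_atMost[symmetric])
  next
    case False
    then show ?thesis using Suc assms(1)[of n] by simp
  qed
qed (use assms in simp)

context filtered_brownian
begin

text \<open>The coefficient on \<open>{q i<..q (Suc i)}\<close> is known at time \<open>q i\<close>. Vanishing outside \<open>{0<..T}\<close> lets the
  square integral be taken over the whole line.\<close>
definition elementary_on :: "real \<Rightarrow> nat \<Rightarrow> (nat \<Rightarrow> real) \<Rightarrow> (real \<Rightarrow> 'a \<Rightarrow> real) \<Rightarrow> bool" where
  "elementary_on T n q h \<longleftrightarrow> grid T n q \<and> constant_between n q h \<and>
     (\<forall>s. s \<notin> {0<..T} \<longrightarrow> h s = (\<lambda>_. 0)) \<and>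
     (\<forall>i<n. h (q (Suc i)) \<in> borel_measurable (F (q i)) \<and>
            (\<exists>C. \<forall>\<omega>\<in>space M. \<bar>h (q (Suc i)) \<omega>\<bar> \<le> C))"

definition elementary_integral :: "nat \<Rightarrow> (nat \<Rightarrow> real) \<Rightarrow> (real \<Rightarrow> 'a \<Rightarrow> real) \<Rightarrow> 'a \<Rightarrow> real" where
  "elementary_integral n q h \<omega> = grid_sum n q (\<lambda>s. h s \<omega>) (\<lambda>s. W s \<omega>)"

lemma elementary_on_refine:
  assumes h: "elementary_on T n q h" and r: "grid T m r" and sub: "q ` {..n} \<subseteq> r ` {..m}"
  shows "elementary_on T m r h"
proof -
  have q: "grid T n q" and c: "constant_between n q h" using h by (auto simp: elementary_on_def)
  have "h (r (Suc i)) \<in> borel_measurable (F (r i)) \<and> (\<exists>C. \<forall>\<omega>\<in>space M. \<bar>h (r (Suc i)) \<omega>\<bar> \<le> C)"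
    if i: "i < m" for i
  proof -
    obtain j where j: "j < n" "q j \<le> r i" "r (Suc i) \<le> q (Suc j)"
      using finer_grid_interval[OF q r sub i] by auto
    have "h (r (Suc i)) = h (q (Suc j))"
      using constant_betweenD[OF c, of j "r (Suc i)"] j grid_less[OF r, of i "Suc i"] i by simp
    then show ?thesis using h j F_measurable[of _ "q j" "r i"] unfolding elementary_on_def by metis
  qed
  then show ?thesis using h constant_between_refine[OF q r sub c] r unfolding elementary_on_def by blast
qed

lemma elementary_integral_refine:
  assumes h: "elementary_on T n q h" and r: "grid T m r" and sub: "q ` {..n} \<subseteq> r ` {..m}"
  shows "elementary_integral m r h = elementary_integral n q h"
proof
  fix \<omega>
  have "constant_between n q (\<lambda>s. h s \<omega>)"
    using h unfolding elementary_on_def constant_between_def by metis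
  then show "elementary_integral m r h \<omega> = elementary_integral n q h \<omega>"
    unfolding elementary_integral_def
    using grid_sum_refine[OF _ r sub] h by (simp add: elementary_on_def)
qed

lemma elementary_on_add:
  assumes "elementary_on T n q h" "elementary_on T n q g"
  shows "elementary_on T n q (\<lambda>s \<omega>. a * h s \<omega> + b * g s \<omega>)"
proof -
  have "\<exists>C. \<forall>\<omega>\<in>space M. \<bar>a * h (q (Suc i)) \<omega> + b * g (q (Suc i)) \<omega>\<bar> \<le> C" if i: "i < n" for i
  proof -
    obtain C D where "\<forall>\<omega>\<in>space M. \<bar>h (q (Suc i)) \<omega>\<bar> \<le> C" "\<forall>\<omega>\<in>space M. \<bar>g (q (Suc i)) \<omega>\<bar> \<le> D"
      using assms i unfolding elementary_on_def by metis
    then have "\<forall>\<omega>\<in>space M. \<bar>a * h (q (Suc i)) \<omega> + b * g (q (Suc i)) \<omega>\<bar> \<le> \<bar>a\<bar> * C + \<bar>b\<bar> * D"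
      by (auto intro!: abs_triangle_ineq[THEN order_trans] add_mono mult_left_mono simp: abs_mult)
    then show ?thesis by blast
  qed
  moreover have "constant_between n q (\<lambda>s \<omega>. a * h s \<omega> + b * g s \<omega>)"
    unfolding constant_between_def
  proof (intro allI impI ballI)
    fix i s assume "i < n" "s \<in> {q i<..q (Suc i)}"
    then have "h s = h (q (Suc i))" "g s = g (q (Suc i))"
      using assms constant_betweenD[of n q h i s] constant_betweenD[of n q g i s]
      by (auto simp: elementary_on_def)
    then show "(\<lambda>\<omega>. a * h s \<omega> + b * g s \<omega>) = (\<lambda>\<omega>. a * h (q (Suc i)) \<omega> + b * g (q (Suc i)) \<omega>)" by simp
  qed
  moreover have "(\<lambda>\<omega>. a * h (q (Suc i)) \<omega> + b * g (q (Suc i)) \<omega>) \<in> borel_measurable (F (q i))"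
    if "i < n" for i
    using assms that unfolding elementary_on_def
    by (intro borel_measurable_add borel_measurable_times) auto
  ultimately show ?thesis using assms unfolding elementary_on_def by auto
qed

lemma elementary_integral_add:
  "elementary_integral n q (\<lambda>s \<omega>. a * h s \<omega> + b * g s \<omega>) \<omega>
     = a * elementary_integral n q h \<omega> + b * elementary_integral n q g \<omega>"
  by (simp add: elementary_integral_def grid_sum_def algebra_simps sum.distrib sum_distrib_left sum_subtractf)

lemma elementary_expand:
  assumes "elementary_on T n q h"
  shows "h s \<omega> = (\<Sum>i<n. h (q (Suc i)) \<omega> * indicator {q i<..q (Suc i)} s)"
proof (cases "s \<in> {0<..T}")
  case True
  have q: "grid T n q" and c: "constant_between n q h" using assms by (auto simp: elementary_on_def)
  obtain j where j: "j < n" "s \<in> {q j<..q (Suc j)}" using grid_cover[OF q] True by auto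
  show ?thesis unfolding sum_grid_indicator[OF q j] using constant_betweenD[OF c j(1), of s] j(2) by simp
next
  case False
  have q: "grid T n q" using assms by (auto simp: elementary_on_def)
  have "s \<notin> {q i<..q (Suc i)}" if "i < n" for i
    using grid_bounds[OF q, of i] grid_bounds[OF q, of "Suc i"] that False by auto
  then show ?thesis using assms False by (simp add: elementary_on_def)
qed

lemma elementary_square_integral:
  assumes "elementary_on T n q h"
  shows "(\<integral>\<^sup>+s. ennreal ((h s \<omega>)\<^sup>2) \<partial>lborel)
    = ennreal (\<Sum>i<n. (h (q (Suc i)) \<omega>)\<^sup>2 * (q (Suc i) - q i))"
proof -
  have q: "grid T n q" using assms by (auto simp: elementary_on_def)
  have sq: "(h s \<omega>)\<^sup>2 = (\<Sum>i<n. (h (q (Suc i)) \<omega>)\<^sup>2 * indicator {q i<..q (Suc i)} s)" for s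
  proof -
    show ?thesis
    proof (cases "\<exists>j<n. s \<in> {q j<..q (Suc j)}")
      case True
      then obtain j where j: "j < n" "s \<in> {q j<..q (Suc j)}" by auto
      have "h s \<omega> = h (q (Suc j)) \<omega>"
        using elementary_expand[OF assms, of s \<omega>] sum_grid_indicator[OF q j] by metis
      then show ?thesis using sum_grid_indicator[OF q j, of "\<lambda>i. (h (q (Suc i)) \<omega>)\<^sup>2"] by metis
    next
      case False
      then have 0: "indicator {q i<..q (Suc i)} s = (0::real)" if "i < n" for i using that by auto
      have z: "(\<Sum>i<n. u i * indicator {q i<..q (Suc i)} s) = 0" for u :: "nat \<Rightarrow> real"
        by (rule sum.neutral) (use 0 in simp)
      have "h s \<omega> = 0" using elementary_expand[OF assms, of s \<omega>] z by metis
      then show ?thesis using z[of "\<lambda>i. (h (q (Suc i)) \<omega>)\<^sup>2"] by (metis zero_power2)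
    qed
  qed
  have d: "0 \<le> q (Suc i) - q i" if "i < n" for i
    using grid_less[OF q, of i "Suc i"] that by simp
  have "(\<integral>\<^sup>+s. ennreal ((h s \<omega>)\<^sup>2) \<partial>lborel)
     = (\<integral>\<^sup>+s. (\<Sum>i<n. ennreal ((h (q (Suc i)) \<omega>)\<^sup>2) * indicator {q i<..q (Suc i)} s) \<partial>lborel)"
  proof (intro nn_integral_cong)
    fix s :: real
    have "ennreal ((h s \<omega>)\<^sup>2)
      = (\<Sum>i<n. ennreal ((h (q (Suc i)) \<omega>)\<^sup>2 * indicator {q i<..q (Suc i)} s))"
      by (subst sq[of s], rule sum_ennreal[symmetric]) simp
    also have "\<dots> = (\<Sum>i<n. ennreal ((h (q (Suc i)) \<omega>)\<^sup>2) * indicator {q i<..q (Suc i)} s)"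
      by (intro sum.cong) (auto simp: indicator_def)
    finally show "ennreal ((h s \<omega>)\<^sup>2)
      = (\<Sum>i<n. ennreal ((h (q (Suc i)) \<omega>)\<^sup>2) * indicator {q i<..q (Suc i)} s)" .
  qed
  also have "\<dots> = (\<Sum>i<n. ennreal ((h (q (Suc i)) \<omega>)\<^sup>2) * ennreal (q (Suc i) - q i))"
  proof (subst nn_integral_sum)
    show "(\<Sum>i<n. \<integral>\<^sup>+s. ennreal ((h (q (Suc i)) \<omega>)\<^sup>2) * indicator {q i<..q (Suc i)} s \<partial>lborel)
       = (\<Sum>i<n. ennreal ((h (q (Suc i)) \<omega>)\<^sup>2) * ennreal (q (Suc i) - q i))"
    proof (rule sum.cong[OF refl])
      fix i assume "i \<in> {..<n}"
      then show "(\<integral>\<^sup>+s. ennreal ((h (q (Suc i)) \<omega>)\<^sup>2) * indicator {q i<..q (Suc i)} s \<partial>lborel)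
        = ennreal ((h (q (Suc i)) \<omega>)\<^sup>2) * ennreal (q (Suc i) - q i)"
        using d[of i] by (subst nn_integral_cmult) auto
    qed
  qed auto
  also have "\<dots> = ennreal (\<Sum>i<n. (h (q (Suc i)) \<omega>)\<^sup>2 * (q (Suc i) - q i))"
  proof (subst sum_ennreal[symmetric])
    show "(\<Sum>i<n. ennreal ((h (q (Suc i)) \<omega>)\<^sup>2) * ennreal (q (Suc i) - q i))
       = (\<Sum>i<n. ennreal ((h (q (Suc i)) \<omega>)\<^sup>2 * (q (Suc i) - q i)))"
      using d by (intro sum.cong) (auto simp: ennreal_mult)
  qed (use d in auto)
  finally show ?thesis .
qed

lemma integrable_bounded_square:
  fixes f :: "'a \<Rightarrow> real"
  assumes [measurable]: "f \<in> borel_measurable M" and "\<exists>C. \<forall>\<omega>\<in>space M. \<bar>f \<omega>\<bar> \<le> C"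
  shows "integrable M (\<lambda>\<omega>. (f \<omega>)\<^sup>2)"
proof -
  obtain C where C: "\<And>\<omega>. \<omega> \<in> space M \<Longrightarrow> \<bar>f \<omega>\<bar> \<le> C" using assms by auto
  have "(f \<omega>)\<^sup>2 \<le> C\<^sup>2" if "\<omega> \<in> space M" for \<omega>
    using power_mono[OF C[OF that], of 2] by simp
  then show ?thesis by (intro integrable_const_bound[of _ "C\<^sup>2"]) auto
qed

text \<open>In the square of \<open>S (Suc m) = S m + \<eta> m * \<Delta>\<close> the cross term has mean zero, because \<open>\<Delta>\<close> is centred and
  independent of \<open>S m * \<eta> m\<close>, and the last term factorises for the same reason.\<close>
lemma isometry:
  assumes q: "grid T n q"
    and \<eta>: "\<And>i. i < n \<Longrightarrow> \<eta> i \<in> borel_measurable (F (q i))"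
    and bd: "\<And>i. i < n \<Longrightarrow> \<exists>C. \<forall>\<omega>\<in>space M. \<bar>\<eta> i \<omega>\<bar> \<le> C"
    and "m \<le> n"
  defines "S \<equiv> \<lambda>m \<omega>. \<Sum>i<m. \<eta> i \<omega> * (W (q (Suc i)) \<omega> - W (q i) \<omega>)"
  shows "S m \<in> borel_measurable (F (q m)) \<and> integrable M (\<lambda>\<omega>. (S m \<omega>)\<^sup>2) \<and>
     expectation (\<lambda>\<omega>. (S m \<omega>)\<^sup>2) = (\<Sum>i<m. expectation (\<lambda>\<omega>. (\<eta> i \<omega>)\<^sup>2) * (q (Suc i) - q i))"
  using \<open>m \<le> n\<close>
proof (induction m)
  case 0
  then show ?case by (simp add: S_def)
next
  case (Suc m)
  have m: "m < n" "m \<le> n" using Suc.prems by auto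
  have b: "0 \<le> q m" "q m < q (Suc m)" "0 \<le> q (Suc m)"
    using grid_bounds[OF q, of m] grid_bounds[OF q, of "Suc m"] grid_less[OF q, of m "Suc m"] m by auto
  have IH: "S m \<in> borel_measurable (F (q m))" "integrable M (\<lambda>\<omega>. (S m \<omega>)\<^sup>2)"
    "expectation (\<lambda>\<omega>. (S m \<omega>)\<^sup>2) = (\<Sum>i<m. expectation (\<lambda>\<omega>. (\<eta> i \<omega>)\<^sup>2) * (q (Suc i) - q i))"
    using Suc.IH m by auto
  define d where "d \<omega> = W (q (Suc m)) \<omega> - W (q m) \<omega>" for \<omega>
  have SS: "S (Suc m) \<omega> = S m \<omega> + \<eta> m \<omega> * d \<omega>" for \<omega> by (simp add: S_def d_def)
  note \<eta>m = \<eta>[OF m(1)]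
  obtain C where C: "\<And>\<omega>. \<omega> \<in> space M \<Longrightarrow> \<bar>\<eta> m \<omega>\<bar> \<le> C" using bd[OF m(1)] by auto
  have SM[measurable]: "S m \<in> borel_measurable M" by (rule F_measurable_M[OF IH(1)])
  have \<eta>M[measurable]: "\<eta> m \<in> borel_measurable M" by (rule F_measurable_M[OF \<eta>m])
  have meas: "S (Suc m) \<in> borel_measurable (F (q (Suc m)))"
  proof -
    have "q m \<le> q (Suc m)" using b by simp
    then show ?thesis unfolding SS d_def
      by (intro borel_measurable_add borel_measurable_times borel_measurable_diff W_adapted[OF b(3)]
          F_measurable[OF IH(1)] F_measurable[OF \<eta>m] F_measurable[OF W_adapted[OF b(1)]])
  qed
  have iS: "integrable M (S m)"
    by (rule square_integrable_imp_integrable) (use IH in auto)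
  have iS\<eta>: "integrable M (\<lambda>\<omega>. S m \<omega> * \<eta> m \<omega>)"
  proof (rule Bochner_Integration.integrable_bound[OF integrable_mult_right[OF iS, of C]])
    show "AE \<omega> in M. norm (S m \<omega> * \<eta> m \<omega>) \<le> norm (C * S m \<omega>)"
    proof (rule AE_I2)
      fix \<omega> assume "\<omega> \<in> space M"
      then have "\<bar>\<eta> m \<omega>\<bar> \<le> \<bar>C\<bar>" using C by (meson abs_ge_self order_trans)
      then have "\<bar>\<eta> m \<omega>\<bar> * \<bar>S m \<omega>\<bar> \<le> \<bar>C\<bar> * \<bar>S m \<omega>\<bar>" by (rule mult_right_mono) simp
      then show "norm (S m \<omega> * \<eta> m \<omega>) \<le> norm (C * S m \<omega>)" by (simp add: abs_mult mult.commute)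
    qed
  qed measurable
  have i\<eta>2: "integrable M (\<lambda>\<omega>. (\<eta> m \<omega>)\<^sup>2)"
    by (rule integrable_bounded_square[OF \<eta>M bd[OF m(1)]])
  note mom = increment_moments[OF b(1,2), folded d_def]
  have S\<eta>F: "(\<lambda>\<omega>. S m \<omega> * \<eta> m \<omega>) \<in> borel_measurable (F (q m))" using IH(1) \<eta>m by measurable
  have ind1: "indep_var borel (\<lambda>\<omega>. S m \<omega> * \<eta> m \<omega>) borel d"
    using increment_independent[OF b(1,2) S\<eta>F, of "\<lambda>x. x"] by (simp add: d_def[abs_def])
  have \<eta>2F: "(\<lambda>\<omega>. (\<eta> m \<omega>)\<^sup>2) \<in> borel_measurable (F (q m))" using \<eta>m by measurable
  have ind2: "indep_var borel (\<lambda>\<omega>. (\<eta> m \<omega>)\<^sup>2) borel (\<lambda>\<omega>. (d \<omega>)\<^sup>2)"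
    using increment_independent[OF b(1,2) \<eta>2F, of "\<lambda>x. x\<^sup>2"] by (simp add: d_def[abs_def])
  note i1 = indep_var_integrable[OF ind1 iS\<eta> mom(1)] and i2 = indep_var_integrable[OF ind2 i\<eta>2 mom(3)]
  have eq: "(\<lambda>\<omega>. (S (Suc m) \<omega>)\<^sup>2) = (\<lambda>\<omega>. (S m \<omega>)\<^sup>2 + (2 * (S m \<omega> * \<eta> m \<omega> * d \<omega>) + (\<eta> m \<omega>)\<^sup>2 * (d \<omega>)\<^sup>2))"
    by (auto simp: SS power2_eq_square algebra_simps)
  have "integrable M (\<lambda>\<omega>. (S (Suc m) \<omega>)\<^sup>2)" unfolding eq using IH(2) i1 i2 by simp
  moreover have "expectation (\<lambda>\<omega>. (S (Suc m) \<omega>)\<^sup>2)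
    = (\<Sum>i<Suc m. expectation (\<lambda>\<omega>. (\<eta> i \<omega>)\<^sup>2) * (q (Suc i) - q i))"
    unfolding eq using IH(2,3) i1 i2 indep_var_lebesgue_integral[OF ind1 iS\<eta> mom(1)]
      indep_var_lebesgue_integral[OF ind2 i\<eta>2 mom(3)] mom(2,4)
    by simp
  ultimately show ?case using meas by blast
qed

lemma elementary_integral_measurable:
  assumes "elementary_on T n q h"
  shows "elementary_integral n q h \<in> borel_measurable M"
proof -
  have q: "grid T n q" using assms by (auto simp: elementary_on_def)
  have "W (q i) \<in> borel_measurable M" if "i \<le> n" for i
    using W_measurable grid_bounds[OF q that] by auto
  moreover have "h (q (Suc i)) \<in> borel_measurable M" if "i < n" for i
    using assms that F_measurable_M by (auto simp: elementary_on_def)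
  ultimately show ?thesis
    unfolding elementary_integral_def grid_sum_def by (intro borel_measurable_sum borel_measurable_times borel_measurable_diff) auto
qed

text \<open>The coefficient at step \<open>i\<close> is replaced by zero if the square integral up to the end of that step
  exceeds \<open>c\<close>. This is decided at time \<open>q i\<close>, so the result is again elementary and obeys the isometry,
  with square integral at most \<open>min c Q\<close>. On the event \<open>Q \<le> c\<close> nothing has been changed.\<close>
lemma elementary_cutoff_inequality:
  assumes h: "elementary_on T n q h" and c: "0 \<le> c"
  defines "Q \<equiv> \<lambda>\<omega>. \<integral>\<^sup>+s. ennreal ((h s \<omega>)\<^sup>2) \<partial>lborel"
  shows "(\<integral>\<^sup>+\<omega>. indicator {\<omega>. Q \<omega> \<le> ennreal c} \<omega> * ennreal ((elementary_integral n q h \<omega>)\<^sup>2) \<partial>M)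
    \<le> (\<integral>\<^sup>+\<omega>. min (ennreal c) (Q \<omega>) \<partial>M)"
proof -
  have q: "grid T n q" using h by (auto simp: elementary_on_def)
  define \<xi> where "\<xi> i = h (q (Suc i))" for i
  define \<Delta> where "\<Delta> i = max 0 (q (Suc i) - q i)" for i
  have \<Delta>: "\<Delta> i = q (Suc i) - q i" if "i < n" for i using q that by (auto simp: grid_def \<Delta>_def)
  have \<xi>: "\<xi> i \<in> borel_measurable (F (q i))" "\<exists>C. \<forall>\<omega>\<in>space M. \<bar>\<xi> i \<omega>\<bar> \<le> C" if "i < n" for i
    using h that by (auto simp: elementary_on_def \<xi>_def)
  define x where "x i \<omega> = (\<xi> i \<omega>)\<^sup>2 * \<Delta> i" for i \<omega>
  have x0: "0 \<le> x i \<omega>" for i \<omega> by (simp add: x_def \<Delta>_def)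
  have Q: "Q \<omega> = ennreal (\<Sum>i<n. x i \<omega>)" for \<omega>
    unfolding Q_def elementary_square_integral[OF h] x_def \<xi>_def using \<Delta> by simp
  \<comment> \<open>the integrand switched off before its square integral passes \<open>c\<close>\<close>
  define \<eta> where "\<eta> i \<omega> = (if (\<Sum>j\<le>i. x j \<omega>) \<le> c then \<xi> i \<omega> else 0)" for i \<omega>
  have \<eta>m: "\<eta> i \<in> borel_measurable (F (q i))" if i: "i < n" for i
  proof -
    have "\<xi> j \<in> borel_measurable (F (q i))" if "j \<le> i" for j
      using F_measurable[OF \<xi>(1) grid_le[OF q that]] i that by simp
    then have "(\<lambda>\<omega>. \<Sum>j\<le>i. x j \<omega>) \<in> borel_measurable (F (q i))"
      unfolding x_def by (intro borel_measurable_sum borel_measurable_times borel_measurable_power) auto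
    then show ?thesis unfolding \<eta>_def using \<xi>(1)[OF i] by measurable
  qed
  have \<eta>b: "\<exists>C. \<forall>\<omega>\<in>space M. \<bar>\<eta> i \<omega>\<bar> \<le> C" if i: "i < n" for i
  proof -
    obtain C where "\<forall>\<omega>\<in>space M. \<bar>\<xi> i \<omega>\<bar> \<le> C" using \<xi>(2)[OF i] by auto
    then have "\<forall>\<omega>\<in>space M. \<bar>\<eta> i \<omega>\<bar> \<le> \<bar>C\<bar>" by (auto simp: \<eta>_def)
    then show ?thesis by blast
  qed
  define S where "S \<omega> = (\<Sum>i<n. \<eta> i \<omega> * (W (q (Suc i)) \<omega> - W (q i) \<omega>))" for \<omega>
  note iso = isometry[OF q \<eta>m \<eta>b order_refl, folded S_def]
  have \<eta>M: "\<eta> i \<in> borel_measurable M" if "i < n" for i using F_measurable_M \<eta>m that by blast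
  have \<eta>2: "integrable M (\<lambda>\<omega>. (\<eta> i \<omega>)\<^sup>2)" if i: "i < n" for i
  proof -
    show ?thesis by (rule integrable_bounded_square[OF \<eta>M[OF i] \<eta>b[OF i]])
  qed
  have "(\<integral>\<^sup>+\<omega>. indicator {\<omega>. Q \<omega> \<le> ennreal c} \<omega> * ennreal ((elementary_integral n q h \<omega>)\<^sup>2) \<partial>M)
     \<le> (\<integral>\<^sup>+\<omega>. ennreal ((S \<omega>)\<^sup>2) \<partial>M)"
  proof (rule nn_integral_mono)
    fix \<omega> assume "\<omega> \<in> space M"
    show "indicator {\<omega>. Q \<omega> \<le> ennreal c} \<omega> * ennreal ((elementary_integral n q h \<omega>)\<^sup>2) \<le> ennreal ((S \<omega>)\<^sup>2)"
    proof (cases "Q \<omega> \<le> ennreal c")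
      case True
      then have le: "(\<Sum>i<n. x i \<omega>) \<le> c" using c x0 by (simp add: Q sum_nonneg)
      have "(\<Sum>j\<le>i. x j \<omega>) \<le> c" if "i < n" for i
        using order_trans[OF sum_mono2[of "{..<n}" "{..i}" "\<lambda>j. x j \<omega>"] le] that x0
        by (auto simp: subset_iff)
      then have "S \<omega> = elementary_integral n q h \<omega>"
        unfolding S_def elementary_integral_def grid_sum_def by (intro sum.cong) (auto simp: \<eta>_def \<xi>_def)
      then show ?thesis by (simp add: indicator_def)
    qed (simp add: indicator_def)
  qed
  also have "\<dots> = ennreal (expectation (\<lambda>\<omega>. (S \<omega>)\<^sup>2))"
    using iso by (intro nn_integral_eq_integral) auto
  also have "expectation (\<lambda>\<omega>. (S \<omega>)\<^sup>2) = expectation (\<lambda>\<omega>. \<Sum>i<n. (\<eta> i \<omega>)\<^sup>2 * \<Delta> i)"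
    using iso \<eta>2 \<Delta> by (subst Bochner_Integration.integral_sum) auto
  also have "ennreal \<dots> = (\<integral>\<^sup>+\<omega>. ennreal (\<Sum>i<n. (\<eta> i \<omega>)\<^sup>2 * \<Delta> i) \<partial>M)"
    using \<eta>2 by (intro nn_integral_eq_integral[symmetric] Bochner_Integration.integrable_sum integrable_mult_left AE_I2 sum_nonneg)
       (auto simp: \<Delta>_def)
  also have "\<dots> \<le> (\<integral>\<^sup>+\<omega>. min (ennreal c) (Q \<omega>) \<partial>M)"
  proof (rule nn_integral_mono)
    fix \<omega>
    have "(\<Sum>i<n. (\<eta> i \<omega>)\<^sup>2 * \<Delta> i) = (\<Sum>i<n. if (\<Sum>j\<le>i. x j \<omega>) \<le> c then x i \<omega> else 0)"
      by (intro sum.cong) (auto simp: \<eta>_def x_def)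
    also have "\<dots> \<le> min c (\<Sum>i<n. x i \<omega>)" by (rule cutoff_partial_sum_le) (use x0 c in auto)
    finally show "ennreal (\<Sum>i<n. (\<eta> i \<omega>)\<^sup>2 * \<Delta> i) \<le> min (ennreal c) (Q \<omega>)"
      using c x0 by (simp add: Q ennreal_leI)
  qed
  finally show ?thesis .
qed

end

section \<open>Limits of elementary integrals\<close>

lemma tendsto_in_prob_subseq:
  assumes "tendsto_in_prob M Z z" "strict_mono r"
  shows "tendsto_in_prob M (\<lambda>k. Z (r k)) z"
  using assms LIMSEQ_subseq_LIMSEQ[of _ 0 r] unfolding tendsto_in_prob_def comp_def by blast

text \<open>Along a sequence on which the \<open>k\<close>-th deviation exceeds \<open>2\<^bsup>-k\<^esup>\<close> with probability less than \<open>2\<^bsup>-k\<^esup>\<close>, the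
  Borel-Cantelli lemma gives convergence almost everywhere.\<close>
lemma tendsto_in_prob_AE_subseq:
  assumes "finite_measure M" and [measurable]: "\<And>n. Z n \<in> borel_measurable M" "z \<in> borel_measurable M"
    and lim: "tendsto_in_prob M Z z"
  shows "\<exists>r::nat \<Rightarrow> nat. strict_mono r \<and> (AE \<omega> in M. (\<lambda>k. Z (r k) \<omega>) \<longlonglongrightarrow> z \<omega>)"
proof -
  interpret finite_measure M by fact
  define E where "E k n = {\<omega>\<in>space M. (1/2::real)^k < \<bar>Z n \<omega> - z \<omega>\<bar>}" for k n
  have Es[measurable]: "E k n \<in> sets M" for k n unfolding E_def by measurable
  have ex: "\<exists>m>N. measure M (E k m) < (1/2)^k" for k N
  proof -
    have "(\<lambda>n. measure M (E k n)) \<longlonglongrightarrow> 0"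
      using lim unfolding tendsto_in_prob_def E_def by simp
    then have "eventually (\<lambda>n. measure M (E k n) < (1/2)^k) sequentially"
      by (rule order_tendstoD) simp
    then have "eventually (\<lambda>n. measure M (E k n) < (1/2)^k \<and> N < n) sequentially"
      using eventually_gt_at_top[of N] by (rule eventually_conj)
    then show ?thesis by (auto simp: eventually_sequentially)
  qed
  have "\<exists>r. \<forall>n. measure M (E n (r n)) < (1/2)^n \<and> r n < r (Suc n)"
    by (rule dependent_nat_choice) (use ex in blast)+
  then obtain r where r: "\<And>n. measure M (E n (r n)) < (1/2)^n" "\<And>n. r n < r (Suc n)" by blast
  have sm: "strict_mono r" using r(2) by (simp add: strict_mono_Suc_iff)
  have "summable (\<lambda>n. measure M (E n (r n)))"
  proof (rule summable_comparison_test')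
    show "summable (\<lambda>n. (1/2::real)^n)" by (rule summable_geometric) simp
    fix n show "norm (measure M (E n (r n))) \<le> (1/2)^n" using r(1)[of n] by simp
  qed
  then have "AE \<omega> in M. eventually (\<lambda>n. \<omega> \<in> space M - E n (r n)) sequentially"
    by (intro borel_cantelli_AE1) (auto simp: less_top[symmetric])
  then have "AE \<omega> in M. (\<lambda>k. Z (r k) \<omega>) \<longlonglongrightarrow> z \<omega>"
  proof eventually_elim
    case (elim \<omega>)
    have "(\<lambda>k. Z (r k) \<omega> - z \<omega>) \<longlonglongrightarrow> 0"
    proof (rule Lim_null_comparison)
      show "eventually (\<lambda>k. norm (Z (r k) \<omega> - z \<omega>) \<le> (1/2)^k) sequentially"
        using elim by eventually_elim (auto simp: E_def)
      show "(\<lambda>k. (1/2::real)^k) \<longlonglongrightarrow> 0" by (rule LIMSEQ_power_zero) simp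
    qed
    then show ?case by (simp add: LIM_zero_iff)
  qed
  then show ?thesis using sm by blast
qed

definition jointly_measurable :: "'a measure \<Rightarrow> (real \<Rightarrow> 'a \<Rightarrow> real) \<Rightarrow> bool" where
  "jointly_measurable M H \<longleftrightarrow> (\<lambda>x. H (fst x) (snd x)) \<in> borel_measurable (borel \<Otimes>\<^sub>M M)"

lemma jointly_measurable_comp:
  assumes "jointly_measurable M H" "f \<in> borel_measurable N" "g \<in> measurable N M"
  shows "(\<lambda>x. H (f x) (g x)) \<in> borel_measurable N"
  using measurable_compose[OF measurable_Pair[OF assms(2,3)], of "\<lambda>x. H (fst x) (snd x)" borel] assms(1)
  by (simp add: jointly_measurable_def)

lemma jointly_measurable_section:
  "jointly_measurable M H \<Longrightarrow> \<omega> \<in> space M \<Longrightarrow> (\<lambda>s. H s \<omega>) \<in> borel_measurable borel"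
  using jointly_measurable_comp[of M H "\<lambda>s. s" borel "\<lambda>_. \<omega>"] by simp

lemma jointly_measurable_at: "jointly_measurable M H \<Longrightarrow> H s \<in> borel_measurable M"
  using jointly_measurable_comp[of M H "\<lambda>_. s" M "\<lambda>\<omega>. \<omega>"] by simp

lemma jointly_measurable_mult_indicator:
  assumes "jointly_measurable M H" "A \<in> sets borel"
  shows "jointly_measurable M (\<lambda>s \<omega>. indicator A s * H s \<omega>)"
  using assms unfolding jointly_measurable_def
  by (intro borel_measurable_times measurable_compose[OF measurable_fst borel_measurable_indicator]) auto

lemma jointly_measurable_linear:
  assumes "jointly_measurable M H" "jointly_measurable M K"
  shows "jointly_measurable M (\<lambda>s \<omega>. a * H s \<omega> + b * K s \<omega>)"
  using assms unfolding jointly_measurable_def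
  by (intro borel_measurable_add borel_measurable_times) auto

lemma jointly_measurable_square_integral:
  assumes "jointly_measurable M H"
  shows "(\<lambda>\<omega>. \<integral>\<^sup>+s. ennreal ((H s \<omega>)\<^sup>2) \<partial>lborel) \<in> borel_measurable M"
proof (rule lborel.borel_measurable_nn_integral)
  have "(\<lambda>x. H (snd x) (fst x)) \<in> borel_measurable (M \<Otimes>\<^sub>M lborel)"
    using jointly_measurable_comp[OF assms, of snd "M \<Otimes>\<^sub>M lborel" fst] by simp
  then show "(\<lambda>(\<omega>, s). ennreal ((H s \<omega>)\<^sup>2)) \<in> borel_measurable (M \<Otimes>\<^sub>M lborel)"
    unfolding case_prod_beta by (intro measurable_compose[OF _ measurable_ennreal] borel_measurable_power)
qed

lemma square_add_le:
  fixes x y :: real assumes "0 < \<delta>"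
  shows "(x + y)\<^sup>2 \<le> (1 + \<delta>) * x\<^sup>2 + (1 + 1 / \<delta>) * y\<^sup>2"
proof -
  have "0 \<le> (sqrt \<delta> * x - y / sqrt \<delta>)\<^sup>2" by simp
  also have "\<dots> = \<delta> * x\<^sup>2 - 2 * x * y + y\<^sup>2 / \<delta>"
    using assms by (simp add: power2_diff power_mult_distrib power_divide)
  finally show ?thesis by (simp add: power2_sum algebra_simps)
qed

text \<open>Upper semicontinuity of the square integral under convergence in mean square, from
  \<open>g\<^sup>2 \<le> (1 + \<delta>) f\<^sup>2 + (1 + 1/\<delta>) (g - f)\<^sup>2\<close> with \<open>\<delta>\<close> chosen so small that \<open>\<delta> \<integral> f\<^sup>2 \<le> e/2\<close>.\<close>
lemma eventually_square_integral_le: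
  fixes f :: "'b \<Rightarrow> real" and g :: "nat \<Rightarrow> 'b \<Rightarrow> real"
  assumes [measurable]: "f \<in> borel_measurable N" "\<And>k. g k \<in> borel_measurable N"
    and fin: "(\<integral>\<^sup>+s. ennreal ((f s)\<^sup>2) \<partial>N) < \<infinity>"
    and lim: "(\<lambda>k. \<integral>\<^sup>+s. ennreal ((g k s - f s)\<^sup>2) \<partial>N) \<longlonglongrightarrow> 0" and e: "0 < e"
  shows "eventually (\<lambda>k. (\<integral>\<^sup>+s. ennreal ((g k s)\<^sup>2) \<partial>N) \<le> (\<integral>\<^sup>+s. ennreal ((f s)\<^sup>2) \<partial>N) + ennreal e) sequentially"
proof -
  obtain u where u: "(\<integral>\<^sup>+s. ennreal ((f s)\<^sup>2) \<partial>N) = ennreal u" "0 \<le> u"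
    using fin by (cases "\<integral>\<^sup>+s. ennreal ((f s)\<^sup>2) \<partial>N" rule: ennreal_cases) auto
  define \<delta> where "\<delta> = e / (2 * (u + 1))"
  have \<delta>: "0 < \<delta>" using e u by (simp add: \<delta>_def)
  have du: "\<delta> * u \<le> e / 2" using e u by (simp add: \<delta>_def field_simps)
  define r where "r = e / 2 / (1 + 1 / \<delta>)"
  have r: "0 < r" using e \<delta> by (simp add: r_def add_pos_pos)
  have "eventually (\<lambda>k. (\<integral>\<^sup>+s. ennreal ((g k s - f s)\<^sup>2) \<partial>N) < ennreal r) sequentially"
    using lim by (rule order_tendstoD) (use r in simp)
  then show ?thesis
  proof eventually_elim
    case (elim k)
    have "(\<integral>\<^sup>+s. ennreal ((g k s)\<^sup>2) \<partial>N)
      \<le> (\<integral>\<^sup>+s. ennreal (1 + \<delta>) * ennreal ((f s)\<^sup>2) + ennreal (1 + 1 / \<delta>) * ennreal ((g k s - f s)\<^sup>2) \<partial>N)"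
    proof (rule nn_integral_mono)
      fix s
      have "(g k s)\<^sup>2 \<le> (1 + \<delta>) * (f s)\<^sup>2 + (1 + 1 / \<delta>) * (g k s - f s)\<^sup>2"
        using square_add_le[OF \<delta>, of "f s" "g k s - f s"] by simp
      then show "ennreal ((g k s)\<^sup>2)
        \<le> ennreal (1 + \<delta>) * ennreal ((f s)\<^sup>2) + ennreal (1 + 1 / \<delta>) * ennreal ((g k s - f s)\<^sup>2)"
        using \<delta> by (simp add: ennreal_mult[symmetric] ennreal_plus[symmetric] ennreal_leI del: ennreal_plus)
    qed
    also have "\<dots> = ennreal (1 + \<delta>) * ennreal u + ennreal (1 + 1 / \<delta>) * (\<integral>\<^sup>+s. ennreal ((g k s - f s)\<^sup>2) \<partial>N)"
      using u by (simp add: nn_integral_add nn_integral_cmult)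
    also have "\<dots> \<le> ennreal (1 + \<delta>) * ennreal u + ennreal (1 + 1 / \<delta>) * ennreal r"
      using elim by (intro add_mono mult_left_mono) auto
    also have "\<dots> = ennreal ((1 + \<delta>) * u + (1 + 1 / \<delta>) * r)"
      using \<delta> u r by (simp add: ennreal_mult[symmetric] ennreal_plus[symmetric] del: ennreal_plus)
    also have "\<dots> \<le> ennreal (u + e)"
    proof (rule ennreal_leI)
      have "0 < 1 + 1 / \<delta>" using \<delta> by (simp add: add_pos_pos)
      then have "(1 + 1 / \<delta>) * r = e / 2"
        using nonzero_mult_div_cancel_left[of "1 + 1 / \<delta>" "e / 2"]
        unfolding r_def times_divide_eq_right by simp
      then show "(1 + \<delta>) * u + (1 + 1 / \<delta>) * r \<le> u + e" using du by (simp add: algebra_simps)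
    qed
    finally show ?case using u e by simp
  qed
qed

context filtered_brownian
begin

text \<open>The value of a stochastic integral at the final time, as a limit almost everywhere in place of a limit
  in probability. Every Ito integral is of this form after passage to a subsequence, and linear
  combinations need no further selection.\<close>
definition ito_limit :: "real \<Rightarrow> (real \<Rightarrow> 'a \<Rightarrow> real) \<Rightarrow> ('a \<Rightarrow> real) \<Rightarrow> bool" where
  "ito_limit T H Z \<longleftrightarrow> jointly_measurable M H \<and> Z \<in> borel_measurable M \<and>
     (AE \<omega> in M. (\<integral>\<^sup>+s. ennreal ((H s \<omega>)\<^sup>2) \<partial>lborel) < \<infinity>) \<and>
     (\<exists>n q h. (\<forall>k. elementary_on T (n k) (q k) (h k)) \<and>
        (AE \<omega> in M. (\<lambda>k. \<integral>\<^sup>+s. ennreal ((h k s \<omega> - H s \<omega>)\<^sup>2) \<partial>lborel) \<longlonglongrightarrow> 0) \<and>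
        (AE \<omega> in M. (\<lambda>k. elementary_integral (n k) (q k) (h k) \<omega>) \<longlonglongrightarrow> Z \<omega>))"

lemma ito_limitE:
  assumes "ito_limit T H Z"
  obtains n q h where "\<forall>k. elementary_on T (n k) (q k) (h k)"
    and "AE \<omega> in M. (\<lambda>k. \<integral>\<^sup>+s. ennreal ((h k s \<omega> - H s \<omega>)\<^sup>2) \<partial>lborel) \<longlonglongrightarrow> 0"
    and "AE \<omega> in M. (\<lambda>k. elementary_integral (n k) (q k) (h k) \<omega>) \<longlonglongrightarrow> Z \<omega>"
  using assms unfolding ito_limit_def by (elim conjE exE) (erule (2) that)

lemma ito_limitD:
  assumes "ito_limit T H Z"
  shows "jointly_measurable M H" "Z \<in> borel_measurable M"
    "AE \<omega> in M. (\<integral>\<^sup>+s. ennreal ((H s \<omega>)\<^sup>2) \<partial>lborel) < \<infinity>"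
  using assms unfolding ito_limit_def by - (elim conjE, assumption)+

lemma elementary_section_measurable:
  assumes "elementary_on T n q h"
  shows "(\<lambda>s. h s \<omega>) \<in> borel_measurable borel"
proof -
  have "(\<lambda>s. h s \<omega>) = (\<lambda>s. \<Sum>i<n. h (q (Suc i)) \<omega> * indicator {q i<..q (Suc i)} s)"
    by (rule ext) (rule elementary_expand[OF assms])
  also have "\<dots> \<in> borel_measurable borel" by measurable
  finally show ?thesis .
qed

lemma elementary_square_integral_measurable:
  assumes h: "elementary_on T n q h"
  shows "(\<lambda>\<omega>. \<integral>\<^sup>+s. ennreal ((h s \<omega>)\<^sup>2) \<partial>lborel) \<in> borel_measurable M"
proof -
  have "h (q (Suc i)) \<in> borel_measurable M" if "i < n" for i
    using h that F_measurable_M by (auto simp: elementary_on_def)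
  then show ?thesis unfolding elementary_square_integral[OF h]
    by (intro measurable_compose[OF _ measurable_ennreal] borel_measurable_sum borel_measurable_times
        borel_measurable_power) auto
qed

text \<open>Fatou's lemma on the left and its reverse on the right, where the constant \<open>c\<close> dominates. The strict
  inequality \<open>Q < c\<close> in the limit makes the square integrals of the approximations eventually at most \<open>c\<close>.\<close>
theorem ito_limit_cutoff_inequality:
  assumes I: "ito_limit T H Z" and c: "0 \<le> c"
  defines "Q \<equiv> \<lambda>\<omega>. \<integral>\<^sup>+s. ennreal ((H s \<omega>)\<^sup>2) \<partial>lborel"
  shows "(\<integral>\<^sup>+\<omega>. indicator {\<omega>. Q \<omega> < ennreal c} \<omega> * ennreal ((Z \<omega>)\<^sup>2) \<partial>M)
    \<le> (\<integral>\<^sup>+\<omega>. min (ennreal c) (Q \<omega>) \<partial>M)"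
proof -
  obtain n q h where h0: "\<forall>k. elementary_on T (n k) (q k) (h k)"
    and lim: "AE \<omega> in M. (\<lambda>k. \<integral>\<^sup>+s. ennreal ((h k s \<omega> - H s \<omega>)\<^sup>2) \<partial>lborel) \<longlonglongrightarrow> 0"
    and limS: "AE \<omega> in M. (\<lambda>k. elementary_integral (n k) (q k) (h k) \<omega>) \<longlonglongrightarrow> Z \<omega>"
    using I by (rule ito_limitE)
  note h = spec[OF h0]
  have jm: "jointly_measurable M H" and Zm[measurable]: "Z \<in> borel_measurable M"
    and fin: "AE \<omega> in M. Q \<omega> < \<infinity>"
    unfolding Q_def by (rule ito_limitD[OF I])+
  define S where "S k = elementary_integral (n k) (q k) (h k)" for k
  define R where "R k \<omega> = (\<integral>\<^sup>+s. ennreal ((h k s \<omega>)\<^sup>2) \<partial>lborel)" for k \<omega>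
  have Sm[measurable]: "S k \<in> borel_measurable M" for k
    unfolding S_def by (rule elementary_integral_measurable[OF h])
  have Rm[measurable]: "R k \<in> borel_measurable M" for k
    unfolding R_def by (rule elementary_square_integral_measurable[OF h])
  have Qm[measurable]: "Q \<in> borel_measurable M"
    unfolding Q_def by (rule jointly_measurable_square_integral[OF jm])
  have ev: "AE \<omega> in M. \<forall>e>0. eventually (\<lambda>k. R k \<omega> \<le> Q \<omega> + ennreal e) sequentially"
    using fin lim AE_space
  proof eventually_elim
    case (elim \<omega>)
    show ?case
    proof (intro allI impI)
      fix e :: real assume "0 < e"
      then show "eventually (\<lambda>k. R k \<omega> \<le> Q \<omega> + ennreal e) sequentially"
        unfolding R_def Q_def
        using eventually_square_integral_le[of "\<lambda>s. H s \<omega>" lborel "\<lambda>k s. h k s \<omega>" e]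
          jointly_measurable_section[OF jm elim(3)] elementary_section_measurable[OF h] elim(1,2)
        by (simp add: Q_def)
    qed
  qed
  have "(\<integral>\<^sup>+\<omega>. indicator {\<omega>. Q \<omega> < ennreal c} \<omega> * ennreal ((Z \<omega>)\<^sup>2) \<partial>M)
      \<le> (\<integral>\<^sup>+\<omega>. liminf (\<lambda>k. indicator {\<omega>. R k \<omega> \<le> ennreal c} \<omega> * ennreal ((S k \<omega>)\<^sup>2)) \<partial>M)"
  proof (rule nn_integral_mono_AE)
    show "AE \<omega> in M. indicator {\<omega>. Q \<omega> < ennreal c} \<omega> * ennreal ((Z \<omega>)\<^sup>2)
       \<le> liminf (\<lambda>k. indicator {\<omega>. R k \<omega> \<le> ennreal c} \<omega> * ennreal ((S k \<omega>)\<^sup>2))"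
      using ev limS
    proof eventually_elim
      case (elim \<omega>)
      show ?case
      proof (cases "Q \<omega> < ennreal c")
        case True
        then obtain u where u: "Q \<omega> = ennreal u" "0 \<le> u" "u < c"
          by (cases "Q \<omega>" rule: ennreal_cases) (auto simp: ennreal_less_iff)
        have "eventually (\<lambda>k. R k \<omega> \<le> Q \<omega> + ennreal (c - u)) sequentially" using elim(1) u by simp
        then have "eventually (\<lambda>k. ennreal ((S k \<omega>)\<^sup>2)
            = indicator {\<omega>. R k \<omega> \<le> ennreal c} \<omega> * ennreal ((S k \<omega>)\<^sup>2)) sequentially"
          by eventually_elim (use u in \<open>simp add: ennreal_plus[symmetric] del: ennreal_plus\<close>)
        moreover have "(\<lambda>k. ennreal ((S k \<omega>)\<^sup>2)) \<longlonglongrightarrow> ennreal ((Z \<omega>)\<^sup>2)"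
          using elim(2) unfolding S_def by (intro tendsto_ennrealI tendsto_power)
        ultimately have "(\<lambda>k. indicator {\<omega>. R k \<omega> \<le> ennreal c} \<omega> * ennreal ((S k \<omega>)\<^sup>2)) \<longlonglongrightarrow> ennreal ((Z \<omega>)\<^sup>2)"
          by (rule Lim_transform_eventually[rotated])
        then have "liminf (\<lambda>k. indicator {\<omega>. R k \<omega> \<le> ennreal c} \<omega> * ennreal ((S k \<omega>)\<^sup>2)) = ennreal ((Z \<omega>)\<^sup>2)"
          by (rule lim_imp_Liminf[OF sequentially_bot])
        then show ?thesis using True by simp
      qed simp
    qed
  qed
  also have "\<dots> \<le> liminf (\<lambda>k. \<integral>\<^sup>+\<omega>. indicator {\<omega>. R k \<omega> \<le> ennreal c} \<omega> * ennreal ((S k \<omega>)\<^sup>2) \<partial>M)"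
    by (rule nn_integral_liminf) measurable
  also have "\<dots> \<le> liminf (\<lambda>k. \<integral>\<^sup>+\<omega>. min (ennreal c) (R k \<omega>) \<partial>M)"
    by (intro Liminf_mono always_eventually allI)
       (use elementary_cutoff_inequality[OF h c] in \<open>simp add: S_def R_def\<close>)
  also have "\<dots> \<le> limsup (\<lambda>k. \<integral>\<^sup>+\<omega>. min (ennreal c) (R k \<omega>) \<partial>M)"
    by (rule Liminf_le_Limsup) simp
  also have "\<dots> \<le> (\<integral>\<^sup>+\<omega>. limsup (\<lambda>k. min (ennreal c) (R k \<omega>)) \<partial>M)"
    by (rule nn_integral_limsup[of _ _ "\<lambda>_. ennreal c"]) (auto simp: emeasure_space_1)
  also have "\<dots> \<le> (\<integral>\<^sup>+\<omega>. min (ennreal c) (Q \<omega>) \<partial>M)"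
  proof (rule nn_integral_mono_AE)
    show "AE \<omega> in M. limsup (\<lambda>k. min (ennreal c) (R k \<omega>)) \<le> min (ennreal c) (Q \<omega>)"
      using ev
    proof eventually_elim
      case (elim \<omega>)
      have "limsup (\<lambda>k. min (ennreal c) (R k \<omega>)) \<le> ennreal c"
        by (rule Limsup_bounded) simp
      moreover have "limsup (\<lambda>k. min (ennreal c) (R k \<omega>)) \<le> Q \<omega>"
      proof (rule ennreal_le_epsilon)
        fix e :: real assume "0 < e"
        then have "eventually (\<lambda>k. min (ennreal c) (R k \<omega>) \<le> Q \<omega> + ennreal e) sequentially"
          using elim by (auto elim!: eventually_mono intro: min.coboundedI2)
        then show "limsup (\<lambda>k. min (ennreal c) (R k \<omega>)) \<le> Q \<omega> + ennreal e"
          by (rule Limsup_bounded)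
      qed
      ultimately show ?case by simp
    qed
  qed
  finally show ?thesis .
qed

lemma ito_limit_zero: "0 < T \<Longrightarrow> ito_limit T (\<lambda>_ _. 0) (\<lambda>_. 0)"
  unfolding ito_limit_def
proof (intro conjI exI)
  assume T: "0 < T"
  show "jointly_measurable M (\<lambda>_ _. 0)" by (simp add: jointly_measurable_def)
  show "\<forall>k::nat. elementary_on T 1 (\<lambda>i. if i = 0 then 0 else T) (\<lambda>_ _. 0)"
    using T by (auto simp: elementary_on_def grid_def constant_between_def)
  show "AE \<omega> in M. (\<lambda>k::nat. elementary_integral 1 (\<lambda>i. if i = 0 then 0 else T) (\<lambda>_ _. 0) \<omega>) \<longlonglongrightarrow> 0"
    by (simp add: elementary_integral_def grid_sum_def)
qed auto

text \<open>The approximating integrands are brought onto a common grid, where elementary integrals are linear.\<close>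
lemma ito_limit_linear:
  assumes "ito_limit T H Z" "ito_limit T K Y"
  shows "ito_limit T (\<lambda>s \<omega>. a * H s \<omega> + b * K s \<omega>) (\<lambda>\<omega>. a * Z \<omega> + b * Y \<omega>)"
proof -
  obtain n q h where h0: "\<forall>k. elementary_on T (n k) (q k) (h k)"
    and limh: "AE \<omega> in M. (\<lambda>k. \<integral>\<^sup>+s. ennreal ((h k s \<omega> - H s \<omega>)\<^sup>2) \<partial>lborel) \<longlonglongrightarrow> 0"
    and limZ: "AE \<omega> in M. (\<lambda>k. elementary_integral (n k) (q k) (h k) \<omega>) \<longlonglongrightarrow> Z \<omega>"
    using assms(1) by (rule ito_limitE)
  note h = spec[OF h0]
  obtain m r g where g0: "\<forall>k. elementary_on T (m k) (r k) (g k)"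
    and limg: "AE \<omega> in M. (\<lambda>k. \<integral>\<^sup>+s. ennreal ((g k s \<omega> - K s \<omega>)\<^sup>2) \<partial>lborel) \<longlonglongrightarrow> 0"
    and limY: "AE \<omega> in M. (\<lambda>k. elementary_integral (m k) (r k) (g k) \<omega>) \<longlonglongrightarrow> Y \<omega>"
    using assms(2) by (rule ito_limitE)
  note g = spec[OF g0]
  have jm: "jointly_measurable M H" "jointly_measurable M K"
    and [measurable]: "Z \<in> borel_measurable M" "Y \<in> borel_measurable M"
    and fin: "AE \<omega> in M. (\<integral>\<^sup>+s. ennreal ((H s \<omega>)\<^sup>2) \<partial>lborel) < \<infinity>"
     "AE \<omega> in M. (\<integral>\<^sup>+s. ennreal ((K s \<omega>)\<^sup>2) \<partial>lborel) < \<infinity>"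
    by (rule ito_limitD[OF assms(1)] ito_limitD[OF assms(2)])+
  have "\<exists>l p. grid T l p \<and> q k ` {..n k} \<subseteq> p ` {..l} \<and> r k ` {..m k} \<subseteq> p ` {..l}" for k
    using common_refinement[of T "n k" "q k" "m k" "r k" "{}"] h[of k] g[of k]
    by (auto simp: elementary_on_def)
  then obtain l p where p: "\<And>k. grid T (l k) (p k)" "\<And>k. q k ` {..n k} \<subseteq> p k ` {..l k}"
    "\<And>k. r k ` {..m k} \<subseteq> p k ` {..l k}" by metis
  note h' = elementary_on_refine[OF h p(1,2)] and g' = elementary_on_refine[OF g p(1,3)]
  have bound: "(\<integral>\<^sup>+s. ennreal ((a * u s + b * v s)\<^sup>2) \<partial>lborel)
      \<le> ennreal (2 * a\<^sup>2) * (\<integral>\<^sup>+s. ennreal ((u s)\<^sup>2) \<partial>lborel) + ennreal (2 * b\<^sup>2) * (\<integral>\<^sup>+s. ennreal ((v s)\<^sup>2) \<partial>lborel)"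
    if [measurable]: "u \<in> borel_measurable borel" "v \<in> borel_measurable borel" for u v :: "real \<Rightarrow> real"
  proof -
    have "(\<integral>\<^sup>+s. ennreal ((a * u s + b * v s)\<^sup>2) \<partial>lborel)
      \<le> (\<integral>\<^sup>+s. ennreal (2 * a\<^sup>2) * ennreal ((u s)\<^sup>2) + ennreal (2 * b\<^sup>2) * ennreal ((v s)\<^sup>2) \<partial>lborel)"
    proof (rule nn_integral_mono)
      fix s
      have "(a * u s + b * v s)\<^sup>2 \<le> 2 * a\<^sup>2 * (u s)\<^sup>2 + 2 * b\<^sup>2 * (v s)\<^sup>2"
        using square_add_le[of 1 "a * u s" "b * v s"] by (simp add: power_mult_distrib)
      then show "ennreal ((a * u s + b * v s)\<^sup>2) \<le> ennreal (2 * a\<^sup>2) * ennreal ((u s)\<^sup>2) + ennreal (2 * b\<^sup>2) * ennreal ((v s)\<^sup>2)"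
        by (simp add: ennreal_mult[symmetric] ennreal_plus[symmetric] ennreal_leI del: ennreal_plus)
    qed
    then show ?thesis by (simp add: nn_integral_add nn_integral_cmult)
  qed
  show ?thesis unfolding ito_limit_def
  proof (intro conjI exI allI)
    show "jointly_measurable M (\<lambda>s \<omega>. a * H s \<omega> + b * K s \<omega>)" by (rule jointly_measurable_linear[OF jm])
    show "(\<lambda>\<omega>. a * Z \<omega> + b * Y \<omega>) \<in> borel_measurable M" by measurable
    show "AE \<omega> in M. (\<integral>\<^sup>+s. ennreal ((a * H s \<omega> + b * K s \<omega>)\<^sup>2) \<partial>lborel) < \<infinity>"
      using fin AE_space
    proof eventually_elim
      case (elim \<omega>)
      show ?case
        by (rule le_less_trans[OF bound[OF jointly_measurable_section[OF jm(1) elim(3)] jointly_measurable_section[OF jm(2) elim(3)]]])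
           (use elim in \<open>simp add: ennreal_mult_less_top\<close>)
    qed
    show "elementary_on T (l k) (p k) (\<lambda>s \<omega>. a * h k s \<omega> + b * g k s \<omega>)" for k
      by (rule elementary_on_add[OF h' g'])
    show "AE \<omega> in M. (\<lambda>k. \<integral>\<^sup>+s. ennreal ((a * h k s \<omega> + b * g k s \<omega> - (a * H s \<omega> + b * K s \<omega>))\<^sup>2) \<partial>lborel) \<longlonglongrightarrow> 0"
      using limh limg AE_space
    proof eventually_elim
      case (elim \<omega>)
      note [measurable] = jointly_measurable_section[OF jm(1) elim(3)] jointly_measurable_section[OF jm(2) elim(3)]
        elementary_section_measurable[OF h] elementary_section_measurable[OF g]
      have eq: "a * h k s \<omega> + b * g k s \<omega> - (a * H s \<omega> + b * K s \<omega>)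
        = a * (h k s \<omega> - H s \<omega>) + b * (g k s \<omega> - K s \<omega>)" for k s by (simp add: algebra_simps)
      have lim: "(\<lambda>k. ennreal (2 * a\<^sup>2) * (\<integral>\<^sup>+s. ennreal ((h k s \<omega> - H s \<omega>)\<^sup>2) \<partial>lborel)
          + ennreal (2 * b\<^sup>2) * (\<integral>\<^sup>+s. ennreal ((g k s \<omega> - K s \<omega>)\<^sup>2) \<partial>lborel)) \<longlonglongrightarrow> ennreal (2 * a\<^sup>2) * 0 + ennreal (2 * b\<^sup>2) * 0"
        by (intro tendsto_add tendsto_mult_ennreal tendsto_const elim(1,2)) auto
      show ?case unfolding eq
        by (rule tendsto_sandwich[OF _ _ tendsto_const, of _ _ _ "\<lambda>k. ennreal (2 * a\<^sup>2) * (\<integral>\<^sup>+s. ennreal ((h k s \<omega> - H s \<omega>)\<^sup>2) \<partial>lborel)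
          + ennreal (2 * b\<^sup>2) * (\<integral>\<^sup>+s. ennreal ((g k s \<omega> - K s \<omega>)\<^sup>2) \<partial>lborel)"])
           (use lim in \<open>auto intro!: always_eventually bound\<close>)
    qed
    show "AE \<omega> in M. (\<lambda>k. elementary_integral (l k) (p k) (\<lambda>s \<omega>. a * h k s \<omega> + b * g k s \<omega>) \<omega>)
        \<longlonglongrightarrow> a * Z \<omega> + b * Y \<omega>"
      using limZ limY
    proof eventually_elim
      case (elim \<omega>)
      show ?case
        unfolding elementary_integral_add elementary_integral_refine[OF h p(1,2)]
          elementary_integral_refine[OF g p(1,3)]
        by (intro tendsto_intros elim)
    qed
  qed
qed

end

section \<open>From the Ito integral to limits of elementary integrals\<close>

lemma tendsto_uniform_floor: "(\<lambda>k. real_of_int \<lfloor>real (Suc k) * s\<rfloor> / real (Suc k)) \<longlonglongrightarrow> s"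
proof (rule LIMSEQ_I)
  fix e :: real assume "0 < e"
  then obtain N where N: "1 / real (Suc N) < e" using nat_approx_posE by blast
  have "norm (real_of_int \<lfloor>real (Suc k) * s\<rfloor> / real (Suc k) - s) < e" if "N \<le> k" for k
  proof -
    have "\<bar>real_of_int \<lfloor>real (Suc k) * s\<rfloor> - real (Suc k) * s\<bar> \<le> 1" by linarith
    then have "\<bar>real_of_int \<lfloor>real (Suc k) * s\<rfloor> - real (Suc k) * s\<bar> / real (Suc k) \<le> 1 / real (Suc k)"
      by (rule divide_right_mono) simp
    moreover have "real_of_int \<lfloor>real (Suc k) * s\<rfloor> / real (Suc k) - s
       = (real_of_int \<lfloor>real (Suc k) * s\<rfloor> - real (Suc k) * s) / real (Suc k)"
      by (simp add: field_simps del: of_nat_Suc)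
    moreover have "1 / real (Suc k) \<le> 1 / real (Suc N)" using that by (intro divide_left_mono) auto
    ultimately show ?thesis using N by (simp del: of_nat_Suc)
  qed
  then show "\<exists>N. \<forall>k\<ge>N. norm (real_of_int \<lfloor>real (Suc k) * s\<rfloor> / real (Suc k) - s) < e" by blast
qed

context filtered_brownian
begin

lemma adapted_measurable: "adapted_on F {0..T} Y \<Longrightarrow> t \<in> {0..T} \<Longrightarrow> Y t \<in> borel_measurable M"
  unfolding adapted_on_def by (rule F_measurable_M[of _ t]) (rule bspec)

text \<open>Clamping the time variable to \<open>{0..T}\<close> turns measurability on the restricted space into measurability
  on the whole line.\<close>
lemma progressive_jointly_measurable:
  assumes "progressive F T H" "0 \<le> T"
  shows "jointly_measurable M (\<lambda>s. H (max 0 (min T s)))"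
proof -
  have H: "(\<lambda>(s, \<omega>). H s \<omega>) \<in> borel_measurable (restrict_space borel {0..T} \<Otimes>\<^sub>M F T)"
    using assms by (auto simp: progressive_def)
  have 1: "(\<lambda>x. max 0 (min T (fst x))) \<in> measurable (borel \<Otimes>\<^sub>M M) (restrict_space borel {0..T})"
    by (rule measurable_restrict_space2) (use assms(2) in auto)
  have "(\<lambda>\<omega>. \<omega>) \<in> measurable M (F T)"
    using F_subset[of T] by (intro measurableI) (auto simp: Int_absorb2 sets.sets_into_space)
  then have 2: "snd \<in> measurable (borel \<Otimes>\<^sub>M M) (F T)"
    using measurable_compose[OF measurable_snd] by blast
  show ?thesis
    using measurable_compose[OF measurable_Pair[OF 1 2] H] by (simp add: jointly_measurable_def)
qed

text \<open>The process read off at the grid times \<open>\<lfloor>n s\<rfloor> / n\<close> is assembled from countably many random variables and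
  converges to \<open>Y\<close> wherever the path is continuous.\<close>
lemma continuous_jointly_measurable_version:
  assumes "adapted_on F {0..T} Y" "continuous_paths_on M {0..T} Y" "0 \<le> T"
  shows "\<exists>Y'. jointly_measurable M Y' \<and> (AE \<omega> in M. \<forall>s\<in>{0..T}. Y' s \<omega> = Y s \<omega>)"
proof -
  define c where "c s = max 0 (min T s)" for s
  have c: "c s \<in> {0..T}" for s using assms(3) by (auto simp: c_def)
  define U where "U k s \<omega> = Y (c (real_of_int \<lfloor>real (Suc k) * s\<rfloor> / real (Suc k))) \<omega>" for k s \<omega>
  have Um: "(\<lambda>x. U k (fst x) (snd x)) \<in> borel_measurable (borel \<Otimes>\<^sub>M M)" for k
    unfolding U_def
  proof (rule measurable_compose_countable[where f = "\<lambda>i x. Y (c (real_of_int i / real (Suc k))) (snd x)" and g = "\<lambda>x. \<lfloor>real (Suc k) * fst x\<rfloor>"])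
    show "(\<lambda>x. Y (c (real_of_int i / real (Suc k))) (snd x)) \<in> borel_measurable (borel \<Otimes>\<^sub>M M)" for i
      by (rule measurable_compose[OF measurable_snd adapted_measurable[OF assms(1) c]])
    show "(\<lambda>x. \<lfloor>real (Suc k) * fst x\<rfloor>) \<in> measurable (borel \<Otimes>\<^sub>M M) (count_space UNIV)"
      by measurable
  qed
  define Y' where "Y' s \<omega> = lim (\<lambda>k. U k s \<omega>)" for s \<omega>
  have "jointly_measurable M Y'" unfolding jointly_measurable_def Y'_def
    by (rule borel_measurable_lim_metric) (rule Um)
  moreover have "AE \<omega> in M. \<forall>s\<in>{0..T}. Y' s \<omega> = Y s \<omega>"
    using assms(2) unfolding continuous_paths_on_def
  proof eventually_elim
    case (elim \<omega>)
    show ?case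
    proof
      fix s assume s: "s \<in> {0..T}"
      have "(\<lambda>k. c (real_of_int \<lfloor>real (Suc k) * s\<rfloor> / real (Suc k))) \<longlonglongrightarrow> c s"
        unfolding c_def by (intro tendsto_max tendsto_min tendsto_const tendsto_uniform_floor)
      then have "(\<lambda>k. c (real_of_int \<lfloor>real (Suc k) * s\<rfloor> / real (Suc k))) \<longlonglongrightarrow> s"
        using s by (simp add: c_def)
      then have "(\<lambda>k. U k s \<omega>) \<longlonglongrightarrow> Y s \<omega>"
        unfolding U_def by (rule continuous_on_tendsto_compose[OF elim _ s]) (intro always_eventually allI c)
      then show "Y' s \<omega> = Y s \<omega>" unfolding Y'_def by (rule limI)
    qed
  qed
  ultimately show ?thesis by blast
qed

lemma simple_process_at:
  assumes "simple_integrand M F T (n, p, \<xi>)" "i < n" "s \<in> {p i<..p (Suc i)}"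
  shows "simple_process (n, p, \<xi>) s = \<xi> i"
proof
  have "grid T n p" using assms(1) by (auto simp: simple_integrand_def grid_def)
  then show "simple_process (n, p, \<xi>) s \<omega> = \<xi> i \<omega>" for \<omega>
    using sum_grid_indicator[of T n p i s "\<lambda>i. \<xi> i \<omega>"] assms(2,3) by (simp add: simple_process_def)
qed

lemma simple_process_elementary:
  assumes h: "simple_integrand M F T (n, p, \<xi>)"
  shows "elementary_on T n p (simple_process (n, p, \<xi>))"
proof -
  have g: "grid T n p" using h by (auto simp: simple_integrand_def grid_def)
  have right: "simple_process (n, p, \<xi>) (p (Suc i)) = \<xi> i" if "i < n" for i
    by (rule simple_process_at[OF h that]) (use grid_less[OF g, of i "Suc i"] that in auto)
  have zero: "simple_process (n, p, \<xi>) s = (\<lambda>_. 0)" if "s \<notin> {0<..T}" for s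
  proof
    fix \<omega>
    have "s \<notin> {p i<..p (Suc i)}" if "i < n" for i
      using grid_bounds[OF g, of i] grid_bounds[OF g, of "Suc i"] that \<open>s \<notin> {0<..T}\<close> by auto
    then have "(\<Sum>i<n. \<xi> i \<omega> * indicator {p i<..p (Suc i)} s) = 0" by (intro sum.neutral) auto
    then show "simple_process (n, p, \<xi>) s \<omega> = 0" by (simp add: simple_process_def)
  qed
  have "constant_between n p (simple_process (n, p, \<xi>))"
    unfolding constant_between_def
  proof (intro allI impI ballI)
    fix i s assume "i < n" "s \<in> {p i<..p (Suc i)}"
    then show "simple_process (n, p, \<xi>) s = simple_process (n, p, \<xi>) (p (Suc i))"
      by (rule simple_process_at[OF h, THEN trans]) (rule right[symmetric], fact)
  qed
  moreover have "\<xi> i \<in> borel_measurable (F (p i)) \<and> (\<exists>C. \<forall>\<omega>\<in>space M. \<bar>\<xi> i \<omega>\<bar> \<le> C)" if "i < n" for i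
    using h that by (auto simp: simple_integrand_def)
  ultimately show ?thesis unfolding elementary_on_def using g zero right by simp
qed

text \<open>The point \<open>t\<close> is added to the grid. Each interval then lies on one side of \<open>t\<close>, so that truncation of the
  integrand at \<open>t\<close> and stopping of the integrator at \<open>t\<close> have the same effect on every summand.\<close>
lemma elementary_stop:
  assumes h: "elementary_on T n q h" and t: "t \<in> {0..T}"
  obtains m r where "elementary_on T m r (\<lambda>s \<omega>. indicator {0<..t} s * h s \<omega>)"
    "elementary_integral m r (\<lambda>s \<omega>. indicator {0<..t} s * h s \<omega>)
       = (\<lambda>\<omega>. grid_sum n q (\<lambda>s. h s \<omega>) (\<lambda>s. W (min s t) \<omega>))"
proof -
  have q: "grid T n q" using h by (simp add: elementary_on_def)
  obtain m r where r: "grid T m r" "q ` {..n} \<subseteq> r ` {..m}" "t \<in> r ` {..m}"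
    using common_refinement[OF q q, of "{t}"] t by auto
  then obtain l where l: "l \<le> m" "t = r l" by auto
  have hr: "elementary_on T m r h" by (rule elementary_on_refine[OF h r(1,2)])
  let ?g = "\<lambda>s \<omega>. indicator {0<..t} s * h s \<omega>"
  have before: "s \<le> t" if "i < l" "s \<le> r (Suc i)" for i s
    using grid_le[OF r(1), of "Suc i" l] l that by auto
  have after: "t < s" if "l \<le> i" "i < m" "r i < s" for i s
    using grid_le[OF r(1), of l i] l that by auto
  have g1: "?g s = h s" if "i < l" "s \<in> {r i<..r (Suc i)}" for i s
    using before[OF that(1), of s] that grid_bounds[OF r(1), of i] l by auto
  have g2: "?g s = (\<lambda>_. 0)" if "l \<le> i" "i < m" "s \<in> {r i<..r (Suc i)}" for i s
    using after[OF that(1,2), of s] that(3) by auto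
  have rr: "r (Suc i) \<in> {r i<..r (Suc i)}" if "i < m" for i
    using grid_less[OF r(1), of i "Suc i"] that by simp
  have chr: "constant_between m r h" using hr by (simp add: elementary_on_def)
  have "elementary_on T m r ?g"
    unfolding elementary_on_def
  proof (intro conjI allI impI)
    show "constant_between m r ?g"
      unfolding constant_between_def
    proof (intro allI impI ballI)
      fix i s assume i: "i < m" and s: "s \<in> {r i<..r (Suc i)}"
      show "?g s = ?g (r (Suc i))"
      proof (cases "i < l")
        case True
        have "h s = h (r (Suc i))" using constant_betweenD[OF chr i, of s] s by simp
        then show ?thesis by (rule trans[OF g1[OF True s] trans[OF _ g1[OF True rr[OF i], symmetric]]])
      next
        case False
        then have l: "l \<le> i" by simp
        show ?thesis by (rule trans[OF g2[OF l i s] g2[OF l i rr[OF i], symmetric]])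
      qed
    qed
    fix i assume i: "i < m"
    have hi: "h (r (Suc i)) \<in> borel_measurable (F (r i))" "\<exists>C. \<forall>\<omega>\<in>space M. \<bar>h (r (Suc i)) \<omega>\<bar> \<le> C"
      using hr i by (auto simp: elementary_on_def)
    consider "?g (r (Suc i)) = h (r (Suc i))" | "?g (r (Suc i)) = (\<lambda>_. 0)"
      using g1[OF _ rr[OF i]] g2[OF _ i rr[OF i]] by (meson leI)
    note cs = this
    show "?g (r (Suc i)) \<in> borel_measurable (F (r i))"
      using cs by cases (simp_all only: hi(1) borel_measurable_const)
    show "\<exists>C. \<forall>\<omega>\<in>space M. \<bar>?g (r (Suc i)) \<omega>\<bar> \<le> C"
      using cs
    proof cases
      case 1
      obtain C where C: "\<forall>\<omega>\<in>space M. \<bar>h (r (Suc i)) \<omega>\<bar> \<le> C" using hi(2) by blast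
      show ?thesis
      proof (intro exI ballI)
        fix \<omega> assume "\<omega> \<in> space M"
        then show "\<bar>?g (r (Suc i)) \<omega>\<bar> \<le> C" using C by (subst fun_cong[OF 1, of \<omega>]) (rule bspec)
      qed
    next
      case 2
      show ?thesis by (intro exI[of _ 0] ballI, subst fun_cong[OF 2]) simp
    qed
  next
    fix s assume "s \<notin> {0<..T}"
    then have "s \<notin> {0<..t}" using t by auto
    then show "?g s = (\<lambda>_. 0)" by auto
  qed (rule r(1))
  moreover have "elementary_integral m r ?g \<omega> = grid_sum n q (\<lambda>s. h s \<omega>) (\<lambda>s. W (min s t) \<omega>)" for \<omega>
  proof -
    have "constant_between n q h" using h by (simp add: elementary_on_def)
    then have "constant_between n q (\<lambda>s. h s \<omega>)" unfolding constant_between_def by metis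
    then have "grid_sum n q (\<lambda>s. h s \<omega>) (\<lambda>s. W (min s t) \<omega>) = grid_sum m r (\<lambda>s. h s \<omega>) (\<lambda>s. W (min s t) \<omega>)"
      by (rule grid_sum_refine[OF q r(1,2), symmetric])
    also have "\<dots> = grid_sum m r (\<lambda>s. ?g s \<omega>) (\<lambda>s. W s \<omega>)"
      unfolding grid_sum_def
    proof (rule sum.cong[OF refl])
      fix i assume "i \<in> {..<m}"
      then have i: "i < m" by simp
      show "h (r (Suc i)) \<omega> * (W (min (r (Suc i)) t) \<omega> - W (min (r i) t) \<omega>)
          = ?g (r (Suc i)) \<omega> * (W (r (Suc i)) \<omega> - W (r i) \<omega>)"
      proof (cases "i < l")
        case True
        have "r (Suc i) \<le> t" using before[OF True order_refl] .
        moreover have "r i \<le> t" using calculation rr[OF i] by auto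
        ultimately show ?thesis using fun_cong[OF g1[OF True rr[OF i]], of \<omega>]
          by (simp only: min_absorb1)
      next
        case False
        have "t \<le> r i" using grid_le[OF r(1), of l i] l i False by simp
        moreover have "t \<le> r (Suc i)" using calculation rr[OF i] by auto
        moreover have "?g (r (Suc i)) \<omega> = 0" using fun_cong[OF g2[OF _ i rr[OF i]], of \<omega>] False by simp
        ultimately show ?thesis by (simp only: min_absorb2 diff_self mult_zero_right mult_zero_left)
      qed
    qed
    finally show ?thesis by (simp add: elementary_integral_def)
  qed
  ultimately show ?thesis using that by blast
qed

lemma simple_ito_integral_grid_sum:
  assumes h: "simple_integrand M F T (n, p, \<xi>)"
  shows "simple_ito_integral W (n, p, \<xi>) t \<omega>
    = grid_sum n p (\<lambda>s. simple_process (n, p, \<xi>) s \<omega>) (\<lambda>s. W (min s t) \<omega>)"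
proof -
  have g: "grid T n p" using h by (auto simp: simple_integrand_def grid_def)
  have right: "simple_process (n, p, \<xi>) (p (Suc i)) = \<xi> i" if "i < n" for i
    by (rule simple_process_at[OF h that]) (use grid_less[OF g, of i "Suc i"] that in auto)
  show ?thesis unfolding simple_ito_integral_def grid_sum_def prod.case
    by (rule sum.cong[OF refl]) (simp only: right lessThan_iff)
qed

lemma simple_ito_integral_measurable:
  assumes h: "simple_integrand M F T hh" and t: "t \<in> {0..T}"
  shows "simple_ito_integral W hh t \<in> borel_measurable M"
proof -
  obtain n p \<xi> where hh: "hh = (n, p, \<xi>)" by (cases hh)
  note h = h[unfolded hh]
  obtain m r where el: "elementary_on T m r (\<lambda>s \<omega>. indicator {0<..t} s * simple_process (n, p, \<xi>) s \<omega>)"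
    and eq: "elementary_integral m r (\<lambda>s \<omega>. indicator {0<..t} s * simple_process (n, p, \<xi>) s \<omega>)
       = (\<lambda>\<omega>. grid_sum n p (\<lambda>s. simple_process (n, p, \<xi>) s \<omega>) (\<lambda>s. W (min s t) \<omega>))"
    using elementary_stop[OF simple_process_elementary[OF h] t] by blast
  have "simple_ito_integral W hh t
      = (\<lambda>\<omega>. grid_sum n p (\<lambda>s. simple_process (n, p, \<xi>) s \<omega>) (\<lambda>s. W (min s t) \<omega>))"
    unfolding hh by (rule ext) (rule simple_ito_integral_grid_sum[OF h])
  then show ?thesis using elementary_integral_measurable[OF el] unfolding eq by simp
qed

lemma elementary_jointly_measurable:
  assumes "elementary_on T n q h"
  shows "jointly_measurable M h"
  unfolding jointly_measurable_def
proof -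
  have "h (q (Suc i)) \<in> borel_measurable M" if "i < n" for i
    using assms that F_measurable_M by (auto simp: elementary_on_def)
  then have "(\<lambda>x. \<Sum>i<n. h (q (Suc i)) (snd x) * indicator {q i<..q (Suc i)} (fst x)) \<in> borel_measurable (borel \<Otimes>\<^sub>M M)"
    by (intro borel_measurable_sum borel_measurable_times measurable_compose[OF measurable_snd]
         measurable_compose[OF measurable_fst borel_measurable_indicator]) auto
  moreover have "(\<lambda>x. h (fst x) (snd x)) = (\<lambda>x. \<Sum>i<n. h (q (Suc i)) (snd x) * indicator {q i<..q (Suc i)} (fst x))"
    by (rule ext) (rule elementary_expand[OF assms])
  ultimately show "(\<lambda>x. h (fst x) (snd x)) \<in> borel_measurable (borel \<Otimes>\<^sub>M M)" by simp
qed

lemma elementary_bounded: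
  assumes "elementary_on T n q h" "\<omega> \<in> space M"
  shows "\<exists>C. \<forall>s. \<bar>h s \<omega>\<bar> \<le> C"
proof (intro exI allI)
  fix s
  have "\<bar>h s \<omega>\<bar> \<le> (\<Sum>i<n. \<bar>h (q (Suc i)) \<omega> * indicator {q i<..q (Suc i)} s\<bar>)"
    using elementary_expand[OF assms(1), of s \<omega>] sum_abs[of "\<lambda>i. h (q (Suc i)) \<omega> * indicator {q i<..q (Suc i)} s" "{..<n}"] by simp
  also have "\<dots> \<le> (\<Sum>i<n. \<bar>h (q (Suc i)) \<omega>\<bar>)"
    by (intro sum_mono) (auto simp: indicator_def)
  finally show "\<bar>h s \<omega>\<bar> \<le> (\<Sum>i<n. \<bar>h (q (Suc i)) \<omega>\<bar>)" .
qed

text \<open>The approximations of the whole integral, truncated at \<open>t\<close>, approximate the integral up to time \<open>t\<close>.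
  Two successive subsequences make the square integrals and the integrals converge almost everywhere.\<close>
lemma has_ito_integral_imp_ito_limit:
  assumes I: "has_ito_integral M F W T H I" and t: "t \<in> {0..T}"
  shows "ito_limit T (\<lambda>s \<omega>. indicator {0<..t} s * H s \<omega>) (I t)"
proof -
  have T: "0 \<le> T" using t by simp
  have prog: "progressive F T H" and sq: "AE \<omega> in M. set_integrable lborel {0..T} (\<lambda>s. (H s \<omega>)\<^sup>2)"
    and ad: "adapted_on F {0..T} I"
    and "\<exists>h. (\<forall>n. simple_integrand M F T (h n)) \<and>
          tendsto_in_prob M (\<lambda>n \<omega>. LBINT s:{0..T}. (simple_process (h n) s \<omega> - H s \<omega>)\<^sup>2) (\<lambda>\<omega>. 0) \<and>
          (\<forall>t\<in>{0..T}. tendsto_in_prob M (\<lambda>n. simple_ito_integral W (h n) t) (I t))"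
    using I unfolding has_ito_integral_def by - (elim conjE, assumption)+
  then obtain h where h: "\<forall>n. simple_integrand M F T (h n)"
    and lim: "tendsto_in_prob M (\<lambda>n \<omega>. LBINT s:{0..T}. (simple_process (h n) s \<omega> - H s \<omega>)\<^sup>2) (\<lambda>\<omega>. 0)"
    and limI: "\<forall>t\<in>{0..T}. tendsto_in_prob M (\<lambda>n. simple_ito_integral W (h n) t) (I t)"
    by (elim exE conjE)
  \<comment> \<open>off \<open>{0..T}\<close> nothing is known about \<open>H\<close>; the clamped process is jointly measurable everywhere\<close>
  define Hc where "Hc s = H (max 0 (min T s))" for s
  have Hc: "Hc s = H s" if "s \<in> {0..T}" for s using that by (simp add: Hc_def)
  have jm: "jointly_measurable M Hc" unfolding Hc_def by (rule progressive_jointly_measurable[OF prog T])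
  have el: "elementary_on T (fst (h k)) (fst (snd (h k))) (simple_process (h k))" for k
    using simple_process_elementary[of T "fst (h k)" "fst (snd (h k))" "snd (snd (h k))"] h by simp
  have jd: "jointly_measurable M (\<lambda>s \<omega>. indicator {0..T} s * (1 * simple_process (h k) s \<omega> + (-1) * Hc s \<omega>))" for k
    by (intro jointly_measurable_mult_indicator jointly_measurable_linear elementary_jointly_measurable[OF el] jm) simp
  define R where "R k \<omega> = (\<integral>\<^sup>+s. ennreal ((indicator {0..T} s * (1 * simple_process (h k) s \<omega> + (-1) * Hc s \<omega>))\<^sup>2) \<partial>lborel)" for k \<omega>
  define V where "V k \<omega> = (LBINT s:{0..T}. (simple_process (h k) s \<omega> - H s \<omega>)\<^sup>2)" for k \<omega>
  have Rm: "R k \<in> borel_measurable M" for k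
    unfolding R_def by (rule jointly_measurable_square_integral[OF jd])
  have VR': "V k \<omega> = enn2real (R k \<omega>)" if "\<omega> \<in> space M" for k \<omega>
  proof -
    have "V k \<omega> = (\<integral>s. (indicator {0..T} s * (1 * simple_process (h k) s \<omega> + (-1) * Hc s \<omega>))\<^sup>2 \<partial>lborel)"
      unfolding V_def set_lebesgue_integral_def
      by (intro Bochner_Integration.integral_cong) (auto simp: indicator_def Hc)
    also have "\<dots> = enn2real (R k \<omega>)" unfolding R_def
      using jointly_measurable_section[OF jd that, of k]
      by (intro integral_eq_nn_integral) auto
    finally show ?thesis .
  qed
  have Vm: "V k \<in> borel_measurable M" for k
  proof -
    have "(\<lambda>\<omega>. enn2real (R k \<omega>)) \<in> borel_measurable M" using Rm[of k] by measurable
    then show ?thesis using measurable_cong[of M "V k" "\<lambda>\<omega>. enn2real (R k \<omega>)" borel] VR' by simp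
  qed
  obtain r1 :: "nat \<Rightarrow> nat" where r1: "strict_mono r1" "AE \<omega> in M. (\<lambda>k. V (r1 k) \<omega>) \<longlonglongrightarrow> 0"
    using tendsto_in_prob_AE_subseq[OF finite_measure_axioms Vm _ lim[folded V_def]] by auto
  have limI': "tendsto_in_prob M (\<lambda>k. simple_ito_integral W (h (r1 k)) t) (I t)"
    using tendsto_in_prob_subseq[OF bspec[OF limI t] r1(1)] .
  obtain r2 :: "nat \<Rightarrow> nat" where r2: "strict_mono r2"
    "AE \<omega> in M. (\<lambda>k. simple_ito_integral W (h (r1 (r2 k))) t \<omega>) \<longlonglongrightarrow> I t \<omega>"
    using tendsto_in_prob_AE_subseq[OF finite_measure_axioms simple_ito_integral_measurable[OF spec[OF h] t]
        adapted_measurable[OF ad t] limI'] by blast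
  define g where "g k = h (r1 (r2 k))" for k
  have ex_el: "\<exists>m r. elementary_on T m r (\<lambda>s \<omega>. indicator {0<..t} s * simple_process (g k) s \<omega>) \<and>
      elementary_integral m r (\<lambda>s \<omega>. indicator {0<..t} s * simple_process (g k) s \<omega>) = simple_ito_integral W (g k) t" for k
  proof -
    obtain n p \<xi> where gk: "g k = (n, p, \<xi>)" by (cases "g k")
    have s: "simple_integrand M F T (n, p, \<xi>)" using h gk by (metis g_def)
    obtain m r where el: "elementary_on T m r (\<lambda>s \<omega>. indicator {0<..t} s * simple_process (n, p, \<xi>) s \<omega>)"
      and eq: "elementary_integral m r (\<lambda>s \<omega>. indicator {0<..t} s * simple_process (n, p, \<xi>) s \<omega>)
       = (\<lambda>\<omega>. grid_sum n p (\<lambda>s. simple_process (n, p, \<xi>) s \<omega>) (\<lambda>s. W (min s t) \<omega>))"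
      using elementary_stop[OF simple_process_elementary[OF s] t] by blast
    have "simple_ito_integral W (n, p, \<xi>) t
      = (\<lambda>\<omega>. grid_sum n p (\<lambda>s. simple_process (n, p, \<xi>) s \<omega>) (\<lambda>s. W (min s t) \<omega>))"
      by (rule ext) (rule simple_ito_integral_grid_sum[OF s])
    with el eq show ?thesis unfolding gk by (intro exI[of _ m] exI[of _ r]) simp
  qed
  have ch: "\<exists>n q. \<forall>k. P k (n k) (q k)" if "\<And>k::nat. \<exists>m r. P k m r"
    for P :: "nat \<Rightarrow> nat \<Rightarrow> (nat \<Rightarrow> real) \<Rightarrow> bool" using that by metis
  have "\<exists>n q. \<forall>k. elementary_on T (n k) (q k) (\<lambda>s \<omega>. indicator {0<..t} s * simple_process (g k) s \<omega>) \<and>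
      elementary_integral (n k) (q k) (\<lambda>s \<omega>. indicator {0<..t} s * simple_process (g k) s \<omega>) = simple_ito_integral W (g k) t"
    by (rule ch[OF ex_el])
  then obtain n q where nq0: "\<forall>k. elementary_on T (n k) (q k) (\<lambda>s \<omega>. indicator {0<..t} s * simple_process (g k) s \<omega>) \<and>
      elementary_integral (n k) (q k) (\<lambda>s \<omega>. indicator {0<..t} s * simple_process (g k) s \<omega>) = simple_ito_integral W (g k) t"
    by (elim exE)
  note nq = conjunct1[OF spec[OF nq0]] conjunct2[OF spec[OF nq0]]
  have Heq: "(\<lambda>s \<omega>. indicator {0<..t} s * H s \<omega>) = (\<lambda>s \<omega>. indicator {0<..t} s * Hc s \<omega>)"
    using t Hc by (intro ext) (auto simp: indicator_def)
  show ?thesis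
    unfolding ito_limit_def
  proof (intro conjI exI[of _ n] exI[of _ q] exI[of _ "\<lambda>k s \<omega>. indicator {0<..t} s * simple_process (g k) s \<omega>"] allI)
    show "jointly_measurable M (\<lambda>s \<omega>. indicator {0<..t} s * H s \<omega>)"
      unfolding Heq by (intro jointly_measurable_mult_indicator jm) simp
    show "I t \<in> borel_measurable M" by (rule adapted_measurable[OF ad t])
    show "AE \<omega> in M. (\<integral>\<^sup>+s. ennreal ((indicator {0<..t} s * H s \<omega>)\<^sup>2) \<partial>lborel) < \<infinity>"
      using sq
    proof eventually_elim
      case (elim \<omega>)
      have "(\<integral>\<^sup>+s. ennreal ((indicator {0<..t} s * H s \<omega>)\<^sup>2) \<partial>lborel)
         \<le> (\<integral>\<^sup>+s. ennreal (norm (indicator {0..T} s *\<^sub>R (H s \<omega>)\<^sup>2)) \<partial>lborel)"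
        using t by (intro nn_integral_mono ennreal_leI) (auto simp: indicator_def)
      also have "\<dots> < \<infinity>" using elim unfolding set_integrable_def integrable_iff_bounded by blast
      finally show ?case .
    qed
    show "elementary_on T (n k) (q k) (\<lambda>s \<omega>. indicator {0<..t} s * simple_process (g k) s \<omega>)" for k by (rule nq(1))
    show "AE \<omega> in M. (\<lambda>k. elementary_integral (n k) (q k) (\<lambda>s \<omega>. indicator {0<..t} s * simple_process (g k) s \<omega>) \<omega>) \<longlonglongrightarrow> I t \<omega>"
      using r2(2) by (simp only: nq(2) g_def[symmetric])
    show "AE \<omega> in M. (\<lambda>k. \<integral>\<^sup>+s. ennreal ((indicator {0<..t} s * simple_process (g k) s \<omega> - indicator {0<..t} s * H s \<omega>)\<^sup>2) \<partial>lborel) \<longlonglongrightarrow> 0"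
      using r1(2) sq AE_space
    proof eventually_elim
      case (elim \<omega>)
      \<comment> \<open>so far \<open>V\<close> is \<open>enn2real\<close> of \<open>R\<close>; convergence of \<open>V\<close> to \<open>0\<close> says something about \<open>R\<close> only once \<open>R\<close> is finite\<close>
      have fin: "R k \<omega> = ennreal (V k \<omega>)" for k
      proof -
        obtain C where C: "\<forall>s. \<bar>simple_process (h k) s \<omega>\<bar> \<le> C" using elementary_bounded[OF el elim(3), of k] by blast
        have "R k \<omega> \<le> (\<integral>\<^sup>+s. ennreal (2 * C\<^sup>2) * indicator {0..T} s
            + ennreal 2 * ennreal (norm (indicator {0..T} s *\<^sub>R (H s \<omega>)\<^sup>2)) \<partial>lborel)"
          unfolding R_def
        proof (rule nn_integral_mono)
          fix s
          show "ennreal ((indicator {0..T} s * (1 * simple_process (h k) s \<omega> + (-1) * Hc s \<omega>))\<^sup>2)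
            \<le> ennreal (2 * C\<^sup>2) * indicator {0..T} s + ennreal 2 * ennreal (norm (indicator {0..T} s *\<^sub>R (H s \<omega>)\<^sup>2))"
          proof (cases "s \<in> {0..T}")
            case True
            have "\<bar>simple_process (h k) s \<omega>\<bar>\<^sup>2 \<le> C\<^sup>2" using C by (intro power_mono) auto
            then have "(simple_process (h k) s \<omega> - H s \<omega>)\<^sup>2 \<le> 2 * C\<^sup>2 + 2 * (H s \<omega>)\<^sup>2"
              using square_add_le[of 1 "simple_process (h k) s \<omega>" "- H s \<omega>"] by simp
            then have "ennreal ((simple_process (h k) s \<omega> - H s \<omega>)\<^sup>2) \<le> ennreal (2 * C\<^sup>2) + ennreal (2 * (H s \<omega>)\<^sup>2)"
              by (subst ennreal_plus[symmetric]) (simp_all add: ennreal_leI del: ennreal_plus)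
            then show ?thesis using True by (simp add: Hc ennreal_mult)
          qed simp
        qed
        also have "\<dots> < \<infinity>"
        proof -
          have m: "(\<lambda>s. indicator {0..T} s *\<^sub>R (H s \<omega>)\<^sup>2) \<in> borel_measurable lborel"
            "(\<integral>\<^sup>+s. ennreal (norm (indicator {0..T} s *\<^sub>R (H s \<omega>)\<^sup>2)) \<partial>lborel) < \<infinity>"
            using elim(2) unfolding set_integrable_def integrable_iff_bounded by blast+
          show ?thesis
            using m T by (subst nn_integral_add) (auto simp: nn_integral_cmult ennreal_mult_less_top)
        qed
        finally show ?thesis using VR'[OF elim(3), of k] by simp
      qed
      have "strict_mono (\<lambda>k. r2 k)" using r2(1) by simp
      then have "(\<lambda>k. V (r1 (r2 k)) \<omega>) \<longlonglongrightarrow> 0" using LIMSEQ_subseq_LIMSEQ[OF elim(1) r2(1)] by (simp add: comp_def)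
      then have "(\<lambda>k. ennreal (V (r1 (r2 k)) \<omega>)) \<longlonglongrightarrow> ennreal 0" by (rule tendsto_ennrealI)
      then have lim0: "(\<lambda>k. R (r1 (r2 k)) \<omega>) \<longlonglongrightarrow> 0" by (simp add: fin)
      show ?case
      proof (rule tendsto_sandwich[OF _ _ tendsto_const lim0])
        show "\<forall>\<^sub>F k in sequentially. (\<integral>\<^sup>+s. ennreal ((indicator {0<..t} s * simple_process (g k) s \<omega> - indicator {0<..t} s * H s \<omega>)\<^sup>2) \<partial>lborel) \<le> R (r1 (r2 k)) \<omega>"
          unfolding R_def g_def
          using t by (intro always_eventually allI nn_integral_mono ennreal_leI) (auto simp: indicator_def Hc)
      qed simp
    qed
  qed
qed

end

section \<open>Step functions as deterministic integrands\<close>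

definition step_function :: "nat \<Rightarrow> (nat \<Rightarrow> real) \<Rightarrow> (nat \<Rightarrow> real) \<Rightarrow> real \<Rightarrow> real" where
  "step_function n p c s = (\<Sum>i<n. c i * indicator {p i<..p (Suc i)} s)"

lemma step_function_measurable [measurable]: "step_function n p c \<in> borel_measurable borel"
  unfolding step_function_def by measurable

lemma step_function_at:
  "grid T n p \<Longrightarrow> i < n \<Longrightarrow> s \<in> {p i<..p (Suc i)} \<Longrightarrow> step_function n p c s = c i"
  unfolding step_function_def by (rule sum_grid_indicator)

lemma step_function_outside:
  assumes p: "grid T n p" and s: "s \<notin> {0<..T}"
  shows "step_function n p c s = 0"
  unfolding step_function_def
proof (rule sum.neutral, rule ballI)
  fix i assume "i \<in> {..<n}"
  then have "s \<notin> {p i<..p (Suc i)}"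
    using grid_bounds[OF p, of i] grid_bounds[OF p, of "Suc i"] s by auto
  then show "c i * indicator {p i<..p (Suc i)} s = 0" by simp
qed

lemma continuous_step_approximation:
  fixes g :: "real \<Rightarrow> real"
  assumes g: "continuous_on {0..T} g" and T: "0 < T" and e: "0 < e" and C: "\<And>s. \<bar>g s\<bar> \<le> C"
  shows "\<exists>n p c. grid T n p \<and> (\<forall>s. \<bar>step_function n p c s\<bar> \<le> C) \<and>
    (\<forall>s\<in>{0<..T}. \<bar>step_function n p c s - g s\<bar> \<le> e)"
proof -
  have "uniformly_continuous_on {0..T} g" by (rule compact_uniformly_continuous[OF g]) simp
  then obtain d where d: "0 < d" "\<And>s s'. s \<in> {0..T} \<Longrightarrow> s' \<in> {0..T} \<Longrightarrow> dist s' s < d \<Longrightarrow> dist (g s') (g s) < e"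
    using e unfolding uniformly_continuous_on_def by metis
  obtain n :: nat where n: "T / d < real n" using reals_Archimedean2 by blast
  then have n0: "0 < n" using T d(1) by (metis divide_pos_pos less_trans of_nat_0_less_iff)
  have Tn: "T / real n < d" using n n0 d(1) by (simp add: field_simps)
  define p where "p i = T * real i / real n" for i
  have p: "grid T n p" using n0 T by (auto simp: grid_def p_def divide_strict_right_mono)
  have step: "p (Suc i) - p i = T / real n" for i by (simp add: p_def add_divide_distrib distrib_left)
  define c where "c i = g (p (Suc i))" for i
  have close: "\<bar>step_function n p c s - g s\<bar> \<le> e \<and> \<bar>step_function n p c s\<bar> \<le> C" if s: "s \<in> {0<..T}" for s
  proof -
    obtain i where i: "i < n" "s \<in> {p i<..p (Suc i)}" using grid_cover[OF p] s by auto
    have v: "step_function n p c s = g (p (Suc i))" using step_function_at[OF p i] by (simp add: c_def)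
    have "dist (p (Suc i)) s < d" using i(2) step[of i] Tn by (auto simp: dist_real_def)
    moreover have "p (Suc i) \<in> {0..T}" using grid_bounds[OF p, of "Suc i"] i by auto
    ultimately have "dist (g (p (Suc i))) (g s) < e" using d(2) s by auto
    then show ?thesis using v C by (simp add: dist_real_def)
  qed
  have "\<bar>step_function n p c s\<bar> \<le> C" for s
    using close[of s] step_function_outside[OF p, of s c] C[of 0] by (cases "s \<in> {0<..T}") auto
  then show ?thesis using p close by blast
qed

text \<open>A Borel function is the limit almost everywhere of continuous functions. These are truncated at \<open>C\<close>,
  and by uniform continuity each is close to a step function on \<open>{0<..T}\<close>.\<close>
lemma borel_step_approximation:
  fixes g :: "real \<Rightarrow> real"
  assumes g: "g \<in> borel_measurable borel" and C: "\<And>s. \<bar>g s\<bar> \<le> C" and T: "0 < T"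
  obtains n p c where "\<forall>k. grid T (n k) (p k)" "\<forall>k s. \<bar>step_function (n k) (p k) (c k) s\<bar> \<le> C"
    "AE s in lborel. s \<in> {0..T} \<longrightarrow> (\<lambda>k. step_function (n k) (p k) (c k) s) \<longlonglongrightarrow> g s"
proof -
  have "g \<in> borel_measurable lebesgue" using g by (simp add: measurable_completion)
  then have "g measurable_on UNIV" by (intro lebesgue_measurable_imp_measurable_on) auto
  then obtain N f where N: "negligible N" and f: "\<And>k. continuous_on UNIV (f k)"
    and lim: "\<And>s. s \<notin> N \<Longrightarrow> (\<lambda>k::nat. f k s) \<longlonglongrightarrow> g s"
    unfolding measurable_on_def by auto
  define h where "h k s = max (- C) (min C (f k s))" for k s
  have C0: "0 \<le> C" using C[of 0] by linarith
  have hC: "\<bar>h k s\<bar> \<le> C" for k s using C0 by (auto simp: h_def)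
  have hc: "continuous_on {0..T} (h k)" for k
    unfolding h_def by (intro continuous_intros continuous_on_subset[OF f]) auto
  have ex: "\<exists>n p c. grid T n p \<and> (\<forall>s. \<bar>step_function n p c s\<bar> \<le> C) \<and>
    (\<forall>s\<in>{0<..T}. \<bar>step_function n p c s - h k s\<bar> \<le> 1 / real (Suc k))" for k
    by (rule continuous_step_approximation[OF hc T _ hC]) simp
  have ch: "\<exists>n p c. \<forall>k. P k (n k) (p k) (c k)" if "\<And>k. \<exists>n p c. P k n p c"
    for P :: "nat \<Rightarrow> nat \<Rightarrow> (nat \<Rightarrow> real) \<Rightarrow> (nat \<Rightarrow> real) \<Rightarrow> bool" using that by metis
  have "\<exists>n p c. \<forall>k. grid T (n k) (p k) \<and> (\<forall>s. \<bar>step_function (n k) (p k) (c k) s\<bar> \<le> C) \<and>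
    (\<forall>s\<in>{0<..T}. \<bar>step_function (n k) (p k) (c k) s - h k s\<bar> \<le> 1 / real (Suc k))"
    by (rule ch[OF ex])
  then obtain n p c where npc: "\<forall>k. grid T (n k) (p k) \<and> (\<forall>s. \<bar>step_function (n k) (p k) (c k) s\<bar> \<le> C) \<and>
    (\<forall>s\<in>{0<..T}. \<bar>step_function (n k) (p k) (c k) s - h k s\<bar> \<le> 1 / real (Suc k))"
    by (elim exE)
  show ?thesis
  proof (rule that[of n p c])
    show "\<forall>k. grid T (n k) (p k)" "\<forall>k s. \<bar>step_function (n k) (p k) (c k) s\<bar> \<le> C" using npc by auto
    have "AE s in lebesgue. s \<notin> N" using N by (intro AE_not_in) (simp add: negligible_iff_null_sets)
    then have "AE s in lborel. s \<notin> N" by (simp add: AE_completion_iff)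
    moreover have "AE s in lborel. s \<noteq> (0::real)" by (rule AE_lborel_singleton)
    ultimately show "AE s in lborel. s \<in> {0..T} \<longrightarrow> (\<lambda>k. step_function (n k) (p k) (c k) s) \<longlonglongrightarrow> g s"
    proof eventually_elim
      case (elim s)
      show ?case
      proof
        assume "s \<in> {0..T}"
        then have s: "s \<in> {0<..T}" using elim(2) by auto
        have "(\<lambda>k. max (- C) (min C (f k s))) \<longlonglongrightarrow> max (- C) (min C (g s))"
          by (intro tendsto_intros lim elim(1))
        moreover have "max (- C) (min C (g s)) = g s" using C[of s] by (auto simp: abs_le_iff)
        ultimately have h: "(\<lambda>k. h k s) \<longlonglongrightarrow> g s" by (simp add: h_def)
        have "(\<lambda>k. step_function (n k) (p k) (c k) s - h k s) \<longlonglongrightarrow> 0"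
        proof (rule Lim_null_comparison)
          show "\<forall>\<^sub>F k in sequentially. norm (step_function (n k) (p k) (c k) s - h k s) \<le> 1 / real (Suc k)"
            using npc s by (intro always_eventually allI) (simp del: of_nat_Suc)
          show "(\<lambda>k. 1 / real (Suc k)) \<longlonglongrightarrow> 0" using LIMSEQ_inverse_real_of_nat by (simp add: inverse_eq_divide)
        qed
        from tendsto_add[OF this h] show "(\<lambda>k. step_function (n k) (p k) (c k) s) \<longlonglongrightarrow> g s" by simp
      qed
    qed
  qed
qed

lemma square_integral_multiplier_tendsto:
  fixes f \<gamma> :: "real \<Rightarrow> real" and \<gamma>' :: "nat \<Rightarrow> real \<Rightarrow> real"
  assumes [measurable]: "f \<in> borel_measurable borel" "\<gamma> \<in> borel_measurable borel" "\<And>k. \<gamma>' k \<in> borel_measurable borel"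
    and fin: "(\<integral>\<^sup>+s. ennreal ((f s)\<^sup>2) \<partial>lborel) < \<infinity>" and D: "\<And>k s. \<bar>\<gamma>' k s\<bar> \<le> D"
    and lim: "AE s in lborel. f s \<noteq> 0 \<longrightarrow> (\<lambda>k. \<gamma>' k s) \<longlonglongrightarrow> \<gamma> s"
  shows "(\<lambda>k. \<integral>\<^sup>+s. ennreal ((\<gamma>' k s * f s)\<^sup>2) \<partial>lborel) \<longlonglongrightarrow> (\<integral>\<^sup>+s. ennreal ((\<gamma> s * f s)\<^sup>2) \<partial>lborel)"
proof (rule nn_integral_dominated_convergence[where w = "\<lambda>s. ennreal (D\<^sup>2) * ennreal ((f s)\<^sup>2)"])
  show "AE s in lborel. ennreal ((\<gamma>' k s * f s)\<^sup>2) \<le> ennreal (D\<^sup>2) * ennreal ((f s)\<^sup>2)" for k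
  proof (rule AE_I2)
    fix s
    have "\<bar>\<gamma>' k s\<bar>\<^sup>2 \<le> D\<^sup>2" using D by (intro power_mono) auto
    then have "(\<gamma>' k s * f s)\<^sup>2 \<le> D\<^sup>2 * (f s)\<^sup>2"
      unfolding power_mult_distrib by (intro mult_right_mono) auto
    then show "ennreal ((\<gamma>' k s * f s)\<^sup>2) \<le> ennreal (D\<^sup>2) * ennreal ((f s)\<^sup>2)"
      by (simp add: ennreal_mult[symmetric] ennreal_leI)
  qed
  show "(\<integral>\<^sup>+s. ennreal (D\<^sup>2) * ennreal ((f s)\<^sup>2) \<partial>lborel) < \<infinity>"
    using fin by (simp add: nn_integral_cmult ennreal_mult_less_top)
  show "AE s in lborel. (\<lambda>k. ennreal ((\<gamma>' k s * f s)\<^sup>2)) \<longlonglongrightarrow> ennreal ((\<gamma> s * f s)\<^sup>2)"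
    using lim
  proof eventually_elim
    case (elim s)
    show ?case
    proof (cases "f s = 0")
      case False
      then show ?thesis using elim by (intro tendsto_ennrealI tendsto_intros) auto
    qed simp
  qed
qed measurable

lemma set_integral_multiplier_tendsto:
  fixes u \<gamma> :: "real \<Rightarrow> real" and \<gamma>' :: "nat \<Rightarrow> real \<Rightarrow> real"
  assumes u: "set_integrable lborel {0..T} u"
    and [measurable]: "\<gamma> \<in> borel_measurable borel" "\<And>k. \<gamma>' k \<in> borel_measurable borel"
    and D: "\<And>k s. \<bar>\<gamma>' k s\<bar> \<le> D"
    and lim: "AE s in lborel. s \<in> {0..T} \<longrightarrow> (\<lambda>k. \<gamma>' k s) \<longlonglongrightarrow> \<gamma> s"
  shows "(\<lambda>k. LBINT s:{0..T}. \<gamma>' k s * u s) \<longlonglongrightarrow> (LBINT s:{0..T}. \<gamma> s * u s)"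
proof -
  define U where "U s = indicator {0..T} s * u s" for s :: real
  have U: "integrable lborel U" using u by (simp add: set_integrable_def U_def[abs_def])
  note [measurable] = borel_measurable_integrable[OF U]
  have "(\<lambda>k. \<integral>s. \<gamma>' k s * U s \<partial>lborel) \<longlonglongrightarrow> (\<integral>s. \<gamma> s * U s \<partial>lborel)"
  proof (rule integral_dominated_convergence[where w = "\<lambda>s. D * \<bar>U s\<bar>"])
    show "integrable lborel (\<lambda>s. D * \<bar>U s\<bar>)" using U by simp
    show "AE s in lborel. (\<lambda>k. \<gamma>' k s * U s) \<longlonglongrightarrow> \<gamma> s * U s"
      using lim
    proof eventually_elim
      case (elim s)
      then show ?case by (cases "s \<in> {0..T}") (auto simp: U_def intro!: tendsto_intros)
    qed
    show "AE s in lborel. norm (\<gamma>' k s * U s) \<le> D * \<bar>U s\<bar>" for k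
      using D by (auto simp: abs_mult intro!: mult_right_mono)
  qed measurable
  then show ?thesis by (simp add: U_def set_lebesgue_integral_def mult.left_commute)
qed

lemma step_function_set_integral:
  fixes u :: "real \<Rightarrow> real"
  assumes p: "grid T n p" and u: "set_integrable lborel {0..T} u"
  shows "(LBINT s:{0..T}. step_function n p c s * u s)
    = (\<Sum>i<n. c i * ((LBINT s:{0..p (Suc i)}. u s) - (LBINT s:{0..p i}. u s)))"
proof -
  have sub: "set_integrable lborel A u" if "A \<subseteq> {0..T}" "A \<in> sets borel" for A
    by (rule set_integrable_subset[OF u]) (use that in auto)
  have piece: "(LBINT s:{0..p (Suc i)}. u s) - (LBINT s:{0..p i}. u s) = (LBINT s:{p i<..p (Suc i)}. u s)"
    and int: "set_integrable lborel {p i<..p (Suc i)} u" if i: "i < n" for i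
  proof -
    have b: "0 \<le> p i" "p i \<le> p (Suc i)" "p (Suc i) \<le> T"
      using grid_bounds[OF p, of i] grid_bounds[OF p, of "Suc i"] grid_less[OF p, of i "Suc i"] i by auto
    show "set_integrable lborel {p i<..p (Suc i)} u" by (rule sub) (use b in auto)
    have "{0..p (Suc i)} = {0..p i} \<union> {p i<..p (Suc i)}" using b by auto
    moreover have "(LBINT s:{0..p i} \<union> {p i<..p (Suc i)}. u s) = (LBINT s:{0..p i}. u s) + (LBINT s:{p i<..p (Suc i)}. u s)"
      by (rule set_integral_Un) (use b in \<open>auto intro!: sub\<close>)
    ultimately show "(LBINT s:{0..p (Suc i)}. u s) - (LBINT s:{0..p i}. u s) = (LBINT s:{p i<..p (Suc i)}. u s)" by simp
  qed
  have "(LBINT s:{0..T}. step_function n p c s * u s)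
      = (\<integral>s. (\<Sum>i<n. c i * (indicator {p i<..p (Suc i)} s * u s)) \<partial>lborel)"
    unfolding set_lebesgue_integral_def
  proof (rule Bochner_Integration.integral_cong[OF refl])
    fix s
    show "indicator {0..T} s *\<^sub>R (step_function n p c s * u s) = (\<Sum>i<n. c i * (indicator {p i<..p (Suc i)} s * u s))"
    proof -
      have "(\<Sum>i<n. c i * (indicator {p i<..p (Suc i)} s * u s)) = step_function n p c s * u s"
        unfolding step_function_def sum_distrib_right mult.assoc ..
      moreover have "step_function n p c s = 0" if "s \<notin> {0..T}"
        using that by (intro step_function_outside[OF p]) auto
      ultimately show ?thesis by (cases "s \<in> {0..T}") simp_all
    qed
  qed
  also have "\<dots> = (\<Sum>i<n. \<integral>s. c i * (indicator {p i<..p (Suc i)} s * u s) \<partial>lborel)"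
    using int by (intro Bochner_Integration.integral_sum) (simp add: set_integrable_def)
  also have "\<dots> = (\<Sum>i<n. c i * ((LBINT s:{0..p (Suc i)}. u s) - (LBINT s:{0..p i}. u s)))"
    by (intro sum.cong refl, subst piece) (simp_all add: set_lebesgue_integral_def)
  finally show ?thesis .
qed

context filtered_brownian
begin

text \<open>The events \<open>Q < c\<close> exhaust the space up to a null set as \<open>c\<close> grows.\<close>
lemma nn_integral_le_of_cutoffs:
  fixes Q f :: "'a \<Rightarrow> ennreal"
  assumes [measurable]: "Q \<in> borel_measurable M" "f \<in> borel_measurable M"
    and fin: "AE \<omega> in M. Q \<omega> < \<infinity>"
    and le: "\<And>c::real. 0 < c \<Longrightarrow> (\<integral>\<^sup>+\<omega>. indicator {\<omega>. Q \<omega> < ennreal c} \<omega> * f \<omega> \<partial>M) \<le> K"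
  shows "(\<integral>\<^sup>+\<omega>. f \<omega> \<partial>M) \<le> K"
proof -
  have "(\<integral>\<^sup>+\<omega>. f \<omega> \<partial>M)
     \<le> (\<integral>\<^sup>+\<omega>. liminf (\<lambda>k. indicator {\<omega>. Q \<omega> < ennreal (real (Suc k))} \<omega> * f \<omega>) \<partial>M)"
  proof (rule nn_integral_mono_AE)
    show "AE \<omega> in M. f \<omega> \<le> liminf (\<lambda>k. indicator {\<omega>. Q \<omega> < ennreal (real (Suc k))} \<omega> * f \<omega>)"
      using fin
    proof eventually_elim
      case (elim \<omega>)
      obtain u where u: "Q \<omega> = ennreal u" "0 \<le> u" using elim by (cases "Q \<omega>" rule: ennreal_cases) auto
      obtain N :: nat where N: "u < real N" using reals_Archimedean2 by blast
      have "eventually (\<lambda>k. f \<omega> \<le> indicator {\<omega>. Q \<omega> < ennreal (real (Suc k))} \<omega> * f \<omega>) sequentially"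
        using eventually_ge_at_top[of N]
      proof eventually_elim
        case (elim k)
        then have "u < real (Suc k)" using N by simp
        then have "Q \<omega> < ennreal (real (Suc k))" using u by (simp add: ennreal_less_iff del: of_nat_Suc)
        then show ?case by simp
      qed
      then show ?case by (rule Liminf_bounded)
    qed
  qed
  also have "\<dots> \<le> liminf (\<lambda>k. \<integral>\<^sup>+\<omega>. indicator {\<omega>. Q \<omega> < ennreal (real (Suc k))} \<omega> * f \<omega> \<partial>M)"
    by (rule nn_integral_liminf) measurable
  also have "\<dots> \<le> liminf (\<lambda>k::nat. K)"
    by (intro Liminf_mono always_eventually allI le) simp
  also have "\<dots> = K" by (simp add: Liminf_const)
  finally show ?thesis .
qed

lemma ito_limit_L2_bound:
  assumes I: "ito_limit T H Z"
  shows "(\<integral>\<^sup>+\<omega>. ennreal ((Z \<omega>)\<^sup>2) \<partial>M) \<le> (\<integral>\<^sup>+\<omega>. (\<integral>\<^sup>+s. ennreal ((H s \<omega>)\<^sup>2) \<partial>lborel) \<partial>M)"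
proof (rule nn_integral_le_of_cutoffs[OF jointly_measurable_square_integral[OF ito_limitD(1)[OF I]] _ ito_limitD(3)[OF I]])
  show "(\<lambda>\<omega>. ennreal ((Z \<omega>)\<^sup>2)) \<in> borel_measurable M" using ito_limitD(2)[OF I] by measurable
  let ?Q = "\<lambda>\<omega>. \<integral>\<^sup>+s. ennreal ((H s \<omega>)\<^sup>2) \<partial>lborel"
  fix c :: real assume "0 < c"
  then have "(\<integral>\<^sup>+\<omega>. indicator {\<omega>. ?Q \<omega> < ennreal c} \<omega> * ennreal ((Z \<omega>)\<^sup>2) \<partial>M)
      \<le> (\<integral>\<^sup>+\<omega>. min (ennreal c) (?Q \<omega>) \<partial>M)"
    by (intro ito_limit_cutoff_inequality[OF I]) simp
  also have "\<dots> \<le> (\<integral>\<^sup>+\<omega>. ?Q \<omega> \<partial>M)" by (intro nn_integral_mono) simp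
  finally show "(\<integral>\<^sup>+\<omega>. indicator {\<omega>. ?Q \<omega> < ennreal c} \<omega> * ennreal ((Z \<omega>)\<^sup>2) \<partial>M) \<le> (\<integral>\<^sup>+\<omega>. ?Q \<omega> \<partial>M)" .
qed

text \<open>Stochastic integrals become small in probability when the square integrals of their integrands do: on
  the event \<open>Q k < 1\<close> the second moment of \<open>Z k\<close> is at most \<open>E min 1 (Q k)\<close>, and eventually every path
  lies in that event.\<close>
lemma ito_limit_vanishing:
  assumes I: "\<And>k. ito_limit T (H k) (Z k)"
    and lim: "AE \<omega> in M. (\<lambda>k. \<integral>\<^sup>+s. ennreal ((H k s \<omega>)\<^sup>2) \<partial>lborel) \<longlonglongrightarrow> 0"
  shows "\<exists>r::nat \<Rightarrow> nat. strict_mono r \<and> (AE \<omega> in M. (\<lambda>k. Z (r k) \<omega>) \<longlonglongrightarrow> 0)"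
proof -
  define Q where "Q k \<omega> = (\<integral>\<^sup>+s. ennreal ((H k s \<omega>)\<^sup>2) \<partial>lborel)" for k \<omega>
  have Zm[measurable]: "Z k \<in> borel_measurable M" for k by (rule ito_limitD(2)[OF I])
  have Qm[measurable]: "Q k \<in> borel_measurable M" for k
    unfolding Q_def by (rule jointly_measurable_square_integral[OF ito_limitD(1)[OF I]])
  define Y where "Y k \<omega> = (if Q k \<omega> < 1 then Z k \<omega> else 0)" for k \<omega>
  have Ym[measurable]: "Y k \<in> borel_measurable M" for k unfolding Y_def by measurable
  have EY: "(\<integral>\<^sup>+\<omega>. ennreal ((Y k \<omega>)\<^sup>2) \<partial>M) \<le> (\<integral>\<^sup>+\<omega>. min 1 (Q k \<omega>) \<partial>M)" for k
  proof -
    have "(\<integral>\<^sup>+\<omega>. ennreal ((Y k \<omega>)\<^sup>2) \<partial>M) = (\<integral>\<^sup>+\<omega>. indicator {\<omega>. Q k \<omega> < ennreal 1} \<omega> * ennreal ((Z k \<omega>)\<^sup>2) \<partial>M)"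
      by (intro nn_integral_cong) (auto simp: Y_def)
    also have "\<dots> \<le> (\<integral>\<^sup>+\<omega>. min (ennreal 1) (Q k \<omega>) \<partial>M)"
      unfolding Q_def by (rule ito_limit_cutoff_inequality[OF I]) simp
    finally show ?thesis by simp
  qed
  have Q0: "(\<lambda>k. \<integral>\<^sup>+\<omega>. min 1 (Q k \<omega>) \<partial>M) \<longlonglongrightarrow> (\<integral>\<^sup>+\<omega>. 0 \<partial>M)"
  proof (rule nn_integral_dominated_convergence[where w = "\<lambda>_. 1"])
    show "AE \<omega> in M. (\<lambda>k. min 1 (Q k \<omega>)) \<longlonglongrightarrow> 0"
      using lim unfolding Q_def[symmetric]
    proof eventually_elim
      case (elim \<omega>)
      have "(\<lambda>k. min 1 (Q k \<omega>)) \<longlonglongrightarrow> min 1 0" by (intro tendsto_min tendsto_const elim)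
      then show ?case by simp
    qed
  qed (auto simp: emeasure_space_1)
  have "tendsto_in_prob M Y (\<lambda>_. 0)"
    unfolding tendsto_in_prob_def
  proof (intro allI impI)
    fix \<delta> :: real assume \<delta>: "0 < \<delta>"
    have le: "ennreal (prob {\<omega>\<in>space M. \<delta> < \<bar>Y k \<omega> - 0\<bar>}) \<le> ennreal (1 / \<delta>\<^sup>2) * (\<integral>\<^sup>+\<omega>. min 1 (Q k \<omega>) \<partial>M)" for k
    proof -
      have "ennreal (prob {\<omega>\<in>space M. \<delta> < \<bar>Y k \<omega> - 0\<bar>}) = (\<integral>\<^sup>+\<omega>. indicator {\<omega>\<in>space M. \<delta> < \<bar>Y k \<omega> - 0\<bar>} \<omega> \<partial>M)"
        by (simp add: emeasure_eq_measure[symmetric])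
      also have "\<dots> \<le> (\<integral>\<^sup>+\<omega>. ennreal (1 / \<delta>\<^sup>2) * ennreal ((Y k \<omega>)\<^sup>2) \<partial>M)"
      proof (rule nn_integral_mono)
        fix \<omega>
        show "indicator {\<omega>\<in>space M. \<delta> < \<bar>Y k \<omega> - 0\<bar>} \<omega> \<le> ennreal (1 / \<delta>\<^sup>2) * ennreal ((Y k \<omega>)\<^sup>2)"
        proof (cases "\<delta> < \<bar>Y k \<omega>\<bar>")
          case True
          have "\<delta>\<^sup>2 \<le> \<bar>Y k \<omega>\<bar>\<^sup>2" using True \<delta> by (intro power_mono) auto
          then have "1 \<le> 1 / \<delta>\<^sup>2 * (Y k \<omega>)\<^sup>2" using \<delta> by (simp add: field_simps)
          then have "ennreal 1 \<le> ennreal (1 / \<delta>\<^sup>2 * (Y k \<omega>)\<^sup>2)" by (rule ennreal_leI)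
          then have "1 \<le> ennreal (1 / \<delta>\<^sup>2) * ennreal ((Y k \<omega>)\<^sup>2)"
            by (subst ennreal_mult[symmetric]) simp_all
          then show ?thesis by (rule order_trans[rotated]) (simp add: indicator_def)
        qed (simp add: indicator_def)
      qed
      also have "\<dots> \<le> ennreal (1 / \<delta>\<^sup>2) * (\<integral>\<^sup>+\<omega>. min 1 (Q k \<omega>) \<partial>M)"
        using EY[of k] by (subst nn_integral_cmult) (auto intro: mult_left_mono)
      finally show ?thesis .
    qed
    have "(\<lambda>k. ennreal (1 / \<delta>\<^sup>2) * (\<integral>\<^sup>+\<omega>. min 1 (Q k \<omega>) \<partial>M)) \<longlonglongrightarrow> ennreal (1 / \<delta>\<^sup>2) * (\<integral>\<^sup>+\<omega>. 0 \<partial>M)"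
      by (rule tendsto_mult_ennreal[OF tendsto_const Q0]) simp
    then have lim0: "(\<lambda>k. ennreal (1 / \<delta>\<^sup>2) * (\<integral>\<^sup>+\<omega>. min 1 (Q k \<omega>) \<partial>M)) \<longlonglongrightarrow> 0" by simp
    have "(\<lambda>k. ennreal (prob {\<omega>\<in>space M. \<delta> < \<bar>Y k \<omega> - 0\<bar>})) \<longlonglongrightarrow> 0"
      by (rule tendsto_sandwich[OF _ _ tendsto_const lim0]) (use le in \<open>intro always_eventually allI, simp\<close>)+
    then have "(\<lambda>k. ennreal (prob {\<omega>\<in>space M. \<delta> < \<bar>Y k \<omega> - 0\<bar>})) \<longlonglongrightarrow> ennreal 0" by simp
    then show "(\<lambda>k. prob {\<omega>\<in>space M. \<delta> < \<bar>Y k \<omega> - 0\<bar>}) \<longlonglongrightarrow> 0"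
      by (subst (asm) tendsto_ennreal_iff) auto
  qed
  then obtain r :: "nat \<Rightarrow> nat" where r: "strict_mono r" "AE \<omega> in M. (\<lambda>k. Y (r k) \<omega>) \<longlonglongrightarrow> 0"
    using tendsto_in_prob_AE_subseq[where Z = Y and z = "\<lambda>_. 0", OF finite_measure_axioms Ym]
    by auto
  have "AE \<omega> in M. (\<lambda>k. Z (r k) \<omega>) \<longlonglongrightarrow> 0"
    using r(2) lim
  proof eventually_elim
    case (elim \<omega>)
    have "(\<lambda>k. Q (r k) \<omega>) \<longlonglongrightarrow> 0"
      using LIMSEQ_subseq_LIMSEQ[OF elim(2) r(1)] by (simp add: comp_def Q_def)
    then have "eventually (\<lambda>k. Q (r k) \<omega> < 1) sequentially" by (rule order_tendstoD) simp
    then have "eventually (\<lambda>k. Y (r k) \<omega> = Z (r k) \<omega>) sequentially"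
      by eventually_elim (simp add: Y_def)
    then show ?case using elim(1) by (rule Lim_transform_eventually[rotated])
  qed
  then show ?thesis using r(1) by blast
qed

lemma ito_limit_step:
  assumes I: "has_ito_integral M F W T H I" and p: "grid T n p" and T: "0 < T"
  shows "ito_limit T (\<lambda>s \<omega>. step_function n p c s * H s \<omega>) (\<lambda>\<omega>. \<Sum>i<n. c i * (I (p (Suc i)) \<omega> - I (p i) \<omega>))"
proof -
  have "ito_limit T (\<lambda>s \<omega>. step_function m p c s * H s \<omega>) (\<lambda>\<omega>. \<Sum>i<m. c i * (I (p (Suc i)) \<omega> - I (p i) \<omega>))"
    if "m \<le> n" for m
    using that
  proof (induction m)
    case 0
    then show ?case using ito_limit_zero[OF T] by (simp add: step_function_def)
  next
    case (Suc m)
    have b: "p m \<in> {0..T}" "p (Suc m) \<in> {0..T}" "p m \<le> p (Suc m)"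
      using grid_bounds[OF p, of m] grid_bounds[OF p, of "Suc m"] grid_le[OF p, of m "Suc m"] Suc.prems by auto
    have "ito_limit T (\<lambda>s \<omega>. 1 * (indicator {0<..p (Suc m)} s * H s \<omega>) + (-1) * (indicator {0<..p m} s * H s \<omega>))
        (\<lambda>\<omega>. 1 * I (p (Suc m)) \<omega> + (-1) * I (p m) \<omega>)"
      by (rule ito_limit_linear[OF has_ito_integral_imp_ito_limit[OF I b(2)] has_ito_integral_imp_ito_limit[OF I b(1)]])
    moreover have "1 * (indicator {0<..p (Suc m)} s * H s \<omega>) + (-1) * (indicator {0<..p m} s * H s \<omega>)
        = indicator {p m<..p (Suc m)} s * H s \<omega>" for s \<omega>
      using b by (auto simp: indicator_def)
    ultimately have piece: "ito_limit T (\<lambda>s \<omega>. indicator {p m<..p (Suc m)} s * H s \<omega>) (\<lambda>\<omega>. I (p (Suc m)) \<omega> - I (p m) \<omega>)"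
      by simp
    have "ito_limit T (\<lambda>s \<omega>. 1 * (step_function m p c s * H s \<omega>) + c m * (indicator {p m<..p (Suc m)} s * H s \<omega>))
       (\<lambda>\<omega>. 1 * (\<Sum>i<m. c i * (I (p (Suc i)) \<omega> - I (p i) \<omega>)) + c m * (I (p (Suc m)) \<omega> - I (p m) \<omega>))"
      by (rule ito_limit_linear[OF _ piece]) (use Suc in simp)
    then show ?case by (simp add: step_function_def algebra_simps)
  qed
  then show ?thesis by simp
qed

end

section \<open>Gronwall inequalities and a stopped integral\<close>

text \<open>The function \<open>V s = \<integral>\<^sub>0\<^sup>s \<alpha> - exp (- \<beta> s) \<integral>\<^sub>0\<^sup>s y\<close> is increasing and vanishes at \<open>0\<close>.\<close>
lemma gronwall_integral:
  fixes y \<alpha> :: "real \<Rightarrow> real"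
  assumes y: "continuous_on {0..T} y" and \<alpha>: "continuous_on {0..T} \<alpha>" and \<beta>: "0 \<le> \<beta>"
    and \<alpha>0: "\<And>t. t \<in> {0..T} \<Longrightarrow> 0 \<le> \<alpha> t"
    and le: "\<And>t. t \<in> {0..T} \<Longrightarrow> y t \<le> \<alpha> t + \<beta> * integral {0..t} y"
    and t: "t \<in> {0..T}"
  shows "integral {0..t} y \<le> exp (\<beta> * T) * integral {0..t} \<alpha>"
proof -
  define R where "R t = integral {0..t} y" for t
  define P where "P t = integral {0..t} \<alpha>" for t
  have dR: "(R has_real_derivative y s) (at s within {0..T})" if "s \<in> {0..T}" for s
    unfolding R_def using integral_has_vector_derivative[OF y that]
    by (simp add: has_real_derivative_iff_has_vector_derivative)
  have dP: "(P has_real_derivative \<alpha> s) (at s within {0..T})" if "s \<in> {0..T}" for s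
    unfolding P_def using integral_has_vector_derivative[OF \<alpha> that]
    by (simp add: has_real_derivative_iff_has_vector_derivative)
  define V where "V s = P s - exp (- \<beta> * s) * R s" for s
  have "V 0 \<le> V t"
  proof (rule DERIV_nonneg_imp_increasing_open[of 0 t V])
    show "0 \<le> t" using t by simp
    show "continuous_on {0..t} V"
    proof (rule continuous_on_subset)
      show "continuous_on {0..T} V" unfolding V_def
        by (intro continuous_intros DERIV_continuous_on[OF dR] DERIV_continuous_on[OF dP]) auto
    qed (use t in auto)
    fix s assume s: "0 < s" "s < t"
    then have sT: "s \<in> {0..T}" "s \<in> interior {0..T}" using t by (auto simp: interior_atLeastAtMost_real)
    have "(V has_real_derivative \<alpha> s - (exp (- \<beta> * s) * y s - \<beta> * exp (- \<beta> * s) * R s)) (at s within {0..T})"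
      unfolding V_def
      by (rule derivative_eq_intros dP[OF sT(1)] dR[OF sT(1)] refl)+ (simp add: algebra_simps)
    then have d: "(V has_real_derivative \<alpha> s - (exp (- \<beta> * s) * y s - \<beta> * exp (- \<beta> * s) * R s)) (at s)"
      using at_within_interior[OF sT(2)] by simp
    have "exp (- \<beta> * s) * (y s - \<beta> * R s) \<le> exp (- \<beta> * s) * \<alpha> s"
      using le[OF sT(1)] by (intro mult_left_mono) (auto simp: R_def)
    also have "\<dots> \<le> 1 * \<alpha> s"
      using \<alpha>0[OF sT(1)] \<beta> s by (intro mult_right_mono) auto
    finally have "0 \<le> \<alpha> s - (exp (- \<beta> * s) * y s - \<beta> * exp (- \<beta> * s) * R s)" by (simp add: algebra_simps)
    then show "\<exists>d. (V has_real_derivative d) (at s) \<and> 0 \<le> d" using d by blast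
  qed
  then have le1: "exp (- \<beta> * t) * R t \<le> P t" by (simp add: V_def R_def P_def)
  have P0: "0 \<le> P t" unfolding P_def
    by (rule integral_nonneg) (use t \<alpha>0 in \<open>auto intro!: integrable_continuous_real continuous_on_subset[OF \<alpha>]\<close>)
  have "R t = exp (\<beta> * t) * (exp (- \<beta> * t) * R t)" by (simp add: exp_minus)
  also have "\<dots> \<le> exp (\<beta> * t) * P t" using le1 by (intro mult_left_mono) auto
  also have "\<dots> \<le> exp (\<beta> * T) * P t" using P0 t \<beta> by (intro mult_right_mono) (auto intro: mult_left_mono)
  finally show ?thesis by (simp add: R_def P_def)
qed

text \<open>Linear growth of the diffusion coefficient, recentred at a bounded reference value \<open>z\<close>.\<close>
lemma linear_growth_around:
  fixes w y z :: real
  assumes w: "w\<^sup>2 \<le> \<kappa> * (1 + y\<^sup>2)" and z: "\<bar>z\<bar> \<le> B" and \<kappa>: "0 \<le> \<kappa>"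
  shows "ennreal (w\<^sup>2) \<le> ennreal (\<kappa> * (1 + 2 * B\<^sup>2)) + ennreal (2 * \<kappa>) * ennreal ((y - z)\<^sup>2)"
proof -
  have "y\<^sup>2 \<le> 2 * z\<^sup>2 + 2 * (y - z)\<^sup>2" using square_add_le[of 1 z "y - z"] by simp
  also have "z\<^sup>2 \<le> B\<^sup>2" using power_mono[OF z, of 2] by simp
  finally have "\<kappa> * (1 + y\<^sup>2) \<le> \<kappa> * (1 + (2 * B\<^sup>2 + 2 * (y - z)\<^sup>2))"
    using \<kappa> by (intro mult_left_mono) auto
  then have "w\<^sup>2 \<le> \<kappa> * (1 + 2 * B\<^sup>2) + 2 * \<kappa> * (y - z)\<^sup>2" using w by (simp add: algebra_simps)
  then show ?thesis
    using \<kappa> by (simp add: ennreal_mult[symmetric] ennreal_plus[symmetric] ennreal_leI del: ennreal_plus)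
qed

lemma set_integrable_bounded_times:
  fixes f g :: "real \<Rightarrow> real"
  assumes f: "f \<in> borel_measurable borel" "\<And>s. s \<in> {0..r} \<Longrightarrow> \<bar>f s\<bar> \<le> C"
    and g: "set_integrable lborel {0..r} g"
  shows "set_integrable lborel {0..r} (\<lambda>s. f s * g s)"
  unfolding set_integrable_def
proof (rule Bochner_Integration.integrable_bound)
  show "integrable lborel (\<lambda>s. C * (indicator {0..r} s *\<^sub>R g s))"
    using g by (intro integrable_mult_right) (simp add: set_integrable_def)
  have "(\<lambda>s. f s * (indicator {0..r} s *\<^sub>R g s)) \<in> borel_measurable lborel"
    using f(1) g by (intro borel_measurable_times) (auto simp: set_integrable_def)
  then show "(\<lambda>s. indicator {0..r} s *\<^sub>R (f s * g s)) \<in> borel_measurable lborel"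
    by (simp add: mult.left_commute)
  show "AE s in lborel. norm (indicator {0..r} s *\<^sub>R (f s * g s)) \<le> norm (C * (indicator {0..r} s *\<^sub>R g s))"
  proof (rule AE_I2)
    fix s
    show "norm (indicator {0..r} s *\<^sub>R (f s * g s)) \<le> norm (C * (indicator {0..r} s *\<^sub>R g s))"
    proof (cases "s \<in> {0..r}")
      case True
      then have "\<bar>f s\<bar> \<le> \<bar>C\<bar>" using f(2)[OF True] by linarith
      then show ?thesis using True by (simp add: abs_mult mult_right_mono)
    qed simp
  qed
qed

text \<open>Gronwall's inequality for a single path: the square of the deviation \<open>d\<close> is controlled by the noise
  \<open>i\<close> up to the same time. The bound involves \<open>i\<close> through \<open>i t\<close> and an integral over \<open>{0..t}\<close> only, which is
  what lets it be restricted to events that decrease in \<open>t\<close>.\<close>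
lemma linear_volterra_bound:
  fixes d i \<theta> :: "real \<Rightarrow> real"
  assumes d: "continuous_on {0..T} d" and i: "continuous_on {0..T} i" and \<theta>m: "\<theta> \<in> borel_measurable borel"
    and L: "\<And>s. s \<in> {0..T} \<Longrightarrow> \<bar>\<theta> s\<bar> \<le> L"
    and eq: "\<And>t. t \<in> {0..T} \<Longrightarrow> d t = (LBINT s:{0..t}. \<theta> s * d s) + i t"
    and t: "t \<in> {0..T}"
  shows "ennreal ((d t)\<^sup>2) \<le> 2 * ennreal ((i t)\<^sup>2)
    + ennreal (2 * L\<^sup>2 * (exp (L * T))\<^sup>2 * T) * (\<integral>\<^sup>+s. indicator {0..t} s * ennreal ((i s)\<^sup>2) \<partial>lborel)"
proof -
  have L0: "0 \<le> L" using L[OF t] by linarith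
  have T0: "0 \<le> T" using t by simp
  have cs: "continuous_on {0..r} d" "continuous_on {0..r} i" if "r \<in> {0..T}" for r
    using that by (auto intro: continuous_on_subset[OF d] continuous_on_subset[OF i])
  have dint: "set_integrable lborel {0..r} (\<lambda>s. \<bar>d s\<bar>)" "set_integrable lborel {0..r} (\<lambda>s. \<bar>i s\<bar>)" if "r \<in> {0..T}" for r
    using that by (auto intro!: borel_integrable_atLeastAtMost' continuous_intros cs)
  have Ieq: "(LBINT s:{0..r}. \<bar>d s\<bar>) = integral {0..r} (\<lambda>s. \<bar>d s\<bar>)"
    "(LBINT s:{0..r}. \<bar>i s\<bar>) = integral {0..r} (\<lambda>s. \<bar>i s\<bar>)" if "r \<in> {0..T}" for r
    using set_borel_integral_eq_integral(2) dint[OF that] by auto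
  have pt: "\<bar>d r\<bar> \<le> \<bar>i r\<bar> + L * integral {0..r} (\<lambda>s. \<bar>d s\<bar>)" if r: "r \<in> {0..T}" for r
  proof -
    have "set_integrable lborel {0..r} (\<lambda>s. \<theta> s * d s)"
      by (rule set_integrable_bounded_times[OF \<theta>m _ borel_integrable_atLeastAtMost'[OF cs(1)[OF r]], where C = L])
         (use L r in auto)
    then have "\<bar>LBINT s:{0..r}. \<theta> s * d s\<bar> \<le> (LBINT s:{0..r}. \<bar>\<theta> s * d s\<bar>)"
      using set_integral_norm_bound[of lborel "{0..r}" "\<lambda>s. \<theta> s * d s"] by simp
    also have "\<dots> \<le> (LBINT s:{0..r}. L * \<bar>d s\<bar>)"
    proof (rule set_integral_mono)
      show "set_integrable lborel {0..r} (\<lambda>s. \<bar>\<theta> s * d s\<bar>)"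
        by (rule set_integrable_abs) fact
      show "set_integrable lborel {0..r} (\<lambda>s. L * \<bar>d s\<bar>)" using dint(1)[OF r] by simp
      show "\<bar>\<theta> s * d s\<bar> \<le> L * \<bar>d s\<bar>" if "s \<in> {0..r}" for s
        using L[of s] that r by (auto simp: abs_mult intro!: mult_right_mono)
    qed
    also have "\<dots> = L * integral {0..r} (\<lambda>s. \<bar>d s\<bar>)" using Ieq(1)[OF r] by simp
    finally show ?thesis using eq[OF r] by linarith
  qed
  have "integral {0..t} (\<lambda>s. \<bar>d s\<bar>) \<le> exp (L * T) * integral {0..t} (\<lambda>s. \<bar>i s\<bar>)"
    by (rule gronwall_integral[OF _ _ L0 _ pt t]) (auto intro!: continuous_intros d i)
  then have "L * integral {0..t} (\<lambda>s. \<bar>d s\<bar>) \<le> L * (exp (L * T) * integral {0..t} (\<lambda>s. \<bar>i s\<bar>))"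
    using L0 by (rule mult_left_mono)
  then have b: "\<bar>d t\<bar> \<le> \<bar>i t\<bar> + L * exp (L * T) * integral {0..t} (\<lambda>s. \<bar>i s\<bar>)" using pt[OF t] by simp
  define J where "J = integral {0..t} (\<lambda>s. \<bar>i s\<bar>)"
  have J: "ennreal J = (\<integral>\<^sup>+s. ennreal (indicator {0..t} s * \<bar>i s\<bar>) \<partial>lborel)" and J0: "0 \<le> J"
  proof -
    have "integrable lborel (\<lambda>s. indicator {0..t} s * \<bar>i s\<bar>)" using dint(2)[OF t] by (simp add: set_integrable_def)
    then have "(\<integral>\<^sup>+s. ennreal (indicator {0..t} s * \<bar>i s\<bar>) \<partial>lborel) = ennreal (LBINT s:{0..t}. \<bar>i s\<bar>)"
      by (subst nn_integral_eq_integral) (auto simp: set_lebesgue_integral_def)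
    then show "ennreal J = (\<integral>\<^sup>+s. ennreal (indicator {0..t} s * \<bar>i s\<bar>) \<partial>lborel)" using Ieq(2)[OF t] by (simp add: J_def)
    show "0 \<le> J" unfolding J_def Ieq(2)[OF t, symmetric] set_lebesgue_integral_def
      by (intro Bochner_Integration.integral_nonneg) auto
  qed
  have im: "(\<lambda>s. indicator {0..t} s *\<^sub>R i s) \<in> borel_measurable borel"
    using borel_measurable_continuous_on_indicator[OF _ cs(2)[OF t]] by simp
  have iabs[measurable]: "(\<lambda>s. indicator {0..t} s * \<bar>i s\<bar>) \<in> borel_measurable borel"
  proof -
    have "(\<lambda>s. \<bar>indicator {0..t} s *\<^sub>R i s\<bar>) \<in> borel_measurable borel" using im by measurable
    moreover have "\<bar>indicator {0..t} s *\<^sub>R i s\<bar> = indicator {0..t} s * \<bar>i s\<bar>" for s by (simp add: abs_mult)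
    ultimately show ?thesis by simp
  qed
  have "ennreal (J\<^sup>2) = (\<integral>\<^sup>+s. ennreal (indicator {0..t} s * \<bar>i s\<bar>) * indicator {0..t} s \<partial>lborel)\<^sup>2"
  proof -
    have "ennreal (indicator {0..t} s * \<bar>i s\<bar>) * indicator {0..t} s = ennreal (indicator {0..t} s * \<bar>i s\<bar>)" for s :: real
      by (simp add: indicator_def)
    then show ?thesis using J0 by (simp add: J[symmetric] ennreal_power)
  qed
  also have "\<dots> \<le> (\<integral>\<^sup>+s. (ennreal (indicator {0..t} s * \<bar>i s\<bar>))\<^sup>2 \<partial>lborel) * (\<integral>\<^sup>+s. (indicator {0..t} s)\<^sup>2 \<partial>lborel)"
    by (rule Cauchy_Schwarz_nn_integral) measurable
  also have "(\<integral>\<^sup>+s. (indicator {0..t} s)\<^sup>2 \<partial>lborel) = (\<integral>\<^sup>+s. indicator {0..t} s \<partial>lborel)"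
    by (intro nn_integral_cong) (simp add: indicator_def)
  also have "\<dots> = ennreal t" using t by simp
  also have "(\<integral>\<^sup>+s. (ennreal (indicator {0..t} s * \<bar>i s\<bar>))\<^sup>2 \<partial>lborel) = (\<integral>\<^sup>+s. indicator {0..t} s * ennreal ((i s)\<^sup>2) \<partial>lborel)"
    by (intro nn_integral_cong) (auto simp: indicator_def ennreal_power)
  finally have JJ: "ennreal (J\<^sup>2) \<le> (\<integral>\<^sup>+s. indicator {0..t} s * ennreal ((i s)\<^sup>2) \<partial>lborel) * ennreal t" .
  define c where "c = L * exp (L * T)"
  have "\<bar>d t\<bar>\<^sup>2 \<le> (\<bar>i t\<bar> + c * J)\<^sup>2" using b by (intro power_mono) (auto simp: J_def c_def)
  also have "\<dots> \<le> 2 * (i t)\<^sup>2 + 2 * c\<^sup>2 * J\<^sup>2" using square_add_le[of 1 "\<bar>i t\<bar>" "c * J"] by (simp add: power_mult_distrib)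
  finally have "ennreal ((d t)\<^sup>2) \<le> ennreal (2 * (i t)\<^sup>2 + 2 * c\<^sup>2 * J\<^sup>2)" by (intro ennreal_leI) simp
  also have "\<dots> = 2 * ennreal ((i t)\<^sup>2) + ennreal (2 * c\<^sup>2) * ennreal (J\<^sup>2)"
    by (simp add: ennreal_mult)
  also have "\<dots> \<le> 2 * ennreal ((i t)\<^sup>2) + ennreal (2 * c\<^sup>2) * ((\<integral>\<^sup>+s. indicator {0..t} s * ennreal ((i s)\<^sup>2) \<partial>lborel) * ennreal T)"
    using t by (intro add_left_mono mult_left_mono order_trans[OF JJ] ennreal_leI) auto
  also have "ennreal (2 * c\<^sup>2) * ((\<integral>\<^sup>+s. indicator {0..t} s * ennreal ((i s)\<^sup>2) \<partial>lborel) * ennreal T)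
     = ennreal (2 * L\<^sup>2 * (exp (L * T))\<^sup>2 * T) * (\<integral>\<^sup>+s. indicator {0..t} s * ennreal ((i s)\<^sup>2) \<partial>lborel)"
    using T0 by (simp add: ennreal_mult c_def power_mult_distrib ac_simps)
  finally show ?thesis .
qed

text \<open>A version for functions that are merely bounded. With \<open>\<beta> = 2 \<kappa>\<^sub>2\<close> the finite supremum \<open>N\<close> of
  \<open>exp (- \<beta> t) m t\<close> satisfies \<open>N \<le> \<kappa>\<^sub>1 T + N/2\<close>. The bound \<open>c\<close> makes \<open>N\<close> finite and is absent from the conclusion.\<close>
lemma weighted_gronwall:
  fixes m :: "real \<Rightarrow> real"
  assumes m0: "\<And>t. t \<in> {0..T} \<Longrightarrow> 0 \<le> m t" and mc: "\<And>t. t \<in> {0..T} \<Longrightarrow> m t \<le> c"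
    and \<kappa>: "0 \<le> \<kappa>1" "0 < \<kappa>2" and T: "0 \<le> T"
    and le: "\<And>t. t \<in> {0..T} \<Longrightarrow> ennreal (m t) \<le> (\<integral>\<^sup>+s. indicator {0<..t} s * ennreal (\<kappa>1 + \<kappa>2 * m s) \<partial>lborel)"
    and t: "t \<in> {0..T}"
  shows "m t \<le> 2 * \<kappa>1 * T * exp (2 * \<kappa>2 * T)"
proof -
  define \<beta> where "\<beta> = 2 * \<kappa>2"
  have \<beta>: "0 < \<beta>" using \<kappa> by (simp add: \<beta>_def)
  define N where "N = (SUP t\<in>{0..T}. exp (- \<beta> * t) * m t)"
  have bdd: "bdd_above ((\<lambda>t. exp (- \<beta> * t) * m t) ` {0..T})"
  proof (rule bdd_aboveI2)
    fix t assume t: "t \<in> {0..T}"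
    have "exp (- \<beta> * t) * m t \<le> 1 * m t" using \<beta> t m0[OF t] by (intro mult_right_mono) auto
    then show "exp (- \<beta> * t) * m t \<le> c" using mc[OF t] by simp
  qed
  have N: "exp (- \<beta> * t) * m t \<le> N" if "t \<in> {0..T}" for t
    unfolding N_def by (rule cSUP_upper[OF that bdd])
  have mN: "m t \<le> N * exp (\<beta> * t)" if "t \<in> {0..T}" for t
    using mult_left_mono[OF N[OF that], of "exp (\<beta> * t)"] by (simp add: exp_minus field_simps)
  have N0: "0 \<le> N" using N[of 0] m0[of 0] T by simp
  have "N \<le> \<kappa>1 * T + N / 2"
    unfolding N_def
  proof (rule cSUP_least)
    show "{0..T} \<noteq> {}" using T by simp
    fix t assume t: "t \<in> {0..T}"
    have "ennreal (m t) \<le> (\<integral>\<^sup>+s. indicator {0<..t} s * ennreal (\<kappa>1 + \<kappa>2 * m s) \<partial>lborel)" by (rule le[OF t])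
    also have "\<dots> \<le> (\<integral>\<^sup>+s. ennreal (\<kappa>1 + \<kappa>2 * (N * exp (\<beta> * s))) * indicator {0..t} s \<partial>lborel)"
    proof (rule nn_integral_mono)
      fix s
      show "indicator {0<..t} s * ennreal (\<kappa>1 + \<kappa>2 * m s) \<le> ennreal (\<kappa>1 + \<kappa>2 * (N * exp (\<beta> * s))) * indicator {0..t} s"
      proof (cases "s \<in> {0<..t}")
        case True
        then have "\<kappa>1 + \<kappa>2 * m s \<le> \<kappa>1 + \<kappa>2 * (N * exp (\<beta> * s))"
          using \<kappa> t by (intro add_left_mono mult_left_mono mN) auto
        then show ?thesis using True by (simp add: ennreal_leI)
      qed simp
    qed
    also have "\<dots> = ennreal ((\<kappa>1 * t + N / 2 * exp (\<beta> * t)) - (\<kappa>1 * 0 + N / 2 * exp (\<beta> * 0)))"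
    proof (rule nn_integral_FTC_Icc[where F = "\<lambda>s. \<kappa>1 * s + N / 2 * exp (\<beta> * s)"])
      show "((\<lambda>s. \<kappa>1 * s + N / 2 * exp (\<beta> * s)) has_real_derivative \<kappa>1 + \<kappa>2 * (N * exp (\<beta> * s))) (at s)"
        for s by (auto intro!: derivative_eq_intros simp: \<beta>_def)
    qed (use \<kappa> N0 t in auto)
    finally have le': "ennreal (m t) \<le> ennreal ((\<kappa>1 * t + N / 2 * exp (\<beta> * t)) - (\<kappa>1 * 0 + N / 2 * exp (\<beta> * 0)))" .
    have "N / 2 * 1 \<le> N / 2 * exp (\<beta> * t)" using N0 \<beta> t by (intro mult_left_mono) auto
    moreover have "0 \<le> \<kappa>1 * t" using \<kappa> t by simp
    ultimately have "m t \<le> \<kappa>1 * t + N / 2 * exp (\<beta> * t) - N / 2"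
      using le' by (subst (asm) ennreal_le_iff) simp_all
    then have "exp (- \<beta> * t) * m t \<le> exp (- \<beta> * t) * (\<kappa>1 * t + N / 2 * exp (\<beta> * t))"
      using N0 by (intro mult_left_mono) auto
    also have "\<dots> = exp (- \<beta> * t) * (\<kappa>1 * t) + N / 2" by (simp add: exp_minus field_simps)
    also have "\<dots> \<le> 1 * (\<kappa>1 * T) + N / 2"
      using \<beta> t \<kappa> by (intro add_right_mono mult_mono) auto
    finally show "exp (- \<beta> * t) * m t \<le> \<kappa>1 * T + (SUP t\<in>{0..T}. exp (- \<beta> * t) * m t) / 2"
      by (simp add: N_def)
  qed
  then have "N \<le> 2 * \<kappa>1 * T" by simp
  then have "N * exp (\<beta> * t) \<le> 2 * \<kappa>1 * T * exp (2 * \<kappa>2 * T)"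
    using N0 \<kappa> t T unfolding \<beta>_def by (intro mult_mono) auto
  then show ?thesis using mN[OF t] by simp
qed

text \<open>Before the first time \<open>\<tau>\<close> at which the running integral \<open>Q\<close> reaches \<open>c\<close> the restriction to \<open>Q s < c\<close> has no
  effect, and by continuity of \<open>Q\<close> the integral up to \<open>\<tau>\<close> is already at least \<open>c\<close>.\<close>
lemma stopped_integral_lower_bound:
  fixes h :: "real \<Rightarrow> ennreal" and c :: real
  assumes [measurable]: "h \<in> borel_measurable borel" and t: "0 \<le> t"
    and fin: "(\<integral>\<^sup>+r. indicator {0<..t} r * h r \<partial>lborel) < \<infinity>"
  defines "Q \<equiv> \<lambda>s. \<integral>\<^sup>+r. indicator {0<..s} r * h r \<partial>lborel"
  shows "min (ennreal c) (Q t) \<le> (\<integral>\<^sup>+s. indicator {0<..t} s * (indicator {s. Q s < ennreal c} s * h s) \<partial>lborel)"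
proof (cases "Q t < ennreal c")
  case True
  have "Q s < ennreal c" if "s \<le> t" for s
  proof (rule le_less_trans[OF _ True])
    show "Q s \<le> Q t" unfolding Q_def by (intro nn_integral_mono) (use that in \<open>auto simp: indicator_def\<close>)
  qed
  then have "Q t \<le> (\<integral>\<^sup>+s. indicator {0<..t} s * (indicator {s. Q s < ennreal c} s * h s) \<partial>lborel)"
    unfolding Q_def by (intro nn_integral_mono) (auto simp: indicator_def)
  then show ?thesis by (rule min.coboundedI2)
next
  case False
  \<comment> \<open>\<open>0\<close> is inserted so that the supremum is taken over a nonempty set\<close>
  define S where "S = insert 0 {s\<in>{0<..t}. Q s < ennreal c}"
  define \<tau> where "\<tau> = Sup S"
  have S: "0 \<in> S" "S \<subseteq> {0..t}" using t by (auto simp: S_def)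
  have bdd: "bdd_above S" using S by (meson bdd_above_Icc bdd_above_mono)
  have \<tau>: "0 \<le> \<tau>" "\<tau> \<le> t"
    unfolding \<tau>_def using cSup_upper[OF S(1) bdd] by (simp, intro cSup_least) (use S in auto)
  have Qmono: "Q s \<le> Q s'" if "s \<le> s'" for s s'
    unfolding Q_def by (intro nn_integral_mono) (use that in \<open>auto simp: indicator_def\<close>)
  have below: "Q s < ennreal c" if s: "0 < s" "s < \<tau>" for s
  proof -
    obtain r where "r \<in> S" "s < r" using less_cSupE[of s S] s S unfolding \<tau>_def by auto
    then show ?thesis using Qmono[of s r] s by (auto simp: S_def)
  qed
  have "ennreal c \<le> Q \<tau>"
  proof (cases "\<tau> = t")
    case True
    then show ?thesis using False by simp
  next
    case False
    define s where "s n = \<tau> + (t - \<tau>) / real (Suc n)" for n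
    have s: "\<tau> < s n" "s n \<le> t" for n
    proof -
      have "(t - \<tau>) / real (Suc n) \<le> (t - \<tau>) / 1" using \<tau> by (intro divide_left_mono) auto
      then show "\<tau> < s n" "s n \<le> t" using \<tau> False by (auto simp: s_def)
    qed
    have above: "ennreal c \<le> Q (s n)" for n
    proof (rule ccontr)
      assume "\<not> ennreal c \<le> Q (s n)"
      then have "s n \<in> S" using s[of n] \<tau> by (auto simp: S_def)
      then show False using cSup_upper[OF _ bdd, of "s n"] s(1)[of n] by (simp add: \<tau>_def)
    qed
    have sl: "s \<longlonglongrightarrow> \<tau>"
    proof -
      have "(\<lambda>n. \<tau> + (t - \<tau>) * inverse (real (Suc n))) \<longlonglongrightarrow> \<tau> + (t - \<tau>) * 0"
        by (intro tendsto_intros LIMSEQ_inverse_real_of_nat)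
      then show ?thesis by (simp add: s_def[abs_def] divide_inverse)
    qed
    have "(\<lambda>n. Q (s n)) \<longlonglongrightarrow> Q \<tau>"
      unfolding Q_def
    proof (rule nn_integral_dominated_convergence[where w = "\<lambda>r. indicator {0<..t} r * h r"])
      show "AE r in lborel. indicator {0<..s n} r * h r \<le> indicator {0<..t} r * h r" for n
        using s(2)[of n] by (auto simp: indicator_def)
      show "AE r in lborel. (\<lambda>n. indicator {0<..s n} r * h r) \<longlonglongrightarrow> indicator {0<..\<tau>} r * h r"
      proof (rule AE_I2)
        fix r
        have "eventually (\<lambda>n. indicator {0<..s n} r * h r = indicator {0<..\<tau>} r * h r) sequentially"
        proof (cases "r \<le> \<tau>")
          case True
          have "r \<le> s n" for n using True s(1)[of n] by simp
          then show ?thesis using True by (intro always_eventually allI) (auto simp: indicator_def)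
        next
          case False
          then have "eventually (\<lambda>n. s n < r) sequentially" using order_tendstoD(2)[OF sl] by simp
          then show ?thesis by eventually_elim (use False in \<open>auto simp: indicator_def\<close>)
        qed
        then show "(\<lambda>n. indicator {0<..s n} r * h r) \<longlonglongrightarrow> indicator {0<..\<tau>} r * h r"
          by (rule tendsto_eventually)
      qed
    qed (use fin in auto)
    then show ?thesis by (rule Lim_bounded2) (use above in auto)
  qed
  also have "Q \<tau> \<le> (\<integral>\<^sup>+s. indicator {0<..t} s * (indicator {s. Q s < ennreal c} s * h s) \<partial>lborel)"
    unfolding Q_def
  proof (rule nn_integral_mono_AE)
    show "AE s in lborel. indicator {0<..\<tau>} s * h s \<le> indicator {0<..t} s *
        (indicator {s. (\<integral>\<^sup>+ r. indicator {0<..s} r * h r \<partial>lborel) < ennreal c} s * h s)"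
      using AE_lborel_singleton[of \<tau>]
    proof eventually_elim
      case (elim s)
      show ?case
      proof (cases "s \<in> {0<..\<tau>}")
        case True
        then have "Q s < ennreal c" using below[of s] elim by simp
        then show ?thesis using True \<tau> by (simp add: Q_def)
      qed simp
    qed
  qed
  finally show ?thesis by (rule min.coboundedI1)
qed

section \<open>The integral of a deterministic function against an Ito process\<close>

lemma has_ito_differentialD:
  assumes "has_ito_differential M F W T X u v"
  shows "adapted_on F {0..T} X" "continuous_paths_on M {0..T} X" "progressive F T u"
    "AE \<omega> in M. set_integrable lborel {0..T} (\<lambda>s. u s \<omega>)"
    "\<exists>I. has_ito_integral M F W T v I \<and>
          (AE \<omega> in M. \<forall>t\<in>{0..T}. X t \<omega> = X 0 \<omega> + (LBINT s:{0..t}. u s \<omega>) + I t \<omega>)"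
  using assms unfolding has_ito_differential_def by - (elim conjE, assumption)+

lemma has_ito_differentialE:
  assumes "has_ito_differential M F W T X u v"
  obtains I where "has_ito_integral M F W T v I"
    "AE \<omega> in M. \<forall>t\<in>{0..T}. X t \<omega> = X 0 \<omega> + (LBINT s:{0..t}. u s \<omega>) + I t \<omega>"
  using has_ito_differentialD(5)[OF assms] by (elim exE conjE)

context filtered_brownian
begin

text \<open>Let \<open>(u1, v1)\<close> be the differential behind \<open>J\<close> and \<open>\<gamma>\<close> a step function close to \<open>g\<close>. The sum
  \<open>\<integral> \<gamma> u1 ds + \<integral> \<gamma> v1 dW\<close> depends on the increments of \<open>X\<close> only, hence equals \<open>\<integral> \<gamma> u ds + \<integral> \<gamma> v dW\<close>. As \<open>\<gamma>\<close> tends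
  to \<open>g\<close>, the stochastic integrals \<open>\<integral> \<gamma> v dW\<close> converge to the residual \<open>J - \<integral> g u ds\<close>, and the bound for
  their second moments passes to the limit by Fatou's lemma.\<close>
lemma integral_wrt_process_residual:
  assumes T: "0 < T" and X: "has_ito_differential M F W T X u v"
    and J: "has_integral_wrt_process M F W T X g J"
    and g[measurable]: "g \<in> borel_measurable borel" and C: "\<And>s. \<bar>g s\<bar> \<le> C"
    and fin: "(\<integral>\<^sup>+\<omega>. (\<integral>\<^sup>+s. ennreal ((indicator {0<..T} s * v s \<omega>)\<^sup>2) \<partial>lborel) \<partial>M) < \<infinity>"
  shows "(\<integral>\<^sup>+\<omega>. ennreal ((J \<omega> - (LBINT s:{0..T}. g s * u s \<omega>))\<^sup>2) \<partial>M)
    \<le> (\<integral>\<^sup>+\<omega>. (\<integral>\<^sup>+s. ennreal ((g s * (indicator {0<..T} s * v s \<omega>))\<^sup>2) \<partial>lborel) \<partial>M)"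
proof -
  have TT: "T \<in> {0..T}" using T by simp
  from J have "\<exists>u v I. has_ito_differential M F W T X u v \<and>
        (AE \<omega> in M. set_integrable lborel {0..T} (\<lambda>s. g s * u s \<omega>)) \<and>
        has_ito_integral M F W T (\<lambda>s \<omega>. g s * v s \<omega>) I \<and>
        (AE \<omega> in M. J \<omega> = (LBINT s:{0..T}. g s * u s \<omega>) + I T \<omega>)"
    unfolding has_integral_wrt_process_def by (rule conjunct2)
  then obtain u1 v1 Ig where X1: "has_ito_differential M F W T X u1 v1"
    and "AE \<omega> in M. set_integrable lborel {0..T} (\<lambda>s. g s * u1 s \<omega>)"
    and Ig: "has_ito_integral M F W T (\<lambda>s \<omega>. g s * v1 s \<omega>) Ig"
    and Jeq: "AE \<omega> in M. J \<omega> = (LBINT s:{0..T}. g s * u1 s \<omega>) + Ig T \<omega>"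
    by (elim exE conjE)
  obtain I1 where I1: "has_ito_integral M F W T v1 I1"
    and X1eq: "AE \<omega> in M. \<forall>t\<in>{0..T}. X t \<omega> = X 0 \<omega> + (LBINT s:{0..t}. u1 s \<omega>) + I1 t \<omega>"
    by (rule has_ito_differentialE[OF X1])
  obtain I2 where I2: "has_ito_integral M F W T v I2"
    and X2eq: "AE \<omega> in M. \<forall>t\<in>{0..T}. X t \<omega> = X 0 \<omega> + (LBINT s:{0..t}. u s \<omega>) + I2 t \<omega>"
    by (rule has_ito_differentialE[OF X])
  note u1 = has_ito_differentialD(4)[OF X1] and u2 = has_ito_differentialD(4)[OF X]
  obtain n p c where p0: "\<forall>k. grid T (n k) (p k)" and cC0: "\<forall>k s. \<bar>step_function (n k) (p k) (c k) s\<bar> \<le> C"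
    and lim: "AE s in lborel. s \<in> {0..T} \<longrightarrow> (\<lambda>k. step_function (n k) (p k) (c k) s) \<longlonglongrightarrow> g s"
    by (rule borel_step_approximation[OF g C T])
  note p = spec[OF p0] and cC = spec[OF spec[OF cC0]]
  define \<gamma> where "\<gamma> k = step_function (n k) (p k) (c k)" for k
  have \<gamma>m[measurable]: "\<gamma> k \<in> borel_measurable borel" for k unfolding \<gamma>_def by measurable
  note cC = cC[folded \<gamma>_def] and lim = lim[folded \<gamma>_def]
  have \<gamma>0: "\<gamma> k s * y = \<gamma> k s * (indicator {0<..T} s * y)" for k s y
    using step_function_outside[OF p, of s k "c k"] by (cases "s \<in> {0<..T}") (auto simp: \<gamma>_def)
  define S1 where "S1 k \<omega> = (\<Sum>i<n k. c k i * (I1 (p k (Suc i)) \<omega> - I1 (p k i) \<omega>))" for k \<omega>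
  define S2 where "S2 k \<omega> = (\<Sum>i<n k. c k i * (I2 (p k (Suc i)) \<omega> - I2 (p k i) \<omega>))" for k \<omega>
  have l1: "ito_limit T (\<lambda>s \<omega>. \<gamma> k s * v1 s \<omega>) (S1 k)" for k
    unfolding \<gamma>_def S1_def[abs_def] by (rule ito_limit_step[OF I1 p T])
  have l2: "ito_limit T (\<lambda>s \<omega>. \<gamma> k s * (indicator {0<..T} s * v s \<omega>)) (S2 k)" for k
  proof -
    have "(\<lambda>s \<omega>. \<gamma> k s * v s \<omega>) = (\<lambda>s \<omega>. \<gamma> k s * (indicator {0<..T} s * v s \<omega>))"
      by (intro ext) (rule \<gamma>0)
    then show ?thesis using ito_limit_step[OF I2 p T, of k "c k"]
      unfolding \<gamma>_def[symmetric] S2_def[abs_def] by (simp only:)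
  qed
  note lg = has_ito_integral_imp_ito_limit[OF Ig TT]
  note lv1 = has_ito_integral_imp_ito_limit[OF I1 TT]
  note lv = has_ito_integral_imp_ito_limit[OF I2 TT]
  have ld: "ito_limit T (\<lambda>s \<omega>. (g s - \<gamma> k s) * (indicator {0<..T} s * v1 s \<omega>)) (\<lambda>\<omega>. Ig T \<omega> - S1 k \<omega>)" for k
  proof -
    have "1 * (indicator {0<..T} s * (g s * v1 s \<omega>)) + (-1) * (\<gamma> k s * v1 s \<omega>)
      = (g s - \<gamma> k s) * (indicator {0<..T} s * v1 s \<omega>)" for s \<omega>
      unfolding \<gamma>0[of k s "v1 s \<omega>"] by (simp add: algebra_simps)
    then show ?thesis using ito_limit_linear[OF lg l1[of k], of 1 "-1"] by simp
  qed
  have "AE \<omega> in M. (\<lambda>k. \<integral>\<^sup>+s. ennreal (((g s - \<gamma> k s) * (indicator {0<..T} s * v1 s \<omega>))\<^sup>2) \<partial>lborel) \<longlonglongrightarrow> 0"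
    using ito_limitD(3)[OF lv1] AE_space
  proof eventually_elim
    case (elim \<omega>)
    have "(\<lambda>k. \<integral>\<^sup>+s. ennreal (((g s - \<gamma> k s) * (indicator {0<..T} s * v1 s \<omega>))\<^sup>2) \<partial>lborel)
       \<longlonglongrightarrow> (\<integral>\<^sup>+s. ennreal ((0 * (indicator {0<..T} s * v1 s \<omega>))\<^sup>2) \<partial>lborel)"
    proof (rule square_integral_multiplier_tendsto[OF _ _ _ elim(1), where D = "2 * C" and \<gamma> = "\<lambda>_. 0"])
      show "(\<lambda>s. indicator {0<..T} s * v1 s \<omega>) \<in> borel_measurable borel"
        by (rule jointly_measurable_section[OF ito_limitD(1)[OF lv1] elim(2)])
      show "\<bar>g s - \<gamma> k s\<bar> \<le> 2 * C" for k s using C[of s] cC[of k s] by linarith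
      show "AE s in lborel. indicator {0<..T} s * v1 s \<omega> \<noteq> 0 \<longrightarrow> (\<lambda>k. g s - \<gamma> k s) \<longlonglongrightarrow> 0"
        using lim
      proof eventually_elim
        case (elim s)
        show ?case
        proof
          assume "indicator {0<..T} s * v1 s \<omega> \<noteq> 0"
          then have "s \<in> {0..T}" by (auto simp: indicator_def split: if_splits)
          then have "(\<lambda>k. g s - \<gamma> k s) \<longlonglongrightarrow> g s - g s" using elim by (intro tendsto_intros) auto
          then show "(\<lambda>k. g s - \<gamma> k s) \<longlonglongrightarrow> 0" by simp
        qed
      qed
    qed measurable
    then show ?case by simp
  qed
  from ito_limit_vanishing[OF ld this] obtain r :: "nat \<Rightarrow> nat" where r: "strict_mono r"
    "AE \<omega> in M. (\<lambda>k. Ig T \<omega> - S1 (r k) \<omega>) \<longlonglongrightarrow> 0" by blast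
  have S2lim: "AE \<omega> in M. (\<lambda>k. S2 (r k) \<omega>) \<longlonglongrightarrow> J \<omega> - (LBINT s:{0..T}. g s * u s \<omega>)"
    using r(2) Jeq X1eq X2eq u1 u2
  proof eventually_elim
    case (elim \<omega>)
    have limr: "AE s in lborel. s \<in> {0..T} \<longrightarrow> (\<lambda>k. \<gamma> (r k) s) \<longlonglongrightarrow> g s"
      using lim
    proof eventually_elim
      case (elim s)
      show ?case
      proof
        assume "s \<in> {0..T}"
        then have "(\<lambda>k. \<gamma> k s) \<longlonglongrightarrow> g s" using elim by blast
        from LIMSEQ_subseq_LIMSEQ[OF this r(1)] show "(\<lambda>k. \<gamma> (r k) s) \<longlonglongrightarrow> g s" by (simp add: comp_def)
      qed
    qed
    have a1: "(\<lambda>k. LBINT s:{0..T}. \<gamma> (r k) s * u1 s \<omega>) \<longlonglongrightarrow> (LBINT s:{0..T}. g s * u1 s \<omega>)"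
      by (rule set_integral_multiplier_tendsto[OF elim(5) g \<gamma>m cC limr])
    have a2: "(\<lambda>k. LBINT s:{0..T}. \<gamma> (r k) s * u s \<omega>) \<longlonglongrightarrow> (LBINT s:{0..T}. g s * u s \<omega>)"
      by (rule set_integral_multiplier_tendsto[OF elim(6) g \<gamma>m cC limr])
    have "(\<lambda>k. Ig T \<omega> - (Ig T \<omega> - S1 (r k) \<omega>)) \<longlonglongrightarrow> Ig T \<omega> - 0"
      by (intro tendsto_intros elim(1))
    then have a3: "(\<lambda>k. S1 (r k) \<omega>) \<longlonglongrightarrow> Ig T \<omega>" by simp
    \<comment> \<open>both differentials of \<open>X\<close> produce the same weighted sum of increments\<close>
    have id: "S2 k \<omega> = S1 k \<omega> + (LBINT s:{0..T}. \<gamma> k s * u1 s \<omega>) - (LBINT s:{0..T}. \<gamma> k s * u s \<omega>)" for k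
    proof -
      have "S1 k \<omega> + (LBINT s:{0..T}. \<gamma> k s * u1 s \<omega>) = (\<Sum>i<n k. c k i * (X (p k (Suc i)) \<omega> - X (p k i) \<omega>))"
        unfolding \<gamma>_def step_function_set_integral[OF p elim(5)] S1_def sum.distrib[symmetric]
      proof (rule sum.cong[OF refl])
        fix i assume "i \<in> {..<n k}"
        then have "p k i \<in> {0..T}" "p k (Suc i) \<in> {0..T}"
          using grid_bounds[OF p[of k], of i] grid_bounds[OF p[of k], of "Suc i"] by auto
        note e = bspec[OF elim(3) this(1)] bspec[OF elim(3) this(2)]
        show "c k i * (I1 (p k (Suc i)) \<omega> - I1 (p k i) \<omega>) +
            c k i * ((LBINT s:{0..p k (Suc i)}. u1 s \<omega>) - (LBINT s:{0..p k i}. u1 s \<omega>)) = c k i * (X (p k (Suc i)) \<omega> - X (p k i) \<omega>)"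
          unfolding e distrib_left[symmetric] by simp
      qed
      moreover have "S2 k \<omega> + (LBINT s:{0..T}. \<gamma> k s * u s \<omega>) = (\<Sum>i<n k. c k i * (X (p k (Suc i)) \<omega> - X (p k i) \<omega>))"
        unfolding \<gamma>_def step_function_set_integral[OF p elim(6)] S2_def sum.distrib[symmetric]
      proof (rule sum.cong[OF refl])
        fix i assume "i \<in> {..<n k}"
        then have "p k i \<in> {0..T}" "p k (Suc i) \<in> {0..T}"
          using grid_bounds[OF p[of k], of i] grid_bounds[OF p[of k], of "Suc i"] by auto
        note e = bspec[OF elim(4) this(1)] bspec[OF elim(4) this(2)]
        show "c k i * (I2 (p k (Suc i)) \<omega> - I2 (p k i) \<omega>) +
            c k i * ((LBINT s:{0..p k (Suc i)}. u s \<omega>) - (LBINT s:{0..p k i}. u s \<omega>)) = c k i * (X (p k (Suc i)) \<omega> - X (p k i) \<omega>)"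
          unfolding e distrib_left[symmetric] by simp
      qed
      ultimately show ?thesis by linarith
    qed
    have "(\<lambda>k. S2 (r k) \<omega>) \<longlonglongrightarrow> Ig T \<omega> + (LBINT s:{0..T}. g s * u1 s \<omega>) - (LBINT s:{0..T}. g s * u s \<omega>)"
      unfolding id by (intro tendsto_intros a1 a2 a3)
    then show ?case using elim(2) by (simp add: add.commute)
  qed
  define q where "q k \<omega> = (\<integral>\<^sup>+s. ennreal ((\<gamma> k s * (indicator {0<..T} s * v s \<omega>))\<^sup>2) \<partial>lborel)" for k \<omega>
  define q' where "q' \<omega> = (\<integral>\<^sup>+s. ennreal ((g s * (indicator {0<..T} s * v s \<omega>))\<^sup>2) \<partial>lborel)" for \<omega>
  define Q where "Q \<omega> = (\<integral>\<^sup>+s. ennreal ((indicator {0<..T} s * v s \<omega>)\<^sup>2) \<partial>lborel)" for \<omega>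
  note jv = ito_limitD(1)[OF lv]
  have mult: "jointly_measurable M (\<lambda>s \<omega>. f s * (indicator {0<..T} s * v s \<omega>))" if "f \<in> borel_measurable borel" for f
    using borel_measurable_times[OF measurable_compose[OF measurable_fst that] jv[unfolded jointly_measurable_def]]
    by (simp add: jointly_measurable_def)
  have qm[measurable]: "q k \<in> borel_measurable M" "q' \<in> borel_measurable M" "Q \<in> borel_measurable M" for k
    unfolding q_def q'_def Q_def
    by (rule jointly_measurable_square_integral[OF mult[OF \<gamma>m]] jointly_measurable_square_integral[OF mult[OF g]]
        jointly_measurable_square_integral[OF jv])+
  have qlim: "(\<lambda>k. \<integral>\<^sup>+\<omega>. q (r k) \<omega> \<partial>M) \<longlonglongrightarrow> (\<integral>\<^sup>+\<omega>. q' \<omega> \<partial>M)"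
  proof (rule nn_integral_dominated_convergence[where w = "\<lambda>\<omega>. ennreal (C\<^sup>2) * Q \<omega>"])
    show "(\<integral>\<^sup>+\<omega>. ennreal (C\<^sup>2) * Q \<omega> \<partial>M) < \<infinity>"
      using fin by (simp add: nn_integral_cmult Q_def[symmetric] ennreal_mult_less_top)
    show "AE \<omega> in M. q (r k) \<omega> \<le> ennreal (C\<^sup>2) * Q \<omega>" for k
    proof (rule AE_I2)
      fix \<omega> assume \<omega>: "\<omega> \<in> space M"
      note [measurable] = jointly_measurable_section[OF jv \<omega>]
      have "q (r k) \<omega> \<le> (\<integral>\<^sup>+s. ennreal (C\<^sup>2) * ennreal ((indicator {0<..T} s * v s \<omega>)\<^sup>2) \<partial>lborel)"
        unfolding q_def
      proof (rule nn_integral_mono)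
        fix s
        have "\<bar>\<gamma> (r k) s\<bar>\<^sup>2 \<le> C\<^sup>2" using cC by (intro power_mono) auto
        then have "(\<gamma> (r k) s * (indicator {0<..T} s * v s \<omega>))\<^sup>2 \<le> C\<^sup>2 * (indicator {0<..T} s * v s \<omega>)\<^sup>2"
          unfolding power_mult_distrib[of "\<gamma> (r k) s"] by (intro mult_right_mono) auto
        then show "ennreal ((\<gamma> (r k) s * (indicator {0<..T} s * v s \<omega>))\<^sup>2) \<le> ennreal (C\<^sup>2) * ennreal ((indicator {0<..T} s * v s \<omega>)\<^sup>2)"
          by (subst ennreal_mult[symmetric]) (auto intro: ennreal_leI)
      qed
      also have "\<dots> = ennreal (C\<^sup>2) * Q \<omega>" unfolding Q_def by (rule nn_integral_cmult) measurable
      finally show "q (r k) \<omega> \<le> ennreal (C\<^sup>2) * Q \<omega>" .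
    qed
    show "AE \<omega> in M. (\<lambda>k. q (r k) \<omega>) \<longlonglongrightarrow> q' \<omega>"
      using ito_limitD(3)[OF lv] AE_space
    proof eventually_elim
      case (elim \<omega>)
      have "(\<lambda>k. q k \<omega>) \<longlonglongrightarrow> q' \<omega>"
        unfolding q_def q'_def
      proof (rule square_integral_multiplier_tendsto[OF _ g \<gamma>m elim(1) cC])
        show "(\<lambda>s. indicator {0<..T} s * v s \<omega>) \<in> borel_measurable borel"
          by (rule jointly_measurable_section[OF jv elim(2)])
        show "AE s in lborel. indicator {0<..T} s * v s \<omega> \<noteq> 0 \<longrightarrow> (\<lambda>k. \<gamma> k s) \<longlonglongrightarrow> g s"
          using lim by eventually_elim (auto simp: indicator_def split: if_splits)
      qed
      from LIMSEQ_subseq_LIMSEQ[OF this r(1)] show ?case by (simp add: comp_def)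
    qed
  qed measurable
  have S2m[measurable]: "S2 k \<in> borel_measurable M" for k by (rule ito_limitD(2)[OF l2])
  have "(\<integral>\<^sup>+\<omega>. ennreal ((J \<omega> - (LBINT s:{0..T}. g s * u s \<omega>))\<^sup>2) \<partial>M)
    \<le> (\<integral>\<^sup>+\<omega>. liminf (\<lambda>k. ennreal ((S2 (r k) \<omega>)\<^sup>2)) \<partial>M)"
  proof (rule nn_integral_mono_AE)
    show "AE \<omega> in M. ennreal ((J \<omega> - (LBINT s:{0..T}. g s * u s \<omega>))\<^sup>2) \<le> liminf (\<lambda>k. ennreal ((S2 (r k) \<omega>)\<^sup>2))"
      using S2lim
    proof eventually_elim
      case (elim \<omega>)
      have "(\<lambda>k. ennreal ((S2 (r k) \<omega>)\<^sup>2)) \<longlonglongrightarrow> ennreal ((J \<omega> - (LBINT s:{0..T}. g s * u s \<omega>))\<^sup>2)"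
        by (intro tendsto_ennrealI tendsto_intros elim)
      from lim_imp_Liminf[OF sequentially_bot this] show ?case by simp
    qed
  qed
  also have "\<dots> \<le> liminf (\<lambda>k. \<integral>\<^sup>+\<omega>. ennreal ((S2 (r k) \<omega>)\<^sup>2) \<partial>M)"
    by (rule nn_integral_liminf) measurable
  also have "\<dots> \<le> liminf (\<lambda>k. \<integral>\<^sup>+\<omega>. q (r k) \<omega> \<partial>M)"
    unfolding q_def by (intro Liminf_mono always_eventually allI ito_limit_L2_bound[OF l2])
  also have "\<dots> = (\<integral>\<^sup>+\<omega>. q' \<omega> \<partial>M)" by (rule lim_imp_Liminf[OF sequentially_bot qlim])
  finally show ?thesis by (simp add: q'_def)
qed

section \<open>Distance of the diffusion from its deterministic limit\<close>

lemma nn_integral_lborel_swap: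
  fixes f :: "real \<Rightarrow> 'a \<Rightarrow> ennreal"
  assumes "(\<lambda>x. f (fst x) (snd x)) \<in> borel_measurable (borel \<Otimes>\<^sub>M M)"
  shows "(\<integral>\<^sup>+\<omega>. (\<integral>\<^sup>+s. f s \<omega> \<partial>lborel) \<partial>M) = (\<integral>\<^sup>+s. (\<integral>\<^sup>+\<omega>. f s \<omega> \<partial>M) \<partial>lborel)"
proof -
  interpret P: pair_sigma_finite lborel M
    by (intro pair_sigma_finite.intro sigma_finite_measure_axioms lborel.sigma_finite_measure_axioms)
  have "(\<lambda>(s, \<omega>). f s \<omega>) \<in> borel_measurable (lborel \<Otimes>\<^sub>M M)"
    using assms by (simp add: case_prod_beta cong: measurable_cong_sets)
  from P.Fubini'[OF this] show ?thesis by simp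
qed

lemma running_square_integral_measurable:
  assumes Vj: "jointly_measurable M V"
  shows "(\<lambda>y. \<integral>\<^sup>+r. indicator {0<..fst y} r * ennreal ((V r (snd y))\<^sup>2) \<partial>lborel)
    \<in> borel_measurable (borel \<Otimes>\<^sub>M M)"
proof (rule lborel.borel_measurable_nn_integral)
  have "(\<lambda>z. V (snd z) (snd (fst z))) \<in> borel_measurable ((borel \<Otimes>\<^sub>M M) \<Otimes>\<^sub>M lborel)"
    using jointly_measurable_comp[OF Vj, of snd "(borel \<Otimes>\<^sub>M M) \<Otimes>\<^sub>M lborel" "\<lambda>z. snd (fst z)"] by simp
  then have 1: "(\<lambda>z. ennreal ((V (snd z) (snd (fst z)))\<^sup>2)) \<in> borel_measurable ((borel \<Otimes>\<^sub>M M) \<Otimes>\<^sub>M lborel)"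
    by (intro measurable_compose[OF _ measurable_ennreal] borel_measurable_power)
  have s1: "(\<lambda>z :: (real \<times> 'a) \<times> real. snd z) \<in> borel_measurable ((borel \<Otimes>\<^sub>M M) \<Otimes>\<^sub>M lborel)"
    using measurable_snd[of "borel \<Otimes>\<^sub>M M" lborel] measurable_cong_sets[OF refl sets_lborel] by blast
  have s2: "(\<lambda>z :: (real \<times> 'a) \<times> real. fst (fst z)) \<in> borel_measurable ((borel \<Otimes>\<^sub>M M) \<Otimes>\<^sub>M lborel)"
    by (rule measurable_compose[OF measurable_fst measurable_fst])
  have 2: "(\<lambda>z :: (real \<times> 'a) \<times> real. if 0 < snd z \<and> snd z \<le> fst (fst z) then 1 else 0 :: ennreal) \<in> borel_measurable ((borel \<Otimes>\<^sub>M M) \<Otimes>\<^sub>M lborel)"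
  proof (rule measurable_If[OF measurable_const measurable_const])
    let ?N = "((borel :: real measure) \<Otimes>\<^sub>M M) \<Otimes>\<^sub>M (lborel :: real measure)"
    have "{z \<in> space ?N. 0 < snd z \<and> snd z \<le> fst (fst z)}
        = {z \<in> space ?N. 0 < snd z} \<inter> {z \<in> space ?N. snd z \<le> fst (fst z)}" by auto
    also have "\<dots> \<in> sets ?N"
      using borel_measurable_less[OF borel_measurable_const[of 0] s1] borel_measurable_le[OF s1 s2]
      by (rule sets.Int)
    finally show "{z \<in> space ?N. 0 < snd z \<and> snd z \<le> fst (fst z)} \<in> sets ?N" .
  qed auto
  have 3: "(\<lambda>(y, r). indicator {0<..fst y} r * ennreal ((V r (snd y))\<^sup>2))
     = (\<lambda>z. (if 0 < snd z \<and> snd z \<le> fst (fst z) then 1 else 0 :: ennreal) * ennreal ((V (snd z) (snd (fst z)))\<^sup>2))"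
    by (auto simp: fun_eq_iff indicator_def)
  show "(\<lambda>(y, r). indicator {0<..fst y} r * ennreal ((V r (snd y))\<^sup>2)) \<in> borel_measurable ((borel \<Otimes>\<^sub>M M) \<Otimes>\<^sub>M lborel)"
    unfolding 3 by (rule borel_measurable_times_ennreal[OF 2 1])
qed

text \<open>For fixed \<open>c > 0\<close> let \<open>Q s = \<integral>\<^sub>0\<^sup>s v\<^sup>2\<close>, \<open>f s = E [(X\<^sub>s - x\<^sub>s)\<^sup>2; Q s < c]\<close> and \<open>m s = E min c (Q s)\<close>. The pathwise
  Gronwall inequality and the cutoff inequality give \<open>f \<le> K m\<close>, since the events \<open>Q s < c\<close> decrease in
  \<open>s\<close>. Conversely \<open>m u\<close> is at most the integral over \<open>{0<..u}\<close> of \<open>E [v\<^sub>s\<^sup>2; Q s < c]\<close>, which linear growth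
  bounds in terms of \<open>f s\<close>. So \<open>m\<close> satisfies a Gronwall inequality whose constants are free of \<open>c\<close>, and
  \<open>c\<close> may tend to infinity.\<close>
theorem linear_sde_deviation_bound:
  fixes x \<theta> :: "real \<Rightarrow> real"
  assumes T: "0 < T" and X: "has_ito_differential M F W T X (\<lambda>t \<omega>. \<theta> t * X t \<omega>) v"
    and X0: "AE \<omega> in M. X 0 \<omega> = x0"
    and \<theta>m: "\<theta> \<in> borel_measurable borel" and L: "\<And>t. t \<in> {0..T} \<Longrightarrow> \<bar>\<theta> t\<bar> \<le> L"
    and xc: "continuous_on {0..T} x" and x: "\<And>t. t \<in> {0..T} \<Longrightarrow> x t = x0 + (LBINT s:{0..t}. \<theta> s * x s)"
    and B: "\<And>t. t \<in> {0..T} \<Longrightarrow> \<bar>x t\<bar> \<le> B"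
    and v: "\<And>s \<omega>. s \<in> {0..T} \<Longrightarrow> \<omega> \<in> space M \<Longrightarrow> (v s \<omega>)\<^sup>2 \<le> \<kappa> * (1 + (X s \<omega>)\<^sup>2)" and \<kappa>: "0 < \<kappa>"
    and t: "t \<in> {0..T}"
  defines "K \<equiv> 2 + 2 * L\<^sup>2 * (exp (L * T))\<^sup>2 * T * T"
  shows "(\<integral>\<^sup>+\<omega>. ennreal ((X t \<omega> - x t)\<^sup>2) \<partial>M)
    \<le> ennreal (\<kappa> * (2 * K * (1 + 2 * B\<^sup>2) * T * exp (4 * \<kappa> * K * T)))"
proof -
  have T0: "0 \<le> T" and TT: "T \<in> {0..T}" using T by auto
  define c1 where "c1 = 2 * L\<^sup>2 * (exp (L * T))\<^sup>2 * T"
  have c1: "0 \<le> c1" using T by (simp add: c1_def)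
  have K: "K = 2 + c1 * T" by (simp add: K_def c1_def)
  have K0: "2 \<le> K" using c1 T unfolding K by simp
  obtain I where I: "has_ito_integral M F W T v I"
    and Xeq: "AE \<omega> in M. \<forall>t\<in>{0..T}. X t \<omega> = X 0 \<omega> + (LBINT s:{0..t}. \<theta> s * X s \<omega>) + I t \<omega>"
    by (rule has_ito_differentialE[OF X])
  note XD = has_ito_differentialD[OF X]
  have Iad: "adapted_on F {0..T} I" and Icont: "continuous_paths_on M {0..T} I"
    using I unfolding has_ito_integral_def by - (elim conjE, assumption)+
  obtain I' where I': "jointly_measurable M I'" "AE \<omega> in M. \<forall>s\<in>{0..T}. I' s \<omega> = I s \<omega>"
    using continuous_jointly_measurable_version[OF Iad Icont T0] by blast
  define V where "V s \<omega> = indicator {0<..T} s * v s \<omega>" for s \<omega>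
  note lim = has_ito_integral_imp_ito_limit[OF I]
  have Vj: "jointly_measurable M V" unfolding V_def using ito_limitD(1)[OF lim[OF TT]] by simp
  define Q where "Q s \<omega> = (\<integral>\<^sup>+r. indicator {0<..s} r * ennreal ((V r \<omega>)\<^sup>2) \<partial>lborel)" for s \<omega>
  have Qlim: "(\<integral>\<^sup>+r. ennreal ((indicator {0<..s} r * v r \<omega>)\<^sup>2) \<partial>lborel) = Q s \<omega>" if "s \<in> {0..T}" for s \<omega>
    unfolding Q_def V_def by (intro nn_integral_cong) (use that in \<open>auto simp: indicator_def\<close>)
  have Qj: "(\<lambda>y. Q (fst y) (snd y)) \<in> borel_measurable (borel \<Otimes>\<^sub>M M)"
    unfolding Q_def by (rule running_square_integral_measurable[OF Vj])
  have Qm[measurable]: "Q s \<in> borel_measurable M" for s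
    using measurable_compose[OF measurable_Pair1'[of s borel M] Qj] by simp
  have Qmono: "Q s \<omega> \<le> Q s' \<omega>" if "s \<le> s'" for s s' \<omega>
    unfolding Q_def by (intro nn_integral_mono) (use that in \<open>auto simp: indicator_def\<close>)
  have Qfin: "AE \<omega> in M. Q T \<omega> < \<infinity>" using ito_limitD(3)[OF lim[OF TT]] unfolding Qlim[OF TT] .
  have Xm: "X s \<in> borel_measurable M" if "s \<in> {0..T}" for s by (rule adapted_measurable[OF XD(1) that])
  have Im: "I s \<in> borel_measurable M" if "s \<in> {0..T}" for s by (rule adapted_measurable[OF Iad that])
  have path: "AE \<omega> in M. (\<forall>s\<in>{0..T}. I' s \<omega> = I s \<omega>) \<and> (\<forall>t\<in>{0..T}. ennreal ((X t \<omega> - x t)\<^sup>2) \<le> 2 * ennreal ((I t \<omega>)\<^sup>2)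
    + ennreal c1 * (\<integral>\<^sup>+s. indicator {0..t} s * ennreal ((I s \<omega>)\<^sup>2) \<partial>lborel))"
    using Xeq X0 XD(2)[unfolded continuous_paths_on_def] XD(4) Icont[unfolded continuous_paths_on_def] I'(2)
  proof eventually_elim
    case (elim \<omega>)
    have xint: "set_integrable lborel {0..T} (\<lambda>s. \<theta> s * x s)"
      by (rule set_integrable_bounded_times[OF \<theta>m L borel_integrable_atLeastAtMost'[OF xc]])
    show ?case
    proof (intro conjI ballI)
      fix t assume t: "t \<in> {0..T}"
      show "ennreal ((X t \<omega> - x t)\<^sup>2) \<le> 2 * ennreal ((I t \<omega>)\<^sup>2)
         + ennreal c1 * (\<integral>\<^sup>+s. indicator {0..t} s * ennreal ((I s \<omega>)\<^sup>2) \<partial>lborel)"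
        unfolding c1_def
      proof (rule linear_volterra_bound[OF _ _ \<theta>m L _ t])
        show "continuous_on {0..T} (\<lambda>s. X s \<omega> - x s)" by (intro continuous_intros elim xc)
        show "continuous_on {0..T} (\<lambda>s. I s \<omega>)" by (rule elim)
        fix t assume t: "t \<in> {0..T}"
        have "set_integrable lborel {0..t} (\<lambda>s. \<theta> s * X s \<omega>)" "set_integrable lborel {0..t} (\<lambda>s. \<theta> s * x s)"
          using t by (auto intro: set_integrable_subset[OF elim(4)] set_integrable_subset[OF xint])
        then have "(LBINT s:{0..t}. \<theta> s * (X s \<omega> - x s)) = (LBINT s:{0..t}. \<theta> s * X s \<omega>) - (LBINT s:{0..t}. \<theta> s * x s)"
          by (simp add: right_diff_distrib set_integral_diff)
        then show "X t \<omega> - x t = (LBINT s:{0..t}. \<theta> s * (X s \<omega> - x s)) + I t \<omega>"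
          using bspec[OF elim(1) t] elim(2) x[OF t] by linarith
      qed
    qed (use elim(6) in blast)
  qed
  show ?thesis
  proof (rule nn_integral_le_of_cutoffs[OF Qm _ Qfin])
    show "(\<lambda>\<omega>. ennreal ((X t \<omega> - x t)\<^sup>2)) \<in> borel_measurable M" using Xm[OF t] by measurable
    fix c :: real assume c: "0 < c"
    define E where "E s \<omega> = (indicator {\<omega>. Q s \<omega> < ennreal c} \<omega> :: ennreal)" for s \<omega>
    have Em[measurable]: "E s \<in> borel_measurable M" for s unfolding E_def by measurable
    have Ej: "(\<lambda>y. E (fst y) (snd y)) \<in> borel_measurable (borel \<Otimes>\<^sub>M M)"
    proof -
      have "{y \<in> space (borel \<Otimes>\<^sub>M M). Q (fst y) (snd y) < ennreal c} \<in> sets (borel \<Otimes>\<^sub>M M)"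
        by (rule borel_measurable_less[OF Qj borel_measurable_const])
      then have "(\<lambda>y. if Q (fst y) (snd y) < ennreal c then 1 else 0 :: ennreal) \<in> borel_measurable (borel \<Otimes>\<^sub>M M)"
        by (rule measurable_If[OF borel_measurable_const borel_measurable_const])
      then show ?thesis unfolding E_def indicator_def mem_Collect_eq of_bool_def .
    qed
    have Emono: "E s' \<omega> \<le> E s \<omega>" if "s \<le> s'" for s s' \<omega>
      using Qmono[OF that, of \<omega>] by (auto simp: E_def indicator_def)
    have E1: "E s \<omega> \<le> 1" for s \<omega> by (simp add: E_def indicator_def)
    define m where "m s = (\<integral>\<^sup>+\<omega>. min (ennreal c) (Q s \<omega>) \<partial>M)" for s
    define f where "f s = (\<integral>\<^sup>+\<omega>. E s \<omega> * ennreal ((X s \<omega> - x s)\<^sup>2) \<partial>M)" for s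
    have mmono: "m s \<le> m s'" if "s \<le> s'" for s s'
      unfolding m_def by (intro nn_integral_mono min.mono Qmono that order_refl)
    have mc: "m s \<le> ennreal c" for s
    proof -
      have "m s \<le> (\<integral>\<^sup>+\<omega>. ennreal c \<partial>M)" unfolding m_def by (intro nn_integral_mono) simp
      then show ?thesis by (simp add: emeasure_space_1)
    qed
    have EI: "(\<integral>\<^sup>+\<omega>. E s \<omega> * ennreal ((I s \<omega>)\<^sup>2) \<partial>M) \<le> m s" if s: "s \<in> {0..T}" for s
      using ito_limit_cutoff_inequality[OF lim[OF s], of c] c unfolding Qlim[OF s] E_def m_def by simp
    have fm: "f s \<le> ennreal K * m s" if s: "s \<in> {0..T}" for s
    proof -
      have fs: "f s \<le> (\<integral>\<^sup>+\<omega>. 2 * (E s \<omega> * ennreal ((I s \<omega>)\<^sup>2))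
          + ennreal c1 * (\<integral>\<^sup>+r. indicator {0..s} r * (E r \<omega> * ennreal ((I' r \<omega>)\<^sup>2)) \<partial>lborel) \<partial>M)"
        unfolding f_def
      proof (rule nn_integral_mono_AE)
        show "AE \<omega> in M. E s \<omega> * ennreal ((X s \<omega> - x s)\<^sup>2) \<le> 2 * (E s \<omega> * ennreal ((I s \<omega>)\<^sup>2))
          + ennreal c1 * (\<integral>\<^sup>+r. indicator {0..s} r * (E r \<omega> * ennreal ((I' r \<omega>)\<^sup>2)) \<partial>lborel)"
          using path AE_space
        proof eventually_elim
          case (elim \<omega>)
          show ?case
          proof (cases "Q s \<omega> < ennreal c")
            case False
            then show ?thesis by (simp add: E_def)
          next
            case True
            \<comment> \<open>the events decrease in time, so the indicator may be moved under the time integral\<close>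
            have E1: "E r \<omega> = 1" if "r \<le> s" for r
              using le_less_trans[OF Qmono[OF that] True] by (simp add: E_def)
            have "(\<integral>\<^sup>+r. indicator {0..s} r * (E r \<omega> * ennreal ((I' r \<omega>)\<^sup>2)) \<partial>lborel)
               = (\<integral>\<^sup>+r. indicator {0..s} r * ennreal ((I r \<omega>)\<^sup>2) \<partial>lborel)"
              by (intro nn_integral_cong) (use elim(1) s E1 in \<open>auto simp: indicator_def\<close>)
            then show ?thesis using bspec[OF conjunct2[OF elim(1)] s] E1[of s] by simp
          qed
        qed
      qed
      have split: "(\<integral>\<^sup>+\<omega>. 2 * (E s \<omega> * ennreal ((I s \<omega>)\<^sup>2))
          + ennreal c1 * (\<integral>\<^sup>+r. indicator {0..s} r * (E r \<omega> * ennreal ((I' r \<omega>)\<^sup>2)) \<partial>lborel) \<partial>M)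
         = 2 * (\<integral>\<^sup>+\<omega>. E s \<omega> * ennreal ((I s \<omega>)\<^sup>2) \<partial>M)
          + ennreal c1 * (\<integral>\<^sup>+\<omega>. (\<integral>\<^sup>+r. indicator {0..s} r * (E r \<omega> * ennreal ((I' r \<omega>)\<^sup>2)) \<partial>lborel) \<partial>M)"
      proof -
        have 1: "(\<lambda>\<omega>. E s \<omega> * ennreal ((I s \<omega>)\<^sup>2)) \<in> borel_measurable M" using Im[OF s] by measurable
        have 2: "(\<lambda>y. indicator {0..s} (fst y) * (E (fst y) (snd y) * ennreal ((I' (fst y) (snd y))\<^sup>2))) \<in> borel_measurable (borel \<Otimes>\<^sub>M M)"
          using Ej I'(1)[unfolded jointly_measurable_def]
          by (intro borel_measurable_times_ennreal measurable_compose[OF _ measurable_ennreal] borel_measurable_power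
              measurable_compose[OF measurable_fst borel_measurable_indicator]) auto
        have 3: "(\<lambda>\<omega>. \<integral>\<^sup>+r. indicator {0..s} r * (E r \<omega> * ennreal ((I' r \<omega>)\<^sup>2)) \<partial>lborel) \<in> borel_measurable M"
          using measurable_compose[OF measurable_pair_swap' 2]
          by (intro lborel.borel_measurable_nn_integral) (simp add: case_prod_beta cong: measurable_cong_sets)
        show ?thesis using 1 3 by (simp add: nn_integral_add nn_integral_cmult)
      qed
      have "(\<integral>\<^sup>+\<omega>. (\<integral>\<^sup>+r. indicator {0..s} r * (E r \<omega> * ennreal ((I' r \<omega>)\<^sup>2)) \<partial>lborel) \<partial>M)
        = (\<integral>\<^sup>+r. (\<integral>\<^sup>+\<omega>. indicator {0..s} r * (E r \<omega> * ennreal ((I' r \<omega>)\<^sup>2)) \<partial>M) \<partial>lborel)"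
      proof (rule nn_integral_lborel_swap)
        show "(\<lambda>y. indicator {0..s} (fst y) * (E (fst y) (snd y) * ennreal ((I' (fst y) (snd y))\<^sup>2))) \<in> borel_measurable (borel \<Otimes>\<^sub>M M)"
          using Ej I'(1)[unfolded jointly_measurable_def]
          by (intro borel_measurable_times_ennreal measurable_compose[OF _ measurable_ennreal] borel_measurable_power
              measurable_compose[OF measurable_fst borel_measurable_indicator]) auto
      qed
      also have "\<dots> \<le> (\<integral>\<^sup>+r. indicator {0..s} r * m s \<partial>lborel)"
      proof (rule nn_integral_mono)
        fix r :: real
        show "(\<integral>\<^sup>+\<omega>. indicator {0..s} r * (E r \<omega> * ennreal ((I' r \<omega>)\<^sup>2)) \<partial>M) \<le> indicator {0..s} r * m s"
        proof (cases "r \<in> {0..s}")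
          case True
          then have r: "r \<in> {0..T}" "r \<le> s" using s by auto
          have "(\<integral>\<^sup>+\<omega>. E r \<omega> * ennreal ((I' r \<omega>)\<^sup>2) \<partial>M) = (\<integral>\<^sup>+\<omega>. E r \<omega> * ennreal ((I r \<omega>)\<^sup>2) \<partial>M)"
          proof (rule nn_integral_cong_AE)
            show "AE \<omega> in M. E r \<omega> * ennreal ((I' r \<omega>)\<^sup>2) = E r \<omega> * ennreal ((I r \<omega>)\<^sup>2)"
              using I'(2) by eventually_elim (use r in simp)
          qed
          also have "\<dots> \<le> m s" by (rule order_trans[OF EI[OF r(1)] mmono[OF r(2)]])
          finally show ?thesis using True by simp
        qed simp
      qed
      also have "\<dots> = ennreal s * m s" using s by (simp add: nn_integral_multc)
      finally have drift: "(\<integral>\<^sup>+\<omega>. (\<integral>\<^sup>+r. indicator {0..s} r * (E r \<omega> * ennreal ((I' r \<omega>)\<^sup>2)) \<partial>lborel) \<partial>M)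
        \<le> ennreal s * m s" .
      have "f s \<le> 2 * (\<integral>\<^sup>+\<omega>. E s \<omega> * ennreal ((I s \<omega>)\<^sup>2) \<partial>M) + ennreal c1 * (ennreal s * m s)"
        by (rule order_trans[OF fs[unfolded split] add_left_mono[OF mult_left_mono[OF drift]]]) simp
      also have "\<dots> \<le> 2 * m s + ennreal c1 * (ennreal T * m s)"
        using EI[OF s] s by (intro add_mono mult_left_mono mult_right_mono ennreal_leI) auto
      also have "\<dots> = ennreal K * m s"
        unfolding K using c1 T by (simp add: ennreal_mult distrib_right mult.assoc)
      finally show ?thesis .
    qed
    \<comment> \<open>\<open>m\<close> is bounded by \<open>c\<close>, hence has real values\<close>
    define mr where "mr s = enn2real (m s)" for s
    have mr: "ennreal (mr s) = m s" for s
      unfolding mr_def by (rule ennreal_enn2real[OF le_less_trans[OF mc]]) simp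
    have "mr t \<le> 2 * (\<kappa> * (1 + 2 * B\<^sup>2)) * T * exp (2 * (2 * \<kappa> * K) * T)"
    proof (rule weighted_gronwall[OF _ _ _ _ T0 _ t])
      show "0 \<le> mr s" for s by (simp add: mr_def)
      show "mr s \<le> c" for s unfolding mr_def using mc[of s] c by (intro enn2real_leI) auto
      show "0 \<le> \<kappa> * (1 + 2 * B\<^sup>2)" "0 < 2 * \<kappa> * K" using \<kappa> K0 by auto
      fix u assume u: "u \<in> {0..T}"
      have uT: "AE \<omega> in M. Q u \<omega> < \<infinity>"
        using Qfin by eventually_elim (use u Qmono in \<open>auto intro: le_less_trans\<close>)
      have "m u \<le> (\<integral>\<^sup>+\<omega>. (\<integral>\<^sup>+s. indicator {0<..u} s * (E s \<omega> * ennreal ((V s \<omega>)\<^sup>2)) \<partial>lborel) \<partial>M)"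
        unfolding m_def
      proof (rule nn_integral_mono_AE)
        show "AE \<omega> in M. min (ennreal c) (Q u \<omega>) \<le> (\<integral>\<^sup>+s. indicator {0<..u} s * (E s \<omega> * ennreal ((V s \<omega>)\<^sup>2)) \<partial>lborel)"
          using uT AE_space
        proof eventually_elim
          case (elim \<omega>)
          have "(\<lambda>s. ennreal ((V s \<omega>)\<^sup>2)) \<in> borel_measurable borel"
            using jointly_measurable_section[OF Vj elim(2)] by measurable
          from stopped_integral_lower_bound[OF this, of u c] elim(1) u
          show ?case unfolding Q_def E_def by (simp add: indicator_def)
        qed
      qed
      also have "\<dots> = (\<integral>\<^sup>+s. (\<integral>\<^sup>+\<omega>. indicator {0<..u} s * (E s \<omega> * ennreal ((V s \<omega>)\<^sup>2)) \<partial>M) \<partial>lborel)"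
      proof (rule nn_integral_lborel_swap)
        show "(\<lambda>y. indicator {0<..u} (fst y) * (E (fst y) (snd y) * ennreal ((V (fst y) (snd y))\<^sup>2))) \<in> borel_measurable (borel \<Otimes>\<^sub>M M)"
          using Ej Vj[unfolded jointly_measurable_def]
          by (intro borel_measurable_times_ennreal measurable_compose[OF _ measurable_ennreal] borel_measurable_power
              measurable_compose[OF measurable_fst borel_measurable_indicator]) auto
      qed
      also have "\<dots> \<le> (\<integral>\<^sup>+s. indicator {0<..u} s * ennreal (\<kappa> * (1 + 2 * B\<^sup>2) + 2 * \<kappa> * K * mr s) \<partial>lborel)"
      proof (rule nn_integral_mono)
        fix s :: real
        show "(\<integral>\<^sup>+\<omega>. indicator {0<..u} s * (E s \<omega> * ennreal ((V s \<omega>)\<^sup>2)) \<partial>M)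
           \<le> indicator {0<..u} s * ennreal (\<kappa> * (1 + 2 * B\<^sup>2) + 2 * \<kappa> * K * mr s)"
        proof (cases "s \<in> {0<..u}")
          case True
          then have s: "s \<in> {0..T}" using u by auto
          have "(\<integral>\<^sup>+\<omega>. E s \<omega> * ennreal ((V s \<omega>)\<^sup>2) \<partial>M)
            \<le> (\<integral>\<^sup>+\<omega>. ennreal (\<kappa> * (1 + 2 * B\<^sup>2)) + ennreal (2 * \<kappa>) * (E s \<omega> * ennreal ((X s \<omega> - x s)\<^sup>2)) \<partial>M)"
          proof (rule nn_integral_mono)
            fix \<omega> assume \<omega>: "\<omega> \<in> space M"
            have "(V s \<omega>)\<^sup>2 \<le> \<kappa> * (1 + (X s \<omega>)\<^sup>2)"
              using order_trans[OF _ v[OF s \<omega>], of "(V s \<omega>)\<^sup>2"] by (simp add: V_def indicator_def)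
            then have "ennreal ((V s \<omega>)\<^sup>2) \<le> ennreal (\<kappa> * (1 + 2 * B\<^sup>2)) + ennreal (2 * \<kappa>) * ennreal ((X s \<omega> - x s)\<^sup>2)"
              using B[OF s] \<kappa> by (intro linear_growth_around) auto
            then show "E s \<omega> * ennreal ((V s \<omega>)\<^sup>2) \<le> ennreal (\<kappa> * (1 + 2 * B\<^sup>2)) + ennreal (2 * \<kappa>) * (E s \<omega> * ennreal ((X s \<omega> - x s)\<^sup>2))"
              by (auto simp: E_def indicator_def)
          qed
          also have "\<dots> = ennreal (\<kappa> * (1 + 2 * B\<^sup>2)) + ennreal (2 * \<kappa>) * f s"
            unfolding f_def using Xm[OF s] by (simp add: nn_integral_add nn_integral_cmult emeasure_space_1)
          also have "\<dots> \<le> ennreal (\<kappa> * (1 + 2 * B\<^sup>2)) + ennreal (2 * \<kappa>) * (ennreal K * m s)"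
            by (intro add_left_mono mult_left_mono fm[OF s]) simp
          also have "\<dots> = ennreal (\<kappa> * (1 + 2 * B\<^sup>2) + 2 * \<kappa> * K * mr s)"
            unfolding mr[symmetric] using \<kappa> K0
            by (simp add: ennreal_mult[symmetric] ennreal_plus[symmetric] mr_def mult.assoc del: ennreal_plus)
          finally show ?thesis using True by simp
        qed simp
      qed
      finally show "ennreal (mr u) \<le> (\<integral>\<^sup>+s. indicator {0<..u} s * ennreal (\<kappa> * (1 + 2 * B\<^sup>2) + 2 * \<kappa> * K * mr s) \<partial>lborel)"
        unfolding mr .
    qed
    then have "K * mr t \<le> K * (2 * (\<kappa> * (1 + 2 * B\<^sup>2)) * T * exp (2 * (2 * \<kappa> * K) * T))"
      using K0 by (intro mult_left_mono) auto
    also have "\<dots> = \<kappa> * (2 * K * (1 + 2 * B\<^sup>2) * T * exp (4 * \<kappa> * K * T))" by simp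
    finally have "ennreal (K * mr t) \<le> ennreal (\<kappa> * (2 * K * (1 + 2 * B\<^sup>2) * T * exp (4 * \<kappa> * K * T)))"
      by (rule ennreal_leI)
    then have bound: "ennreal K * m t \<le> ennreal (\<kappa> * (2 * K * (1 + 2 * B\<^sup>2) * T * exp (4 * \<kappa> * K * T)))"
      unfolding mr[symmetric] using K0 by (simp add: ennreal_mult mr_def)
    have "(\<integral>\<^sup>+\<omega>. indicator {\<omega>. Q T \<omega> < ennreal c} \<omega> * ennreal ((X t \<omega> - x t)\<^sup>2) \<partial>M) \<le> f t"
      unfolding f_def E_def[symmetric] using t by (intro nn_integral_mono mult_right_mono Emono) auto
    from order_trans[OF this order_trans[OF fm[OF t] bound]]
    show "(\<integral>\<^sup>+\<omega>. indicator {\<omega>. Q T \<omega> < ennreal c} \<omega> * ennreal ((X t \<omega> - x t)\<^sup>2) \<partial>M)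
      \<le> ennreal (\<kappa> * (2 * K * (1 + 2 * B\<^sup>2) * T * exp (4 * \<kappa> * K * T)))" .
  qed
qed

end

section \<open>Uniform bounds for the derivatives of the multiplier\<close>

lemma Theta_class_DERIV:
  assumes "\<theta> \<in> Theta_class m L L1" "j < m"
  shows "((deriv ^^ j) \<theta> has_real_derivative (deriv ^^ Suc j) \<theta> x) (at x)"
proof -
  have "(deriv ^^ j) \<theta> differentiable (at x)" using assms by (simp add: Theta_class_def)
  then show ?thesis using DERIV_deriv_iff_real_differentiable[of "(deriv ^^ j) \<theta>" x] by simp
qed

text \<open>Between two points at distance at least \<open>1\<close> where the derivative of order \<open>j\<close> is small, the mean value
  theorem yields a point where the derivative of order \<open>j + 1\<close> is small. The interval doubles in
  length at every step.\<close>
lemma derivative_small_somewhere: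
  assumes \<theta>: "\<theta> \<in> Theta_class m L L1"
  shows "j \<le> m \<Longrightarrow> \<exists>\<xi>\<in>{x..x + 2 ^ j - 1}. \<bar>(deriv ^^ j) \<theta> \<xi>\<bar> \<le> 2 ^ j * L"
proof (induction j arbitrary: x)
  case 0
  then show ?case using \<theta> by (auto simp: Theta_class_def)
next
  case (Suc j)
  obtain u where u: "x \<le> u" "u \<le> x + 2 ^ j - 1" "\<bar>(deriv ^^ j) \<theta> u\<bar> \<le> 2 ^ j * L"
    using Suc.IH[of x] Suc.prems by auto
  obtain v where v: "x + 2 ^ j \<le> v" "v \<le> x + 2 ^ j + 2 ^ j - 1" "\<bar>(deriv ^^ j) \<theta> v\<bar> \<le> 2 ^ j * L"
    using Suc.IH[of "x + 2 ^ j"] Suc.prems by auto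
  have uv: "1 \<le> v - u" using u v by simp
  obtain z where z: "u < z" "z < v"
    "(deriv ^^ j) \<theta> v - (deriv ^^ j) \<theta> u = (v - u) * (deriv ^^ Suc j) \<theta> z"
    using MVT2[of u v "(deriv ^^ j) \<theta>" "(deriv ^^ Suc j) \<theta>"] Theta_class_DERIV[OF \<theta>, of j] Suc.prems uv
    by auto
  have "\<bar>(deriv ^^ Suc j) \<theta> z\<bar> \<le> (v - u) * \<bar>(deriv ^^ Suc j) \<theta> z\<bar>"
    using mult_right_mono[OF uv, of "\<bar>(deriv ^^ Suc j) \<theta> z\<bar>"] by simp
  also have "\<dots> = \<bar>(deriv ^^ j) \<theta> v - (deriv ^^ j) \<theta> u\<bar>"
    unfolding z(3) using uv by (simp add: abs_mult)
  also have "\<dots> \<le> 2 ^ Suc j * L" using u(3) v(3) by simp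
  finally have "\<bar>(deriv ^^ Suc j) \<theta> z\<bar> \<le> 2 ^ Suc j * L" .
  moreover have "z \<in> {x..x + 2 ^ Suc j - 1}" using z u v by simp
  ultimately show ?case by blast
qed

text \<open>Downward induction on the order. The top derivative is Lipschitz and small somewhere near every point.
  Each lower derivative is small somewhere near every point and has a bounded derivative.\<close>
lemma derivatives_uniformly_bounded:
  "\<exists>K. \<forall>\<theta>\<in>Theta_class m L L1. \<forall>j\<le>m. \<forall>x. \<bar>(deriv ^^ j) \<theta> x\<bar> \<le> K"
proof -
  have top: "\<exists>K. \<forall>\<theta>\<in>Theta_class m L L1. \<forall>x. \<bar>(deriv ^^ (m - d)) \<theta> x\<bar> \<le> K" if "d \<le> m" for d
    using that
  proof (induction d)
    case 0
    have "\<bar>(deriv ^^ m) \<theta> x\<bar> \<le> 2 ^ m * L + \<bar>L1\<bar> * 2 ^ m" if \<theta>: "\<theta> \<in> Theta_class m L L1" for \<theta> x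
    proof -
      obtain u where u: "x \<le> u" "u \<le> x + 2 ^ m - 1" "\<bar>(deriv ^^ m) \<theta> u\<bar> \<le> 2 ^ m * L"
        using derivative_small_somewhere[OF \<theta>, of m x] by auto
      have "\<bar>(deriv ^^ m) \<theta> x - (deriv ^^ m) \<theta> u\<bar> \<le> L1 * \<bar>x - u\<bar>"
        using \<theta> by (simp add: Theta_class_def)
      also have "\<dots> \<le> \<bar>L1\<bar> * 2 ^ m" using u by (intro mult_mono) auto
      finally show ?thesis using u(3) by simp
    qed
    then show ?case by (intro exI[of _ "2 ^ m * L + \<bar>L1\<bar> * 2 ^ m"]) simp
  next
    case (Suc d)
    obtain K where K: "\<And>\<theta> x. \<theta> \<in> Theta_class m L L1 \<Longrightarrow> \<bar>(deriv ^^ (m - d)) \<theta> x\<bar> \<le> K"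
      using Suc by auto
    define j where "j = m - Suc d"
    have j: "m - d = Suc j" "j < m" using Suc.prems by (auto simp: j_def)
    have "\<bar>(deriv ^^ j) \<theta> x\<bar> \<le> 2 ^ j * L + 2 ^ j * \<bar>K\<bar>" if \<theta>: "\<theta> \<in> Theta_class m L L1" for \<theta> x
    proof -
      obtain u where u: "x \<le> u" "u \<le> x + 2 ^ j - 1" "\<bar>(deriv ^^ j) \<theta> u\<bar> \<le> 2 ^ j * L"
        using derivative_small_somewhere[OF \<theta>, of j x] j by auto
      have "\<bar>(deriv ^^ j) \<theta> x - (deriv ^^ j) \<theta> u\<bar> \<le> 2 ^ j * \<bar>K\<bar>"
      proof (cases "x = u")
        case False
        then have xu: "x < u" using u by simp
        obtain z where z: "(deriv ^^ j) \<theta> u - (deriv ^^ j) \<theta> x = (u - x) * (deriv ^^ Suc j) \<theta> z"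
          using MVT2[of x u "(deriv ^^ j) \<theta>" "(deriv ^^ Suc j) \<theta>"] Theta_class_DERIV[OF \<theta> j(2)] xu by auto
        have "\<bar>(deriv ^^ Suc j) \<theta> z\<bar> \<le> \<bar>K\<bar>" using K[OF \<theta>, of z] unfolding j(1) by linarith
        then have "\<bar>u - x\<bar> * \<bar>(deriv ^^ Suc j) \<theta> z\<bar> \<le> 2 ^ j * \<bar>K\<bar>"
          using u by (intro mult_mono) auto
        then show ?thesis using z by (metis abs_minus_commute abs_mult)
      qed simp
      then show ?thesis using u(3) by linarith
    qed
    then show ?case unfolding j_def[symmetric] by (intro exI[of _ "2 ^ j * L + 2 ^ j * \<bar>K\<bar>"]) simp
  qed
  have "\<forall>j\<in>{..m}. \<exists>K. \<forall>\<theta>\<in>Theta_class m L L1. \<forall>x. \<bar>(deriv ^^ j) \<theta> x\<bar> \<le> K"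
  proof
    fix j assume "j \<in> {..m}"
    then show "\<exists>K. \<forall>\<theta>\<in>Theta_class m L L1. \<forall>x. \<bar>(deriv ^^ j) \<theta> x\<bar> \<le> K"
      using top[of "m - j"] by simp
  qed
  then obtain k where k: "\<forall>j\<in>{..m}. \<forall>\<theta>\<in>Theta_class m L L1. \<forall>x. \<bar>(deriv ^^ j) \<theta> x\<bar> \<le> k j"
    using bchoice by metis
  have "k j \<le> (\<Sum>i\<le>m. \<bar>k i\<bar>)" if "j \<le> m" for j
    using member_le_sum[of j "{..m}" "\<lambda>i. \<bar>k i\<bar>"] that by simp
  then show ?thesis using k by (intro exI[of _ "\<Sum>i\<le>m. \<bar>k i\<bar>"] ballI allI impI) (meson atMost_iff order_trans)
qed

text \<open>One derivative is split off at a time, so that closure under products and the bootstrap through the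
  differential equation become plain inductions on the order.\<close>
primrec smooth_bounded :: "real set \<Rightarrow> real \<Rightarrow> nat \<Rightarrow> (real \<Rightarrow> real) \<Rightarrow> bool" where
  "smooth_bounded S K 0 f \<longleftrightarrow> (\<forall>t\<in>S. \<bar>f t\<bar> \<le> K)"
| "smooth_bounded S K (Suc n) f \<longleftrightarrow> (\<forall>t\<in>S. \<bar>f t\<bar> \<le> K) \<and>
     (\<exists>f'. (\<forall>t\<in>S. (f has_real_derivative f' t) (at t)) \<and> smooth_bounded S K n f')"

lemma smooth_bounded_mono_const: "smooth_bounded S K n f \<Longrightarrow> K \<le> K' \<Longrightarrow> smooth_bounded S K' n f"
proof (induction n arbitrary: f)
  case (Suc n)
  from Suc.prems(1) obtain f' where f': "\<forall>t\<in>S. (f has_real_derivative f' t) (at t)" "smooth_bounded S K n f'"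
    by auto
  have "\<forall>t\<in>S. \<bar>f t\<bar> \<le> K'" using Suc.prems by force
  then show ?case using f'(1) Suc.IH[OF f'(2) Suc.prems(2)] by auto
qed force

lemma smooth_bounded_bound: "smooth_bounded S K n f \<Longrightarrow> t \<in> S \<Longrightarrow> \<bar>f t\<bar> \<le> K"
  by (cases n) auto

lemma smooth_bounded_Suc_less: "smooth_bounded S K (Suc n) f \<Longrightarrow> smooth_bounded S K n f"
proof (induction n arbitrary: f)
  case (Suc n)
  obtain f' where f': "\<forall>t\<in>S. (f has_real_derivative f' t) (at t)" "smooth_bounded S K (Suc n) f'"
    using Suc.prems by auto
  then show ?case using Suc.IH[OF f'(2)] smooth_bounded_bound[OF Suc.prems] by auto
qed auto

lemma smooth_bounded_le: "n \<le> m \<Longrightarrow> smooth_bounded S K m f \<Longrightarrow> smooth_bounded S K n f"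
  by (induction m rule: dec_induct) (use smooth_bounded_Suc_less in blast)+

lemma smooth_bounded_add:
  "smooth_bounded S K n f \<Longrightarrow> smooth_bounded S M n g \<Longrightarrow> smooth_bounded S (K + M) n (\<lambda>t. f t + g t)"
proof (induction n arbitrary: f g)
  case 0
  then show ?case by (fastforce intro: abs_triangle_ineq[THEN order_trans] add_mono)
next
  case (Suc n)
  obtain f' where f': "\<forall>t\<in>S. (f has_real_derivative f' t) (at t)" "smooth_bounded S K n f'"
    using Suc.prems(1) by auto
  obtain g' where g': "\<forall>t\<in>S. (g has_real_derivative g' t) (at t)" "smooth_bounded S M n g'"
    using Suc.prems(2) by auto
  have "\<bar>f t + g t\<bar> \<le> K + M" if "t \<in> S" for t
    using smooth_bounded_bound[OF Suc.prems(1) that] smooth_bounded_bound[OF Suc.prems(2) that] by linarith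
  moreover have "\<forall>t\<in>S. ((\<lambda>t. f t + g t) has_real_derivative f' t + g' t) (at t)"
    using f'(1) g'(1) by (auto intro: DERIV_add)
  ultimately show ?case using Suc.IH[OF f'(2) g'(2)] by (auto intro!: exI[of _ "\<lambda>t. f' t + g' t"])
qed

text \<open>The product rule costs a factor \<open>2\<close> for each derivative.\<close>
lemma smooth_bounded_mult:
  assumes "0 \<le> K" "0 \<le> M"
  shows "smooth_bounded S K n f \<Longrightarrow> smooth_bounded S M n g \<Longrightarrow> smooth_bounded S (2 ^ n * (K * M)) n (\<lambda>t. f t * g t)"
proof (induction n arbitrary: f g)
  case 0
  then show ?case using assms by (auto simp: abs_mult intro!: mult_mono)
next
  case (Suc n)
  obtain f' where f': "\<forall>t\<in>S. (f has_real_derivative f' t) (at t)" "smooth_bounded S K n f'"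
    using Suc.prems(1) by auto
  obtain g' where g': "\<forall>t\<in>S. (g has_real_derivative g' t) (at t)" "smooth_bounded S M n g'"
    using Suc.prems(2) by auto
  have "\<bar>f t * g t\<bar> \<le> 2 ^ Suc n * (K * M)" if "t \<in> S" for t
  proof -
    have "\<bar>f t * g t\<bar> \<le> 1 * (K * M)"
      using smooth_bounded_bound[OF Suc.prems(1) that] smooth_bounded_bound[OF Suc.prems(2) that] assms
      by (auto simp: abs_mult intro!: mult_mono)
    also have "\<dots> \<le> 2 ^ Suc n * (K * M)" using assms by (intro mult_right_mono one_le_power) auto
    finally show ?thesis .
  qed
  moreover have "\<forall>t\<in>S. ((\<lambda>t. f t * g t) has_real_derivative f' t * g t + f t * g' t) (at t)"
    using f'(1) g'(1) by (auto intro!: derivative_eq_intros)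
  moreover have "smooth_bounded S (2 ^ Suc n * (K * M)) n (\<lambda>t. f' t * g t + f t * g' t)"
    using smooth_bounded_add[OF Suc.IH[OF f'(2) smooth_bounded_Suc_less[OF Suc.prems(2)]]
        Suc.IH[OF smooth_bounded_Suc_less[OF Suc.prems(1)] g'(2)]] by (simp add: mult_ac)
  ultimately show ?case by (auto intro!: exI[of _ "\<lambda>t. f' t * g t + f t * g' t"])
qed

lemma smooth_bounded_derivatives:
  "smooth_bounded S K n f \<Longrightarrow> \<exists>D. D 0 = f \<and> (\<forall>j<n. \<forall>t\<in>S. (D j has_real_derivative D (Suc j) t) (at t))
     \<and> (\<forall>j\<le>n. \<forall>t\<in>S. \<bar>D j t\<bar> \<le> K)"
proof (induction n arbitrary: f)
  case 0
  then show ?case by (intro exI[of _ "\<lambda>_. f"]) auto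
next
  case (Suc n)
  obtain f' where f': "\<forall>t\<in>S. (f has_real_derivative f' t) (at t)" "smooth_bounded S K n f'"
    using Suc.prems by auto
  from Suc.IH[OF f'(2)] obtain D where D: "D 0 = f'"
    "\<forall>j<n. \<forall>t\<in>S. (D j has_real_derivative D (Suc j) t) (at t)" "\<forall>j\<le>n. \<forall>t\<in>S. \<bar>D j t\<bar> \<le> K" by blast
  define E where "E j = (case j of 0 \<Rightarrow> f | Suc i \<Rightarrow> D i)" for j
  have "(E j has_real_derivative E (Suc j) t) (at t)" if "j < Suc n" "t \<in> S" for j t
    using that D f'(1) by (cases j) (auto simp: E_def)
  moreover have "\<bar>E j t\<bar> \<le> K" if "j \<le> Suc n" "t \<in> S" for j t
    using that D smooth_bounded_bound[OF Suc.prems] by (cases j) (auto simp: E_def)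
  moreover have "E 0 = f" by (simp add: E_def)
  ultimately show ?case by (intro exI[of _ E]) blast
qed

text \<open>The coefficients of the Taylor polynomial are left unspecified except for the constant one, since the
  kernel annihilates the others.\<close>
lemma smooth_bounded_taylor:
  assumes f: "smooth_bounded {c<..<d} K (Suc n) f" and t: "t \<in> {c<..<d}"
  shows "\<exists>p. p 0 = f t \<and> (\<forall>s\<in>{c<..<d}. \<bar>f s - (\<Sum>j\<le>n. p j * (s - t) ^ j)\<bar> \<le> K * \<bar>s - t\<bar> ^ Suc n)"
proof -
  from smooth_bounded_derivatives[OF f] obtain D where D: "D 0 = f"
    "\<forall>j<Suc n. \<forall>t\<in>{c<..<d}. (D j has_real_derivative D (Suc j) t) (at t)"
    "\<forall>j\<le>Suc n. \<forall>t\<in>{c<..<d}. \<bar>D j t\<bar> \<le> K" by blast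
  have K: "0 \<le> K" using smooth_bounded_bound[OF f t] by linarith
  show ?thesis
  proof (intro exI[of _ "\<lambda>j. D j t / fact j"] conjI ballI)
    show "D 0 t / fact 0 = f t" using D(1) by simp
    fix s assume s: "s \<in> {c<..<d}"
    show "\<bar>f s - (\<Sum>j\<le>n. D j t / fact j * (s - t) ^ j)\<bar> \<le> K * \<bar>s - t\<bar> ^ Suc n"
    proof (cases "s = t")
      case True
      have "(\<Sum>j\<le>n. D j t / fact j * 0 ^ j) = (\<Sum>j\<in>{0}. D j t / fact j * 0 ^ j)"
        by (rule sum.mono_neutral_right) auto
      then show ?thesis using True D(1) K by simp
    next
      case False
      have "\<exists>z. (if s < t then s < z \<and> z < t else t < z \<and> z < s) \<and>
          f s = (\<Sum>m<Suc n. (D m t / fact m) * (s - t)^m) + (D (Suc n) z / fact (Suc n)) * (s - t)^(Suc n)"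
      proof (rule Taylor[of "Suc n" D f "min s t" "max s t"])
        show "\<forall>m z. m < Suc n \<and> min s t \<le> z \<and> z \<le> max s t \<longrightarrow> (D m has_real_derivative D (Suc m) z) (at z)"
          using D(2) s t by (auto simp: min_def max_def split: if_splits)
      qed (use False D(1) in auto)
      then obtain z where z: "if s < t then s < z \<and> z < t else t < z \<and> z < s"
        "f s = (\<Sum>m<Suc n. (D m t / fact m) * (s - t)^m) + (D (Suc n) z / fact (Suc n)) * (s - t)^(Suc n)" by blast
      have "z \<in> {c<..<d}" using z(1) s t by (auto split: if_splits)
      then have Dz: "\<bar>D (Suc n) z\<bar> \<le> K" using D(3) by blast
      have "\<bar>D (Suc n) z / fact (Suc n)\<bar> \<le> K / 1"
        unfolding abs_divide using Dz K fact_ge_1[of "Suc n", where 'a = real] by (intro frac_le) auto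
      then have "\<bar>D (Suc n) z / fact (Suc n) * (s - t)^(Suc n)\<bar> \<le> K * \<bar>s - t\<bar> ^ Suc n"
        unfolding abs_mult power_abs[symmetric] by (intro mult_right_mono) auto
      then show ?thesis using z(2) by (simp only: lessThan_Suc_atMost add_diff_cancel_left')
    qed
  qed
qed

section \<open>The deterministic limit and the bias of the kernel\<close>

lemma Theta_class_continuous:
  assumes "\<theta> \<in> Theta_class (Suc m) L L1"
  shows "continuous_on S \<theta>"
proof -
  have "(\<theta> has_real_derivative deriv \<theta> x) (at x)" for x
    using Theta_class_DERIV[OF assms, of 0 x] by simp
  then have "isCont \<theta> x" for x by (rule DERIV_isCont)
  then show ?thesis by (simp add: continuous_at_imp_continuous_on)
qed

lemma Theta_class_bound: "\<theta> \<in> Theta_class m L L1 \<Longrightarrow> \<bar>\<theta> x\<bar> \<le> L"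
  by (simp add: Theta_class_def)

lemma LBINT_Icc_continuous:
  fixes f :: "real \<Rightarrow> real"
  assumes "continuous_on {0..t} f"
  shows "(LBINT s:{0..t}. f s) = integral {0..t} f"
  by (rule set_borel_integral_eq_integral(2)[OF borel_integrable_atLeastAtMost'[OF assms]])

context
  fixes \<theta> :: "real \<Rightarrow> real" and x0 L :: real
  assumes cont: "\<And>S. continuous_on S \<theta>" and bound: "\<And>s. \<bar>\<theta> s\<bar> \<le> L"
begin

lemma ode_solution_derivative_within:
  assumes "t \<in> {0..T}"
  shows "(ode_solution x0 \<theta> has_real_derivative \<theta> t * ode_solution x0 \<theta> t) (at t within {0..T})"
proof -
  have "((\<lambda>t. integral {0..t} \<theta>) has_real_derivative \<theta> t) (at t within {0..T})"
    using integral_has_vector_derivative[OF cont assms]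
    by (simp add: has_real_derivative_iff_has_vector_derivative)
  then have "((\<lambda>t. x0 * exp (integral {0..t} \<theta>)) has_real_derivative \<theta> t * (x0 * exp (integral {0..t} \<theta>))) (at t within {0..T})"
    by (auto intro!: derivative_eq_intros)
  then show ?thesis by (simp add: ode_solution_def[abs_def] LBINT_Icc_continuous[OF cont])
qed

lemma ode_solution_derivative:
  assumes "0 < t"
  shows "(ode_solution x0 \<theta> has_real_derivative \<theta> t * ode_solution x0 \<theta> t) (at t)"
proof -
  have "t \<in> interior {0..t + 1}" using assms by (simp add: interior_atLeastAtMost_real)
  then show ?thesis
    using ode_solution_derivative_within[of t "t + 1"] assms at_within_interior[of t "{0..t + 1}"] by simp
qed

lemma ode_solution_continuous: "continuous_on {0..T} (ode_solution x0 \<theta>)"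
  by (rule DERIV_continuous_on[OF ode_solution_derivative_within])

lemma ode_solution_integral_equation:
  assumes "0 \<le> t"
  shows "ode_solution x0 \<theta> t = x0 + (LBINT s:{0..t}. \<theta> s * ode_solution x0 \<theta> s)"
proof -
  have "((\<lambda>s. \<theta> s * ode_solution x0 \<theta> s) has_integral ode_solution x0 \<theta> t - ode_solution x0 \<theta> 0) {0..t}"
    by (rule fundamental_theorem_of_calculus[OF assms])
       (use ode_solution_derivative_within in \<open>simp add: has_real_derivative_iff_has_vector_derivative\<close>)
  then have "integral {0..t} (\<lambda>s. \<theta> s * ode_solution x0 \<theta> s) = ode_solution x0 \<theta> t - ode_solution x0 \<theta> 0"
    by (rule integral_unique)
  moreover have "(LBINT s:{0..t}. \<theta> s * ode_solution x0 \<theta> s) = integral {0..t} (\<lambda>s. \<theta> s * ode_solution x0 \<theta> s)"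
    by (rule LBINT_Icc_continuous) (intro continuous_intros cont ode_solution_continuous)
  moreover have "ode_solution x0 \<theta> 0 = x0"
    using LBINT_Icc_continuous[OF cont, of 0] by (simp add: ode_solution_def)
  ultimately show ?thesis by simp
qed

lemma ode_solution_bound:
  assumes "t \<in> {0..T}"
  shows "\<bar>ode_solution x0 \<theta> t\<bar> \<le> \<bar>x0\<bar> * exp (L * T)"
proof -
  have L: "0 \<le> L" using bound[of 0] by linarith
  have "norm (integral {0..t} \<theta>) \<le> L * (t - 0)"
    by (rule integral_bound) (use assms bound cont in auto)
  also have "\<dots> \<le> L * T" using assms L by (intro mult_left_mono) auto
  finally have "exp (integral {0..t} \<theta>) \<le> exp (L * T)" by simp
  then show ?thesis
    by (simp add: ode_solution_def LBINT_Icc_continuous[OF cont] abs_mult mult_left_mono)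
qed

end

lemma Theta_class_smooth_bounded:
  assumes \<theta>: "\<theta> \<in> Theta_class m L L1" and K: "\<And>j x. j \<le> m \<Longrightarrow> \<bar>(deriv ^^ j) \<theta> x\<bar> \<le> K"
  shows "d \<le> m \<Longrightarrow> smooth_bounded S K d ((deriv ^^ (m - d)) \<theta>)"
proof (induction d)
  case 0
  then show ?case using K by simp
next
  case (Suc d)
  have "m - d = Suc (m - Suc d)" "m - Suc d < m" using Suc.prems by auto
  then show ?case
    using Suc K[of "m - Suc d"] Theta_class_DERIV[OF \<theta>, of "m - Suc d"]
    by (auto intro!: exI[of _ "(deriv ^^ (m - d)) \<theta>"])
qed

text \<open>Bootstrap: if \<open>x\<close> has \<open>n\<close> bounded derivatives, then so has \<open>x' = \<theta> x\<close>, so that \<open>x\<close> has \<open>n + 1\<close> of them.\<close>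
lemma drift_smooth_bounded:
  assumes T: "0 < T"
  shows "\<exists>K\<ge>0. \<forall>\<theta>\<in>Theta_class (Suc k) L L1.
    smooth_bounded {0<..<T} K (Suc k) (\<lambda>t. \<theta> t * ode_solution x0 \<theta> t)"
proof -
  let ?\<Theta> = "Theta_class (Suc k) L L1" and ?S = "{0<..<T}"
  obtain K0 where K0: "\<And>\<theta> j x. \<theta> \<in> ?\<Theta> \<Longrightarrow> j \<le> Suc k \<Longrightarrow> \<bar>(deriv ^^ j) \<theta> x\<bar> \<le> K0"
    using derivatives_uniformly_bounded[of "Suc k" L L1] by blast
  have \<theta>: "smooth_bounded ?S \<bar>K0\<bar> n \<theta>" if "\<theta> \<in> ?\<Theta>" "n \<le> Suc k" for \<theta> n
  proof (rule smooth_bounded_le[OF that(2)], rule smooth_bounded_mono_const[where K = K0])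
    have "smooth_bounded ?S K0 (Suc k) ((deriv ^^ (Suc k - Suc k)) \<theta>)"
      by (rule Theta_class_smooth_bounded[OF that(1) K0[OF that(1)] order_refl])
    then show "smooth_bounded ?S K0 (Suc k) \<theta>" by (simp only: diff_self_eq_0 funpow_0)
  qed simp
  have x: "\<exists>M\<ge>0. \<forall>\<theta>\<in>?\<Theta>. smooth_bounded ?S M n (ode_solution x0 \<theta>)" if "n \<le> Suc k" for n
    using that
  proof (induction n)
    case 0
    have "\<bar>ode_solution x0 \<theta> t\<bar> \<le> \<bar>x0\<bar> * exp (L * T)" if "\<theta> \<in> ?\<Theta>" "t \<in> ?S" for \<theta> t
      by (rule ode_solution_bound[OF Theta_class_continuous[OF that(1)] Theta_class_bound[OF that(1)]])
         (use that in auto)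
    then show ?case by (intro exI[of _ "\<bar>x0\<bar> * exp (L * T)"]) auto
  next
    case (Suc n)
    then obtain M where M: "0 \<le> M" "\<And>\<theta>. \<theta> \<in> ?\<Theta> \<Longrightarrow> smooth_bounded ?S M n (ode_solution x0 \<theta>)" by auto
    define M' where "M' = max M (2 ^ n * (\<bar>K0\<bar> * M))"
    have "smooth_bounded ?S M' (Suc n) (ode_solution x0 \<theta>)" if t: "\<theta> \<in> ?\<Theta>" for \<theta>
    proof -
      have "smooth_bounded ?S (2 ^ n * (\<bar>K0\<bar> * M)) n (\<lambda>t. \<theta> t * ode_solution x0 \<theta> t)"
        by (rule smooth_bounded_mult[OF _ M(1) \<theta>[OF t] M(2)[OF t]]) (use Suc.prems in auto)
      then have "smooth_bounded ?S M' n (\<lambda>t. \<theta> t * ode_solution x0 \<theta> t)"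
        by (rule smooth_bounded_mono_const) (simp add: M'_def)
      moreover have "\<forall>s\<in>?S. (ode_solution x0 \<theta> has_real_derivative \<theta> s * ode_solution x0 \<theta> s) (at s)"
        using ode_solution_derivative[OF Theta_class_continuous[OF t] Theta_class_bound[OF t]] by simp
      moreover have "\<forall>s\<in>?S. \<bar>ode_solution x0 \<theta> s\<bar> \<le> M'"
        using smooth_bounded_bound[OF M(2)[OF t]] by (fastforce simp: M'_def)
      ultimately show ?thesis by (auto intro!: exI[of _ "\<lambda>t. \<theta> t * ode_solution x0 \<theta> t"])
    qed
    moreover have "0 \<le> M'" using M(1) by (simp add: M'_def)
    ultimately show ?case by blast
  qed
  obtain M where M: "0 \<le> M" "\<And>\<theta>. \<theta> \<in> ?\<Theta> \<Longrightarrow> smooth_bounded ?S M (Suc k) (ode_solution x0 \<theta>)"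
    using x[of "Suc k"] by auto
  have "smooth_bounded ?S (2 ^ Suc k * (\<bar>K0\<bar> * M)) (Suc k) (\<lambda>t. \<theta> t * ode_solution x0 \<theta> t)" if "\<theta> \<in> ?\<Theta>" for \<theta>
    by (rule smooth_bounded_mult[OF _ M(1) \<theta>[OF that order_refl] M(2)[OF that]]) simp
  then show ?thesis using M(1) by (intro exI[of _ "2 ^ Suc k * (\<bar>K0\<bar> * M)"]) auto
qed

text \<open>The Bochner integral of a function that is not integrable is \<open>0\<close>, so an integral equal to \<open>1\<close> forces
  integrability.\<close>
lemma cond_A2_measurable:
  assumes "cond_A2 A B G"
  shows "G \<in> borel_measurable borel"
proof -
  have int: "(LBINT u:{A..B}. G u) = 1" and out: "\<And>u. u \<notin> {A..B} \<Longrightarrow> G u = 0"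
    using assms by (auto simp: cond_A2_def)
  have "integrable lborel (\<lambda>u. indicator {A..B} u *\<^sub>R G u)"
    using int not_integrable_integral_eq[of lborel "\<lambda>u. indicator {A..B} u *\<^sub>R G u"]
    by (auto simp: set_lebesgue_integral_def)
  moreover have "(\<lambda>u. indicator {A..B} u *\<^sub>R G u) = G" using out by (auto simp: fun_eq_iff indicator_def)
  ultimately show ?thesis using borel_measurable_integrable by force
qed

text \<open>After the substitution \<open>s = t + h u\<close> the moment conditions allow the Taylor polynomial of \<open>f\<close> at \<open>t\<close> to be
  subtracted, apart from its constant term, without changing the integral. The remainder is of order
  \<open>h ^ Suc k\<close> on the support of \<open>G\<close>, which \<open>t + h u\<close> maps into the open interval where \<open>f\<close> is smooth.\<close>
lemma kernel_bias:
  fixes f G :: "real \<Rightarrow> real"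
  assumes A2: "cond_A2 A B G" and A3: "cond_A3 k G" and C: "\<And>u. \<bar>G u\<bar> \<le> C"
    and f: "smooth_bounded {0<..<T} K (Suc k) f" and fm: "(\<lambda>s. indicator {0<..<T} s * f s) \<in> borel_measurable borel"
    and t: "t \<in> {0<..<T}" and h: "0 < h" and lo: "0 < t + h * A" and hi: "t + h * B < T"
  shows "\<bar>1 / h * (LBINT s:{0..T}. G ((s - t) / h) * f s) - f t\<bar>
    \<le> C * K * (max \<bar>A\<bar> \<bar>B\<bar>) ^ Suc k * (B - A) * h ^ Suc k"
proof -
  have AB: "A < 0" "0 < B" and out: "\<And>u. u \<notin> {A..B} \<Longrightarrow> G u = 0" and int1: "(LBINT u:{A..B}. G u) = 1"
    using A2 by (auto simp: cond_A2_def)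
  note Gm[measurable] = cond_A2_measurable[OF A2]
  define R where "R = max \<bar>A\<bar> \<bar>B\<bar>"
  have R: "\<bar>u\<bar> \<le> R" if "u \<in> {A..B}" for u using that by (auto simp: R_def)
  have C0: "0 \<le> C" using C[of 0] by linarith
  have K0: "0 \<le> K" using smooth_bounded_bound[OF f t] by linarith
  obtain p where p: "p 0 = f t" "\<And>s. s \<in> {0<..<T} \<Longrightarrow> \<bar>f s - (\<Sum>j\<le>k. p j * (s - t) ^ j)\<bar> \<le> K * \<bar>s - t\<bar> ^ Suc k"
    using smooth_bounded_taylor[OF f t] by blast
  \<comment> \<open>cut off outside the interval so that the substitution runs over the whole line\<close>
  define F where "F s = indicator {0<..<T} s * f s" for s
  have Fm[measurable]: "F \<in> borel_measurable borel" using fm by (simp add: F_def[abs_def])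
  have win: "t + h * u \<in> {0<..<T}" if "u \<in> {A..B}" for u
  proof -
    have "h * A \<le> h * u" "h * u \<le> h * B" using that h by (auto intro: mult_left_mono)
    then show ?thesis using lo hi by simp
  qed
  have bounded_int: "integrable lborel g" if [measurable]: "g \<in> borel_measurable borel"
    and "\<And>u. u \<notin> {A..B} \<Longrightarrow> g u = 0" and "\<And>u. u \<in> {A..B} \<Longrightarrow> \<bar>g u\<bar> \<le> D" for g :: "real \<Rightarrow> real" and D
  proof (rule Bochner_Integration.integrable_bound)
    show "integrable lborel (\<lambda>u. indicator {A..B} u *\<^sub>R D)" using AB by (intro integrable_scaleR_left) simp
    show "AE u in lborel. norm (g u) \<le> norm (indicator {A..B} u *\<^sub>R D)"
    proof (rule AE_I2)
      fix u
      show "norm (g u) \<le> norm (indicator {A..B} u *\<^sub>R D)"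
        by (cases "u \<in> {A..B}") (use that(2)[of u] that(3)[of u] in auto)
    qed
  qed simp
  have mono_int: "integrable lborel (\<lambda>u. u ^ j * G u)" for j
  proof (rule bounded_int)
    show "\<bar>u ^ j * G u\<bar> \<le> R ^ j * C" if "u \<in> {A..B}" for u
      unfolding abs_mult power_abs using R[OF that] C by (intro mult_mono power_mono) auto
  qed (use out in auto)
  have F_int: "integrable lborel (\<lambda>u. G u * F (t + h * u))"
  proof (rule bounded_int)
    show "\<bar>G u * F (t + h * u)\<bar> \<le> C * K" if "u \<in> {A..B}" for u
      unfolding abs_mult F_def using C[of u] smooth_bounded_bound[OF f win[OF that]] win[OF that] C0
      by (intro mult_mono) auto
  qed (use out in auto)
  have moment: "(\<integral>u. u ^ j * G u \<partial>lborel) = (if j = 0 then 1 else 0)" if "j \<le> k" for j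
  proof (cases "j = 0")
    case True
    have "(\<integral>u. G u \<partial>lborel) = (LBINT u:{A..B}. G u)"
      unfolding set_lebesgue_integral_def by (intro Bochner_Integration.integral_cong) (use out in \<open>auto simp: indicator_def\<close>)
    then show ?thesis using True int1 by simp
  next
    case False
    then show ?thesis using A3 that by (auto simp: cond_A3_def)
  qed
  define P where "P u = (\<Sum>j\<le>k. p j * h ^ j * (u ^ j * G u))" for u
  have P_int: "integrable lborel P" unfolding P_def by (intro Bochner_Integration.integrable_sum integrable_mult_right mono_int)
  have "(\<integral>u. P u \<partial>lborel) = (\<Sum>j\<le>k. p j * h ^ j * (if j = 0 then 1 else 0))"
    unfolding P_def using mono_int moment by (subst Bochner_Integration.integral_sum) (auto intro!: sum.cong)
  also have "\<dots> = (\<Sum>j\<le>k. if j = 0 then f t else 0)" by (intro sum.cong) (auto simp: p(1))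
  finally have P1: "(\<integral>u. P u \<partial>lborel) = f t" by simp
  have "(LBINT s:{0..T}. G ((s - t) / h) * f s) = (\<integral>s. G ((s - t) / h) * F s \<partial>lborel)"
    unfolding set_lebesgue_integral_def
  proof (rule Bochner_Integration.integral_cong[OF refl])
    fix s
    show "indicator {0..T} s *\<^sub>R (G ((s - t) / h) * f s) = G ((s - t) / h) * F s"
    proof (cases "(s - t) / h \<in> {A..B}")
      case True
      then have "s \<in> {0<..<T}" using win[OF True] h by simp
      then show ?thesis by (simp add: F_def)
    qed (simp add: out)
  qed
  also have "\<dots> = \<bar>h\<bar> *\<^sub>R (\<integral>u. G ((t + h * u - t) / h) * F (t + h * u) \<partial>lborel)"
    using h by (intro lborel_integral_real_affine) simp
  finally have subst: "1 / h * (LBINT s:{0..T}. G ((s - t) / h) * f s) = (\<integral>u. G u * F (t + h * u) \<partial>lborel)"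
    using h by simp
  have "\<bar>1 / h * (LBINT s:{0..T}. G ((s - t) / h) * f s) - f t\<bar> = \<bar>\<integral>u. G u * F (t + h * u) - P u \<partial>lborel\<bar>"
    unfolding subst P1[symmetric] using F_int P_int by simp
  also have "\<dots> \<le> (\<integral>u. \<bar>G u * F (t + h * u) - P u\<bar> \<partial>lborel)"
    using integral_norm_bound[of lborel "\<lambda>u. G u * F (t + h * u) - P u"] by simp
  also have "\<dots> \<le> (\<integral>u. indicator {A..B} u * (C * (K * (h * R) ^ Suc k)) \<partial>lborel)"
  proof (rule integral_mono)
    show "integrable lborel (\<lambda>u. \<bar>G u * F (t + h * u) - P u\<bar>)" using F_int P_int by simp
    show "integrable lborel (\<lambda>u. indicator {A..B} u * (C * (K * (h * R) ^ Suc k)))"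
      using AB by (intro integrable_mult_left) simp
    fix u
    show "\<bar>G u * F (t + h * u) - P u\<bar> \<le> indicator {A..B} u * (C * (K * (h * R) ^ Suc k))"
    proof (cases "u \<in> {A..B}")
      case True
      have "P u = G u * (\<Sum>j\<le>k. p j * (t + h * u - t) ^ j)"
        by (simp add: P_def sum_distrib_left power_mult_distrib mult_ac)
      then have "\<bar>G u * F (t + h * u) - P u\<bar> = \<bar>G u\<bar> * \<bar>f (t + h * u) - (\<Sum>j\<le>k. p j * (t + h * u - t) ^ j)\<bar>"
        using win[OF True] by (simp add: F_def right_diff_distrib[symmetric] abs_mult)
      also have "\<dots> \<le> C * (K * \<bar>t + h * u - t\<bar> ^ Suc k)"
        using C p(2)[OF win[OF True]] C0 by (intro mult_mono) auto
      also have "\<dots> \<le> C * (K * (h * R) ^ Suc k)"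
        using R[OF True] h C0 K0 by (intro mult_left_mono power_mono) (auto simp: abs_mult)
      finally show ?thesis using True by simp
    qed (simp add: out P_def)
  qed
  also have "\<dots> = (B - A) * (C * (K * (h * R) ^ Suc k))" using AB by simp
  finally show ?thesis by (simp add: R_def power_mult_distrib mult_ac)
qed

section \<open>The error of the estimator\<close>

lemma ennreal_abs_integral_le:
  fixes f :: "'b \<Rightarrow> real"
  shows "ennreal \<bar>\<integral>x. f x \<partial>N\<bar> \<le> (\<integral>\<^sup>+x. ennreal \<bar>f x\<bar> \<partial>N)"
proof (cases "integrable N f")
  case True
  then show ?thesis using integral_norm_bound_ennreal[OF True] by simp
next
  case False
  then show ?thesis by (simp add: not_integrable_integral_eq)
qed

lemma nn_integral_square_window_le:
  fixes g :: "real \<Rightarrow> real"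
  assumes C: "\<And>s. \<bar>g s\<bar> \<le> C" and out: "\<And>s. s \<notin> {p..q} \<Longrightarrow> g s = 0" and "p \<le> q"
    and F: "\<And>s. s \<in> {p..q} \<Longrightarrow> F s \<le> ennreal D" and D: "0 \<le> D"
  shows "(\<integral>\<^sup>+s. ennreal ((g s)\<^sup>2) * F s \<partial>lborel) \<le> ennreal (C\<^sup>2 * D * (q - p))"
proof -
  have "(\<integral>\<^sup>+s. ennreal ((g s)\<^sup>2) * F s \<partial>lborel) \<le> (\<integral>\<^sup>+s. ennreal (C\<^sup>2 * D) * indicator {p..q} s \<partial>lborel)"
  proof (rule nn_integral_mono)
    fix s
    show "ennreal ((g s)\<^sup>2) * F s \<le> ennreal (C\<^sup>2 * D) * indicator {p..q} s"
    proof (cases "s \<in> {p..q}")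
      case True
      have "(g s)\<^sup>2 \<le> C\<^sup>2" using power_mono[OF C[of s], of 2] by simp
      then have "ennreal ((g s)\<^sup>2) * F s \<le> ennreal (C\<^sup>2) * ennreal D"
        by (intro mult_mono F[OF True] ennreal_leI) auto
      then show ?thesis using True D by (simp add: ennreal_mult)
    qed (simp add: out)
  qed
  also have "\<dots> = ennreal (C\<^sup>2 * D) * ennreal (q - p)" using \<open>p \<le> q\<close> by (simp add: nn_integral_cmult)
  also have "\<dots> = ennreal (C\<^sup>2 * D * (q - p))" using \<open>p \<le> q\<close> D by (simp add: ennreal_mult)
  finally show ?thesis .
qed

context filtered_brownian
begin

text \<open>The noise is the residual of \<open>J\<close>, whose second moment is at most the integral of \<open>g\<^sup>2 E v\<^sup>2\<close>. The drift
  error \<open>\<integral> g \<theta> (X - x) ds\<close> is estimated by the Cauchy-Schwarz inequality on the window \<open>{p..q}\<close>. This makes it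
  quadratic in the length of the window, whereas the noise is linear.\<close>
theorem stochastic_error_bound:
  fixes x \<theta> g :: "real \<Rightarrow> real"
  assumes T: "0 < T" and X: "has_ito_differential M F W T X (\<lambda>t \<omega>. \<theta> t * X t \<omega>) v"
    and J: "has_integral_wrt_process M F W T X g J"
    and \<theta>m[measurable]: "\<theta> \<in> borel_measurable borel" and L: "\<And>t. t \<in> {0..T} \<Longrightarrow> \<bar>\<theta> t\<bar> \<le> L"
    and xc: "continuous_on {0..T} x" and B: "\<And>t. t \<in> {0..T} \<Longrightarrow> \<bar>x t\<bar> \<le> B"
    and v: "\<And>s \<omega>. s \<in> {0..T} \<Longrightarrow> \<omega> \<in> space M \<Longrightarrow> (v s \<omega>)\<^sup>2 \<le> \<kappa> * (1 + (X s \<omega>)\<^sup>2)" and \<kappa>: "0 < \<kappa>"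
    and g[measurable]: "g \<in> borel_measurable borel" and C: "\<And>s. \<bar>g s\<bar> \<le> C"
    and out: "\<And>s. s \<notin> {p..q} \<Longrightarrow> g s = 0" and pq: "0 \<le> p" "p \<le> q" "q \<le> T"
    and D: "\<And>s. s \<in> {0..T} \<Longrightarrow> (\<integral>\<^sup>+\<omega>. ennreal ((X s \<omega> - x s)\<^sup>2) \<partial>M) \<le> ennreal D" and D0: "0 \<le> D"
  shows "(\<integral>\<^sup>+\<omega>. ennreal ((J \<omega> - (LBINT s:{0..T}. g s * (\<theta> s * x s)))\<^sup>2) \<partial>M)
    \<le> ennreal (2 * (C\<^sup>2 * (\<kappa> * (1 + 2 * B\<^sup>2 + 2 * D)) * (q - p)) + 2 * ((C * (q - p) * L)\<^sup>2 * D))"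
proof -
  have T0: "0 \<le> T" and TT: "T \<in> {0..T}" using T by auto
  have L0: "0 \<le> L" using L[OF TT] by linarith
  define D1 where "D1 = \<kappa> * (1 + 2 * B\<^sup>2 + 2 * D)"
  have D1: "0 \<le> D1" using \<kappa> D0 by (simp add: D1_def)
  obtain I where I: "has_ito_integral M F W T v I" by (rule has_ito_differentialE[OF X])
  note XD = has_ito_differentialD[OF X]
  define V where "V s \<omega> = indicator {0<..T} s * v s \<omega>" for s \<omega>
  have Vj: "jointly_measurable M V" unfolding V_def
    by (rule ito_limitD(1)[OF has_ito_integral_imp_ito_limit[OF I TT]])
  obtain X' where X': "jointly_measurable M X'" "AE \<omega> in M. \<forall>s\<in>{0..T}. X' s \<omega> = X s \<omega>"
    using continuous_jointly_measurable_version[OF XD(1,2) T0] by blast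
  have Xm: "X s \<in> borel_measurable M" if "s \<in> {0..T}" for s by (rule adapted_measurable[OF XD(1) that])
  have EV: "(\<integral>\<^sup>+\<omega>. ennreal ((V s \<omega>)\<^sup>2) \<partial>M) \<le> ennreal D1" for s
  proof (cases "s \<in> {0<..T}")
    case True
    then have s: "s \<in> {0..T}" by auto
    have "(\<integral>\<^sup>+\<omega>. ennreal ((V s \<omega>)\<^sup>2) \<partial>M)
      \<le> (\<integral>\<^sup>+\<omega>. ennreal (\<kappa> * (1 + 2 * B\<^sup>2)) + ennreal (2 * \<kappa>) * ennreal ((X s \<omega> - x s)\<^sup>2) \<partial>M)"
    proof (rule nn_integral_mono)
      fix \<omega> assume \<omega>: "\<omega> \<in> space M"
      show "ennreal ((V s \<omega>)\<^sup>2) \<le> ennreal (\<kappa> * (1 + 2 * B\<^sup>2)) + ennreal (2 * \<kappa>) * ennreal ((X s \<omega> - x s)\<^sup>2)"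
        using v[OF s \<omega>] B[OF s] \<kappa> True by (intro linear_growth_around) (auto simp: V_def)
    qed
    also have "\<dots> = ennreal (\<kappa> * (1 + 2 * B\<^sup>2)) + ennreal (2 * \<kappa>) * (\<integral>\<^sup>+\<omega>. ennreal ((X s \<omega> - x s)\<^sup>2) \<partial>M)"
      using Xm[OF s] by (simp add: nn_integral_add nn_integral_cmult emeasure_space_1)
    also have "\<dots> \<le> ennreal (\<kappa> * (1 + 2 * B\<^sup>2)) + ennreal (2 * \<kappa>) * ennreal D"
      by (intro add_left_mono mult_left_mono D[OF s]) simp
    also have "\<dots> = ennreal D1"
      unfolding D1_def using \<kappa> D0
      by (simp add: ennreal_mult[symmetric] ennreal_plus[symmetric] distrib_left mult_ac del: ennreal_plus)
    finally show ?thesis .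
  qed (simp add: V_def)
  have Vsq: "(\<lambda>y. ennreal ((V (fst y) (snd y))\<^sup>2)) \<in> borel_measurable (borel \<Otimes>\<^sub>M M)"
    using Vj unfolding jointly_measurable_def
    by (intro measurable_compose[OF _ measurable_ennreal] borel_measurable_power)
  have fin: "(\<integral>\<^sup>+\<omega>. (\<integral>\<^sup>+s. ennreal ((indicator {0<..T} s * v s \<omega>)\<^sup>2) \<partial>lborel) \<partial>M) < \<infinity>"
  proof -
    have "(\<integral>\<^sup>+\<omega>. (\<integral>\<^sup>+s. ennreal ((V s \<omega>)\<^sup>2) \<partial>lborel) \<partial>M) = (\<integral>\<^sup>+s. (\<integral>\<^sup>+\<omega>. ennreal ((V s \<omega>)\<^sup>2) \<partial>M) \<partial>lborel)"
      by (rule nn_integral_lborel_swap[OF Vsq])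
    also have "\<dots> \<le> (\<integral>\<^sup>+s. ennreal D1 * indicator {0<..T} s \<partial>lborel)"
    proof (rule nn_integral_mono)
      fix s :: real
      show "(\<integral>\<^sup>+\<omega>. ennreal ((V s \<omega>)\<^sup>2) \<partial>M) \<le> ennreal D1 * indicator {0<..T} s"
        using EV[of s] by (cases "s \<in> {0<..T}") (simp_all add: V_def)
    qed
    also have "\<dots> < \<infinity>" using T by (simp add: nn_integral_cmult ennreal_mult_less_top)
    finally show ?thesis by (simp add: V_def)
  qed
  have gsq: "(\<lambda>s. ennreal ((g s)\<^sup>2)) \<in> borel_measurable borel" by measurable
  have "(\<integral>\<^sup>+\<omega>. ennreal ((J \<omega> - (LBINT s:{0..T}. g s * (\<theta> s * X s \<omega>)))\<^sup>2) \<partial>M)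
    \<le> (\<integral>\<^sup>+\<omega>. (\<integral>\<^sup>+s. ennreal ((g s * (indicator {0<..T} s * v s \<omega>))\<^sup>2) \<partial>lborel) \<partial>M)"
    by (rule integral_wrt_process_residual[OF T X J g C fin])
  also have "\<dots> = (\<integral>\<^sup>+\<omega>. (\<integral>\<^sup>+s. ennreal ((g s)\<^sup>2) * ennreal ((V s \<omega>)\<^sup>2) \<partial>lborel) \<partial>M)"
    by (intro nn_integral_cong) (simp add: V_def[symmetric] power_mult_distrib ennreal_mult)
  also have "\<dots> = (\<integral>\<^sup>+s. (\<integral>\<^sup>+\<omega>. ennreal ((g s)\<^sup>2) * ennreal ((V s \<omega>)\<^sup>2) \<partial>M) \<partial>lborel)"
    by (rule nn_integral_lborel_swap, rule borel_measurable_times_ennreal[OF measurable_compose[OF measurable_fst gsq] Vsq])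
  also have "\<dots> = (\<integral>\<^sup>+s. ennreal ((g s)\<^sup>2) * (\<integral>\<^sup>+\<omega>. ennreal ((V s \<omega>)\<^sup>2) \<partial>M) \<partial>lborel)"
    using jointly_measurable_at[OF Vj] by (intro nn_integral_cong nn_integral_cmult) measurable
  also have "\<dots> \<le> ennreal (C\<^sup>2 * D1 * (q - p))"
    by (rule nn_integral_square_window_le[OF C out pq(2) EV D1])
  finally have noise: "(\<integral>\<^sup>+\<omega>. ennreal ((J \<omega> - (LBINT s:{0..T}. g s * (\<theta> s * X s \<omega>)))\<^sup>2) \<partial>M) \<le> ennreal (C\<^sup>2 * D1 * (q - p))" .
  define xb where "xb s = indicator {0..T} s * x s" for s
  have xbm[measurable]: "xb \<in> borel_measurable borel"
    using borel_measurable_continuous_on_indicator[OF _ xc] by (simp add: xb_def[abs_def])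
  define U where "U s \<omega> = indicator {0..T} s * (\<theta> s * (X' s \<omega> - xb s))" for s \<omega>
  have Uj: "jointly_measurable M U"
    using X'(1) unfolding jointly_measurable_def U_def
    by (intro borel_measurable_times borel_measurable_diff measurable_compose[OF measurable_fst borel_measurable_indicator]
        measurable_compose[OF measurable_fst \<theta>m] measurable_compose[OF measurable_fst xbm]) auto
  have Usq: "(\<lambda>y. ennreal ((U (fst y) (snd y))\<^sup>2)) \<in> borel_measurable (borel \<Otimes>\<^sub>M M)"
    using Uj unfolding jointly_measurable_def
    by (intro measurable_compose[OF _ measurable_ennreal] borel_measurable_power)
  define A where "A \<omega> = (\<integral>s. g s * U s \<omega> \<partial>lborel)" for \<omega>
  have Am[measurable]: "A \<in> borel_measurable M"
    unfolding A_def
  proof (rule lborel.borel_measurable_lebesgue_integral)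
    have "(\<lambda>y. U (snd y) (fst y)) \<in> borel_measurable (M \<Otimes>\<^sub>M lborel)"
      using jointly_measurable_comp[OF Uj, of snd "M \<Otimes>\<^sub>M lborel" fst] by simp
    moreover have "(\<lambda>y. g (snd y)) \<in> borel_measurable (M \<Otimes>\<^sub>M lborel)"
      using g by measurable
    ultimately show "(\<lambda>(\<omega>, s). g s * U s \<omega>) \<in> borel_measurable (M \<Otimes>\<^sub>M lborel)"
      unfolding case_prod_beta by (rule borel_measurable_times[rotated])
  qed
  have Jm[measurable]: "J \<in> borel_measurable M" using J unfolding has_integral_wrt_process_def by (rule conjunct1)
  define x1 where "x1 = (LBINT s:{0..T}. g s * (\<theta> s * x s))"
  note gint = set_integrable_bounded_times[OF g C]
  have xint: "set_integrable lborel {0..T} (\<lambda>s. \<theta> s * x s)"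
    by (rule set_integrable_bounded_times[OF \<theta>m L borel_integrable_atLeastAtMost'[OF xc]])
  have decomp: "AE \<omega> in M. J \<omega> - (LBINT s:{0..T}. g s * (\<theta> s * X s \<omega>)) = J \<omega> - x1 - A \<omega>"
    using XD(4) X'(2)
  proof eventually_elim
    case (elim \<omega>)
    have "A \<omega> = (LBINT s:{0..T}. g s * (\<theta> s * X s \<omega>) - g s * (\<theta> s * x s))"
      unfolding A_def set_lebesgue_integral_def
      by (intro Bochner_Integration.integral_cong) (use elim(2) in \<open>auto simp: U_def xb_def indicator_def algebra_simps\<close>)
    also have "\<dots> = (LBINT s:{0..T}. g s * (\<theta> s * X s \<omega>)) - x1"
      unfolding x1_def by (rule set_integral_diff(2)[OF gint[OF elim(1)] gint[OF xint]])
    finally show ?case by simp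
  qed
  have EU: "(\<integral>\<^sup>+\<omega>. ennreal ((U s \<omega>)\<^sup>2) \<partial>M) \<le> ennreal (L\<^sup>2 * D)" if s: "s \<in> {p..q}" for s
  proof -
    have sT: "s \<in> {0..T}" using s pq by auto
    have "(\<integral>\<^sup>+\<omega>. ennreal ((U s \<omega>)\<^sup>2) \<partial>M) \<le> (\<integral>\<^sup>+\<omega>. ennreal (L\<^sup>2) * ennreal ((X s \<omega> - x s)\<^sup>2) \<partial>M)"
    proof (rule nn_integral_mono_AE)
      show "AE \<omega> in M. ennreal ((U s \<omega>)\<^sup>2) \<le> ennreal (L\<^sup>2) * ennreal ((X s \<omega> - x s)\<^sup>2)"
        using X'(2)
      proof eventually_elim
        case (elim \<omega>)
        have "(\<theta> s)\<^sup>2 \<le> L\<^sup>2" using power_mono[OF L[OF sT], of 2] by simp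
        then have "(U s \<omega>)\<^sup>2 \<le> L\<^sup>2 * (X s \<omega> - x s)\<^sup>2"
          using elim sT by (auto simp: U_def xb_def power_mult_distrib intro: mult_right_mono)
        then show ?case by (simp add: ennreal_mult[symmetric] ennreal_leI)
      qed
    qed
    also have "\<dots> = ennreal (L\<^sup>2) * (\<integral>\<^sup>+\<omega>. ennreal ((X s \<omega> - x s)\<^sup>2) \<partial>M)"
      using Xm[OF sT] by (simp add: nn_integral_cmult)
    also have "\<dots> \<le> ennreal (L\<^sup>2) * ennreal D" by (intro mult_left_mono D[OF sT]) simp
    finally show ?thesis using D0 by (simp add: ennreal_mult)
  qed
  define \<Phi> where "\<Phi> \<omega> = (\<integral>\<^sup>+s. indicator {p..q} s * ennreal ((U s \<omega>)\<^sup>2) \<partial>lborel)" for \<omega>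
  have "ennreal ((A \<omega>)\<^sup>2) \<le> ennreal (C\<^sup>2 * (q - p)) * \<Phi> \<omega>" if \<omega>: "\<omega> \<in> space M" for \<omega>
  proof -
    note Um[measurable] = jointly_measurable_section[OF Uj \<omega>]
    have "ennreal ((A \<omega>)\<^sup>2) = (ennreal \<bar>A \<omega>\<bar>)\<^sup>2" by (simp add: ennreal_power)
    also have "\<dots> \<le> (\<integral>\<^sup>+s. ennreal \<bar>g s * U s \<omega>\<bar> \<partial>lborel)\<^sup>2"
      unfolding A_def by (intro power_mono ennreal_abs_integral_le) simp
    also have "(\<integral>\<^sup>+s. ennreal \<bar>g s * U s \<omega>\<bar> \<partial>lborel)
       = (\<integral>\<^sup>+s. ennreal \<bar>g s\<bar> * (indicator {p..q} s * ennreal \<bar>U s \<omega>\<bar>) \<partial>lborel)"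
    proof (intro nn_integral_cong)
      fix s
      show "ennreal \<bar>g s * U s \<omega>\<bar> = ennreal \<bar>g s\<bar> * (indicator {p..q} s * ennreal \<bar>U s \<omega>\<bar>)"
        by (cases "s \<in> {p..q}") (simp_all add: out abs_mult ennreal_mult)
    qed
    also have "(\<integral>\<^sup>+s. ennreal \<bar>g s\<bar> * (indicator {p..q} s * ennreal \<bar>U s \<omega>\<bar>) \<partial>lborel)\<^sup>2
       \<le> (\<integral>\<^sup>+s. (ennreal \<bar>g s\<bar>)\<^sup>2 \<partial>lborel) * (\<integral>\<^sup>+s. (indicator {p..q} s * ennreal \<bar>U s \<omega>\<bar>)\<^sup>2 \<partial>lborel)"
      by (rule Cauchy_Schwarz_nn_integral) measurable
    also have "(\<integral>\<^sup>+s. (indicator {p..q} s * ennreal \<bar>U s \<omega>\<bar>)\<^sup>2 \<partial>lborel) = \<Phi> \<omega>"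
      unfolding \<Phi>_def by (intro nn_integral_cong) (auto simp: indicator_def ennreal_power)
    also have "(\<integral>\<^sup>+s. (ennreal \<bar>g s\<bar>)\<^sup>2 \<partial>lborel) = (\<integral>\<^sup>+s. ennreal ((g s)\<^sup>2) * 1 \<partial>lborel)"
      by (intro nn_integral_cong) (simp add: ennreal_power)
    also have "\<dots> * \<Phi> \<omega> \<le> ennreal (C\<^sup>2 * 1 * (q - p)) * \<Phi> \<omega>"
      by (intro mult_right_mono nn_integral_square_window_le[OF C out pq(2)]) auto
    finally show ?thesis by simp
  qed
  then have "(\<integral>\<^sup>+\<omega>. ennreal ((A \<omega>)\<^sup>2) \<partial>M) \<le> (\<integral>\<^sup>+\<omega>. ennreal (C\<^sup>2 * (q - p)) * \<Phi> \<omega> \<partial>M)"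
    by (intro nn_integral_mono) auto
  also have "\<dots> = ennreal (C\<^sup>2 * (q - p)) * (\<integral>\<^sup>+\<omega>. \<Phi> \<omega> \<partial>M)"
  proof (rule nn_integral_cmult)
    have "jointly_measurable M (\<lambda>s \<omega>. indicator {p..q} s * U s \<omega>)"
      by (rule jointly_measurable_mult_indicator[OF Uj]) simp
    from jointly_measurable_square_integral[OF this]
    show "\<Phi> \<in> borel_measurable M"
      unfolding \<Phi>_def power_mult_distrib by (rule measurable_cong[THEN iffD1, rotated])
        (intro nn_integral_cong, simp add: indicator_def)
  qed
  also have "(\<integral>\<^sup>+\<omega>. \<Phi> \<omega> \<partial>M) = (\<integral>\<^sup>+s. (\<integral>\<^sup>+\<omega>. indicator {p..q} s * ennreal ((U s \<omega>)\<^sup>2) \<partial>M) \<partial>lborel)"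
    unfolding \<Phi>_def
    by (rule nn_integral_lborel_swap, rule borel_measurable_times_ennreal[OF measurable_compose[OF measurable_fst borel_measurable_indicator] Usq]) simp
  also have "\<dots> = (\<integral>\<^sup>+s. ennreal ((indicator {p..q} s)\<^sup>2) * (\<integral>\<^sup>+\<omega>. ennreal ((U s \<omega>)\<^sup>2) \<partial>M) \<partial>lborel)"
    by (intro nn_integral_cong) (simp add: indicator_def)
  also have "ennreal (C\<^sup>2 * (q - p)) * \<dots> \<le> ennreal (C\<^sup>2 * (q - p)) * ennreal (1\<^sup>2 * (L\<^sup>2 * D) * (q - p))"
    by (intro mult_left_mono nn_integral_square_window_le[OF _ _ pq(2) EU]) (use D0 in auto)
  also have "\<dots> = ennreal ((C * (q - p) * L)\<^sup>2 * D)"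
  proof -
    have "0 \<le> C\<^sup>2 * (q - p)" "0 \<le> 1\<^sup>2 * (L\<^sup>2 * D) * (q - p)" using D0 pq by auto
    then have "ennreal (C\<^sup>2 * (q - p)) * ennreal (1\<^sup>2 * (L\<^sup>2 * D) * (q - p))
        = ennreal (C\<^sup>2 * (q - p) * (1\<^sup>2 * (L\<^sup>2 * D) * (q - p)))"
      by (rule ennreal_mult[symmetric])
    then show ?thesis by (simp add: power_mult_distrib power2_eq_square mult_ac)
  qed
  finally have drift: "(\<integral>\<^sup>+\<omega>. ennreal ((A \<omega>)\<^sup>2) \<partial>M) \<le> ennreal ((C * (q - p) * L)\<^sup>2 * D)" .
  have "(\<integral>\<^sup>+\<omega>. ennreal ((J \<omega> - x1)\<^sup>2) \<partial>M)
    \<le> (\<integral>\<^sup>+\<omega>. 2 * ennreal ((J \<omega> - x1 - A \<omega>)\<^sup>2) + 2 * ennreal ((A \<omega>)\<^sup>2) \<partial>M)"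
  proof (rule nn_integral_mono)
    fix \<omega>
    have "(J \<omega> - x1)\<^sup>2 \<le> 2 * (J \<omega> - x1 - A \<omega>)\<^sup>2 + 2 * (A \<omega>)\<^sup>2"
      using square_add_le[of 1 "J \<omega> - x1 - A \<omega>" "A \<omega>"] by simp
    then have "ennreal ((J \<omega> - x1)\<^sup>2) \<le> ennreal (2 * (J \<omega> - x1 - A \<omega>)\<^sup>2 + 2 * (A \<omega>)\<^sup>2)" by (rule ennreal_leI)
    then show "ennreal ((J \<omega> - x1)\<^sup>2) \<le> 2 * ennreal ((J \<omega> - x1 - A \<omega>)\<^sup>2) + 2 * ennreal ((A \<omega>)\<^sup>2)"
      by (simp add: ennreal_mult)
  qed
  also have "\<dots> = 2 * (\<integral>\<^sup>+\<omega>. ennreal ((J \<omega> - x1 - A \<omega>)\<^sup>2) \<partial>M) + 2 * (\<integral>\<^sup>+\<omega>. ennreal ((A \<omega>)\<^sup>2) \<partial>M)"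
    by (simp add: nn_integral_add nn_integral_cmult)
  also have "(\<integral>\<^sup>+\<omega>. ennreal ((J \<omega> - x1 - A \<omega>)\<^sup>2) \<partial>M)
     = (\<integral>\<^sup>+\<omega>. ennreal ((J \<omega> - (LBINT s:{0..T}. g s * (\<theta> s * X s \<omega>)))\<^sup>2) \<partial>M)"
    by (rule nn_integral_cong_AE) (use decomp in eventually_elim, simp only:)
  also have "2 * \<dots> + 2 * (\<integral>\<^sup>+\<omega>. ennreal ((A \<omega>)\<^sup>2) \<partial>M)
      \<le> 2 * ennreal (C\<^sup>2 * D1 * (q - p)) + 2 * ennreal ((C * (q - p) * L)\<^sup>2 * D)"
    by (intro add_mono mult_left_mono noise drift) auto
  also have "\<dots> = ennreal (2 * (C\<^sup>2 * D1 * (q - p)) + 2 * ((C * (q - p) * L)\<^sup>2 * D))"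
    using D1 D0 pq by (simp add: ennreal_mult)
  finally show ?thesis by (simp add: x1_def D1_def)
qed

end

lemma power_rate:
  fixes h :: real
  assumes "0 < h"
  shows "(h ^ (k + 2)) powr (- (2 * (real k + 1) / (real k + 2))) = 1 / h ^ (2 * k + 2)"
proof -
  have "(h ^ (k + 2)) powr (- (2 * (real k + 1) / (real k + 2)))
      = h powr (real (k + 2) * (- (2 * (real k + 1) / (real k + 2))))"
    using assms by (subst powr_realpow[symmetric]) (simp_all add: powr_powr)
  also have "real (k + 2) * (- (2 * (real k + 1) / (real k + 2))) = - real (2 * k + 2)"
    by (simp add: field_simps)
  also have "h powr - real (2 * k + 2) = 1 / h ^ (2 * k + 2)"
    using assms by (simp only: powr_minus powr_realpow inverse_eq_divide)
  finally show ?thesis .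
qed

lemma root_powr_power:
  assumes "0 < \<epsilon>"
  shows "(\<epsilon> powr (1 / (real k + 2))) ^ (k + 2) = \<epsilon>"
proof -
  have "(\<epsilon> powr (1 / (real k + 2))) ^ (k + 2) = \<epsilon> powr (1 / (real k + 2) * real (k + 2))"
    using assms by (subst powr_realpow[symmetric]) (simp_all add: powr_powr)
  also have "1 / (real k + 2) * real (k + 2) = 1" by (simp add: field_simps)
  finally show ?thesis using assms by simp
qed

context filtered_brownian
begin

text \<open>The noise level is \<open>\<epsilon> = h ^ (k + 2)\<close>. Division of the stochastic error by \<open>h\<close> costs \<open>h\<^bsup>-2\<^esup>\<close>, which \<open>\<epsilon>\<^sup>2\<close>
  turns into \<open>h ^ (2 * k + 2)\<close>, the order of the squared bias. All constants depend on \<open>\<theta>\<close> only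
  through \<open>L\<close> and the smoothness bound \<open>K\<close>. The length \<open>h (B - A)\<close> of the window is bounded by
  \<open>B - A\<close>, since the noise need not be estimated better than the bias.\<close>
theorem kernel_estimator_mean_square_error:
  assumes T: "0 < T" and \<theta>: "\<theta> \<in> Theta_class (Suc k) L L1"
    and A2: "cond_A2 A B G" and A3: "cond_A3 k G" and C: "\<And>u. \<bar>G u\<bar> \<le> C"
    and X: "has_ito_differential M F W T X (\<lambda>t \<omega>. \<theta> t * X t \<omega>) v" and X0: "AE \<omega> in M. X 0 \<omega> = x0"
    and v: "\<And>s \<omega>. s \<in> {0..T} \<Longrightarrow> \<omega> \<in> space M \<Longrightarrow> (v s \<omega>)\<^sup>2 \<le> (h ^ (k + 2))\<^sup>2 * \<kappa> * (1 + (X s \<omega>)\<^sup>2)" and \<kappa>: "0 < \<kappa>"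
    and J: "has_integral_wrt_process M F W T X (\<lambda>\<tau>. G ((\<tau> - t) / h)) J"
    and K: "smooth_bounded {0<..<T} K (Suc k) (\<lambda>t. \<theta> t * ode_solution x0 \<theta> t)"
    and t: "t \<in> {0<..<T}" and h: "0 < h" "h \<le> 1" and lo: "0 < t + h * A" and hi: "t + h * B < T"
  defines "b \<equiv> \<bar>x0\<bar> * exp (L * T)" and "K1 \<equiv> 2 + 2 * L\<^sup>2 * (exp (L * T))\<^sup>2 * T * T"
  defines "D \<equiv> \<kappa> * (2 * K1 * (1 + 2 * b\<^sup>2) * T * exp (4 * \<kappa> * K1 * T))"
  shows "(\<integral>\<^sup>+\<omega>. ennreal ((1 / h * J \<omega> - \<theta> t * ode_solution x0 \<theta> t)\<^sup>2) \<partial>M)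
    \<le> ennreal (h ^ (2 * k + 2) *
      (2 * (2 * (C\<^sup>2 * (\<kappa> * (1 + 2 * b\<^sup>2 + 2 * D)) * (B - A)) + 2 * ((C * (B - A) * L)\<^sup>2 * D))
       + 2 * (C * K * (max \<bar>A\<bar> \<bar>B\<bar>) ^ Suc k * (B - A))\<^sup>2))"
proof -
  let ?x = "ode_solution x0 \<theta>"
  note cont = Theta_class_continuous[OF \<theta>] and bd = Theta_class_bound[OF \<theta>]
  have \<theta>m[measurable]: "\<theta> \<in> borel_measurable borel" by (rule borel_measurable_continuous_onI[OF cont])
  have L0: "0 \<le> L" using bd[of 0] by linarith
  have AB: "A < 0" "0 < B" and out: "\<And>u. u \<notin> {A..B} \<Longrightarrow> G u = 0" using A2 by (auto simp: cond_A2_def)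
  note Gm[measurable] = cond_A2_measurable[OF A2]
  have K10: "2 \<le> K1" using T by (simp add: K1_def)
  have D0: "0 \<le> D" unfolding D_def using \<kappa> K10 T by (intro mult_nonneg_nonneg) auto
  define \<epsilon> where "\<epsilon> = h ^ (k + 2)"
  have \<epsilon>: "0 < \<epsilon>" "\<epsilon> \<le> 1" unfolding \<epsilon>_def using h by (auto intro: power_le_one simp del: power_Suc power_add_numeral add_2_eq_Suc')
  then have \<epsilon>2: "0 < \<epsilon>\<^sup>2" "\<epsilon>\<^sup>2 \<le> 1" by (auto simp: power_le_one)
  note v = v[folded \<epsilon>_def]
  have \<kappa>': "0 < \<epsilon>\<^sup>2 * \<kappa>" "\<epsilon>\<^sup>2 * \<kappa> \<le> \<kappa>" using \<epsilon>2 \<kappa> by (auto simp: mult_le_cancel_right1)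
  have bb: "\<bar>?x s\<bar> \<le> b" if "s \<in> {0..T}" for s unfolding b_def by (rule ode_solution_bound[OF cont bd that])
  have dev: "(\<integral>\<^sup>+\<omega>. ennreal ((X s \<omega> - ?x s)\<^sup>2) \<partial>M) \<le> ennreal (\<epsilon>\<^sup>2 * D)" if s: "s \<in> {0..T}" for s
  proof -
    have "(\<integral>\<^sup>+\<omega>. ennreal ((X s \<omega> - ?x s)\<^sup>2) \<partial>M)
      \<le> ennreal (\<epsilon>\<^sup>2 * \<kappa> * (2 * K1 * (1 + 2 * b\<^sup>2) * T * exp (4 * (\<epsilon>\<^sup>2 * \<kappa>) * K1 * T)))"
      unfolding K1_def
      by (rule linear_sde_deviation_bound[OF T X X0 \<theta>m bd ode_solution_continuous[OF cont bd]
            ode_solution_integral_equation[OF cont bd] bb v \<kappa>'(1) s]) auto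
    also have "\<dots> \<le> ennreal (\<epsilon>\<^sup>2 * D)"
    proof (rule ennreal_leI)
      have "4 * (\<epsilon>\<^sup>2 * \<kappa>) * K1 * T \<le> 4 * \<kappa> * K1 * T"
        using \<kappa>'(2) K10 T by (intro mult_right_mono) auto
      then have "2 * K1 * (1 + 2 * b\<^sup>2) * T * exp (4 * (\<epsilon>\<^sup>2 * \<kappa>) * K1 * T) \<le> 2 * K1 * (1 + 2 * b\<^sup>2) * T * exp (4 * \<kappa> * K1 * T)"
        using K10 T by (intro mult_left_mono) auto
      then have "\<epsilon>\<^sup>2 * \<kappa> * (2 * K1 * (1 + 2 * b\<^sup>2) * T * exp (4 * (\<epsilon>\<^sup>2 * \<kappa>) * K1 * T))
         \<le> \<epsilon>\<^sup>2 * \<kappa> * (2 * K1 * (1 + 2 * b\<^sup>2) * T * exp (4 * \<kappa> * K1 * T))"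
        by (rule mult_left_mono[OF _ less_imp_le[OF \<kappa>'(1)]])
      then show "\<epsilon>\<^sup>2 * \<kappa> * (2 * K1 * (1 + 2 * b\<^sup>2) * T * exp (4 * (\<epsilon>\<^sup>2 * \<kappa>) * K1 * T)) \<le> \<epsilon>\<^sup>2 * D"
        unfolding D_def by (simp only: mult.assoc)
    qed
    finally show ?thesis .
  qed
  define x1 where "x1 = (LBINT s:{0..T}. G ((s - t) / h) * (\<theta> s * ?x s))"
  define w where "w = h * (B - A)"
  have w: "t + h * B - (t + h * A) = w" by (simp add: w_def algebra_simps)
  have outg: "G ((s - t) / h) = 0" if "s \<notin> {t + h * A..t + h * B}" for s
  proof (rule out)
    show "(s - t) / h \<notin> {A..B}" using that h(1) by (auto simp: field_simps)
  qed
  have "(\<integral>\<^sup>+\<omega>. ennreal ((J \<omega> - x1)\<^sup>2) \<partial>M)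
    \<le> ennreal (2 * (C\<^sup>2 * (\<epsilon>\<^sup>2 * \<kappa> * (1 + 2 * b\<^sup>2 + 2 * (\<epsilon>\<^sup>2 * D))) * (t + h * B - (t + h * A)))
       + 2 * ((C * (t + h * B - (t + h * A)) * L)\<^sup>2 * (\<epsilon>\<^sup>2 * D)))"
    unfolding x1_def
  proof (rule stochastic_error_bound[OF T X J \<theta>m bd ode_solution_continuous[OF cont bd] bb v \<kappa>'(1) _ C outg _ _ _ dev])
    show "(\<lambda>s. G ((s - t) / h)) \<in> borel_measurable borel" by measurable
    show "t + h * A \<le> t + h * B" using h AB by (intro add_left_mono mult_left_mono) auto
  qed (use lo hi D0 in auto)
  also have "\<dots> \<le> ennreal (\<epsilon>\<^sup>2 * (2 * (C\<^sup>2 * (\<kappa> * (1 + 2 * b\<^sup>2 + 2 * D)) * (B - A)) + 2 * ((C * (B - A) * L)\<^sup>2 * D)))"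
    unfolding w
  proof (rule ennreal_leI)
    have l: "0 \<le> w" "w \<le> B - A" using h AB by (auto simp: w_def mult_le_cancel_right1)
    have "\<epsilon>\<^sup>2 * D \<le> D" using \<epsilon>2 D0 by (simp add: mult_left_le_one_le)
    then have "C\<^sup>2 * (\<kappa> * (1 + 2 * b\<^sup>2 + 2 * (\<epsilon>\<^sup>2 * D))) * w \<le> C\<^sup>2 * (\<kappa> * (1 + 2 * b\<^sup>2 + 2 * D)) * (B - A)"
      using l \<kappa> D0 by (intro mult_mono mult_left_mono mult_nonneg_nonneg add_mono) auto
    moreover have "(C * w * L)\<^sup>2 * D \<le> (C * (B - A) * L)\<^sup>2 * D"
    proof (rule mult_right_mono[OF _ D0])
      have "w\<^sup>2 \<le> (B - A)\<^sup>2" using l by (intro power_mono) auto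
      then show "(C * w * L)\<^sup>2 \<le> (C * (B - A) * L)\<^sup>2"
        unfolding power_mult_distrib by (intro mult_right_mono mult_left_mono) auto
    qed
    ultimately have "\<epsilon>\<^sup>2 * (2 * (C\<^sup>2 * (\<kappa> * (1 + 2 * b\<^sup>2 + 2 * (\<epsilon>\<^sup>2 * D))) * w) + 2 * ((C * w * L)\<^sup>2 * D))
      \<le> \<epsilon>\<^sup>2 * (2 * (C\<^sup>2 * (\<kappa> * (1 + 2 * b\<^sup>2 + 2 * D)) * (B - A)) + 2 * ((C * (B - A) * L)\<^sup>2 * D))"
      using \<epsilon>2 by (intro mult_left_mono add_mono) auto
    then show "2 * (C\<^sup>2 * (\<epsilon>\<^sup>2 * \<kappa> * (1 + 2 * b\<^sup>2 + 2 * (\<epsilon>\<^sup>2 * D))) * w) + 2 * ((C * w * L)\<^sup>2 * (\<epsilon>\<^sup>2 * D))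
      \<le> \<epsilon>\<^sup>2 * (2 * (C\<^sup>2 * (\<kappa> * (1 + 2 * b\<^sup>2 + 2 * D)) * (B - A)) + 2 * ((C * (B - A) * L)\<^sup>2 * D))"
      by (simp add: algebra_simps)
  qed
  finally have stoch: "(\<integral>\<^sup>+\<omega>. ennreal ((J \<omega> - x1)\<^sup>2) \<partial>M)
    \<le> ennreal (\<epsilon>\<^sup>2 * (2 * (C\<^sup>2 * (\<kappa> * (1 + 2 * b\<^sup>2 + 2 * D)) * (B - A)) + 2 * ((C * (B - A) * L)\<^sup>2 * D)))" .
  define c1 where "c1 = 2 * (C\<^sup>2 * (\<kappa> * (1 + 2 * b\<^sup>2 + 2 * D)) * (B - A)) + 2 * ((C * (B - A) * L)\<^sup>2 * D)"
  have c1: "0 \<le> c1" unfolding c1_def using \<kappa> D0 AB by (intro add_nonneg_nonneg mult_nonneg_nonneg) auto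
  define c2 where "c2 = C * K * (max \<bar>A\<bar> \<bar>B\<bar>) ^ Suc k * (B - A)"
  define \<beta> where "\<beta> = 1 / h * x1 - \<theta> t * ?x t"
  have xm: "(\<lambda>s. indicator {0<..<T} s * (\<theta> s * ?x s)) \<in> borel_measurable borel"
  proof -
    have "(\<lambda>s. indicator {0..T} s *\<^sub>R ?x s) \<in> borel_measurable borel"
      using borel_measurable_continuous_on_indicator[OF _ ode_solution_continuous[OF cont bd]] by simp
    then have "(\<lambda>s. indicator {0<..<T} s * (\<theta> s * (indicator {0..T} s *\<^sub>R ?x s))) \<in> borel_measurable borel"
      by measurable
    moreover have "indicator {0<..<T} s * (\<theta> s * (indicator {0..T} s *\<^sub>R ?x s)) = indicator {0<..<T} s * (\<theta> s * ?x s)" for s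
      by (simp add: indicator_def)
    ultimately show ?thesis by (simp only:)
  qed
  have "\<bar>\<beta>\<bar> \<le> c2 * h ^ Suc k"
    unfolding \<beta>_def x1_def c2_def by (rule kernel_bias[OF A2 A3 C K xm t h(1) lo hi])
  then have "\<bar>\<beta>\<bar>\<^sup>2 \<le> (c2 * h ^ Suc k)\<^sup>2" by (intro power_mono) auto
  moreover have "(h ^ Suc k)\<^sup>2 = h ^ (2 * k + 2)"
    unfolding power_mult[symmetric] by (rule arg_cong[where f = "power h"]) simp
  ultimately have \<beta>2: "\<beta>\<^sup>2 \<le> h ^ (2 * k + 2) * c2\<^sup>2"
    by (simp only: power2_abs power_mult_distrib mult.commute[of "c2\<^sup>2"])
  have Jm[measurable]: "J \<in> borel_measurable M" using J unfolding has_integral_wrt_process_def by (rule conjunct1)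
  have "(\<integral>\<^sup>+\<omega>. ennreal ((1 / h * J \<omega> - \<theta> t * ?x t)\<^sup>2) \<partial>M)
    \<le> (\<integral>\<^sup>+\<omega>. ennreal (2 / h\<^sup>2) * ennreal ((J \<omega> - x1)\<^sup>2) + ennreal (2 * \<beta>\<^sup>2) \<partial>M)"
  proof (rule nn_integral_mono)
    fix \<omega>
    have "1 / h * J \<omega> - \<theta> t * ?x t = 1 / h * (J \<omega> - x1) + \<beta>" by (simp add: \<beta>_def algebra_simps)
    then have "(1 / h * J \<omega> - \<theta> t * ?x t)\<^sup>2 \<le> 2 / h\<^sup>2 * (J \<omega> - x1)\<^sup>2 + 2 * \<beta>\<^sup>2"
      using square_add_le[of 1 "1 / h * (J \<omega> - x1)" \<beta>] by (simp add: power_mult_distrib power_divide)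
    then have "ennreal ((1 / h * J \<omega> - \<theta> t * ?x t)\<^sup>2) \<le> ennreal (2 / h\<^sup>2 * (J \<omega> - x1)\<^sup>2 + 2 * \<beta>\<^sup>2)"
      by (rule ennreal_leI)
    then show "ennreal ((1 / h * J \<omega> - \<theta> t * ?x t)\<^sup>2) \<le> ennreal (2 / h\<^sup>2) * ennreal ((J \<omega> - x1)\<^sup>2) + ennreal (2 * \<beta>\<^sup>2)"
      by (subst ennreal_mult[symmetric], simp, simp, subst ennreal_plus[symmetric]) simp_all
  qed
  also have "\<dots> = ennreal (2 / h\<^sup>2) * (\<integral>\<^sup>+\<omega>. ennreal ((J \<omega> - x1)\<^sup>2) \<partial>M) + ennreal (2 * \<beta>\<^sup>2)"
    by (simp add: nn_integral_add nn_integral_cmult emeasure_space_1)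
  also have "\<dots> \<le> ennreal (2 / h\<^sup>2) * ennreal (\<epsilon>\<^sup>2 * c1) + ennreal (2 * (h ^ (2 * k + 2) * c2\<^sup>2))"
    using stoch \<beta>2 unfolding c1_def[symmetric] by (intro add_mono mult_left_mono ennreal_leI) auto
  also have "\<dots> = ennreal (2 / h\<^sup>2 * (\<epsilon>\<^sup>2 * c1) + 2 * (h ^ (2 * k + 2) * c2\<^sup>2))"
  proof -
    have "0 \<le> 2 / h\<^sup>2" "0 \<le> \<epsilon>\<^sup>2 * c1" "0 \<le> 2 * (h ^ (2 * k + 2) * c2\<^sup>2)" using c1 h by auto
    then show ?thesis by (subst ennreal_mult[symmetric], simp, simp, subst ennreal_plus[symmetric]) auto
  qed
  also have "2 / h\<^sup>2 * (\<epsilon>\<^sup>2 * c1) + 2 * (h ^ (2 * k + 2) * c2\<^sup>2) = h ^ (2 * k + 2) * (2 * c1 + 2 * c2\<^sup>2)"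
  proof -
    have "\<epsilon>\<^sup>2 = h\<^sup>2 * h ^ (2 * k + 2)" unfolding \<epsilon>_def power_mult[symmetric] power_add[symmetric] by (simp add: algebra_simps)
    then have "2 / h\<^sup>2 * (\<epsilon>\<^sup>2 * c1) = 2 * (h ^ (2 * k + 2) * c1)" using h(1) by simp
    then show ?thesis by (simp add: algebra_simps)
  qed
  finally show ?thesis unfolding c1_def c2_def .
qed

end

theorem theorem3p2:
  fixes M :: "'a measure" and W Y :: "real \<Rightarrow> 'a \<Rightarrow> real"
    and \<sigma>1 \<sigma>2 :: "real \<Rightarrow> real \<Rightarrow> real" and G :: "real \<Rightarrow> real"
    and T x0 L L1 A B a b \<epsilon>0 :: real and k :: nat and \<phi> :: "real \<Rightarrow> real"
    and X :: "real \<Rightarrow> (real \<Rightarrow> real) \<Rightarrow> real \<Rightarrow> 'a \<Rightarrow> real"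
    and thetahat_X :: "real \<Rightarrow> (real \<Rightarrow> real) \<Rightarrow> real \<Rightarrow> 'a \<Rightarrow> real"
  assumes "T > 0" and "k \<ge> 1" and "L1 > 0" and "0 < a" and "a \<le> b" and "b < T"
    and "brownian_motion M W"
    and "adapted_on (brownian_filtration M W) {0..} Y" and "continuous_paths_on M {0..} Y"
    and "\<And>\<theta>. \<theta> \<in> Theta_class (k + 1) L L1 \<Longrightarrow> existence_conditions (\<lambda>t x. \<theta> t * x) \<sigma>1 \<sigma>2"
    and "\<And>\<theta>. \<theta> \<in> Theta_class (k + 1) L L1 \<Longrightarrow> cond_A1 T L \<theta> \<sigma>1 \<sigma>2"
    and "cond_A2 A B G" and "cond_A3 k G"
    and "\<And>\<epsilon>. \<epsilon> > 0 \<Longrightarrow> \<phi> \<epsilon> = \<epsilon> powr (1 / (real k + 2))"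
    and "\<epsilon>0 > 0"
    and "\<And>\<epsilon> \<theta>. 0 < \<epsilon> \<Longrightarrow> \<epsilon> < \<epsilon>0 \<Longrightarrow> \<theta> \<in> Theta_class (k + 1) L L1 \<Longrightarrow>
           linear_sde_solution M W Y T \<sigma>1 \<sigma>2 x0 \<epsilon> \<theta> (X \<epsilon> \<theta>)"
    and "\<And>\<epsilon> \<theta> t. 0 < \<epsilon> \<Longrightarrow> \<epsilon> < \<epsilon>0 \<Longrightarrow> \<theta> \<in> Theta_class (k + 1) L L1 \<Longrightarrow> t \<in> {a..b} \<Longrightarrow>
           kernel_estimate M W T G (\<phi> \<epsilon>) (X \<epsilon> \<theta>) t (thetahat_X \<epsilon> \<theta> t)"
  shows "Limsup (at_right 0) (\<lambda>\<epsilon>.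
           SUP \<theta>\<in>Theta_class (k + 1) L L1. SUP t\<in>{a..b}.
             (\<integral>\<^sup>+ \<omega>. ennreal (\<bar>thetahat_X \<epsilon> \<theta> t \<omega> - \<theta> t * ode_solution x0 \<theta> t\<bar>\<^sup>2) \<partial>M)
               * ennreal (\<epsilon> powr (- (2 * (real k + 1) / (real k + 2))))) < \<infinity>"
proof -
  let ?\<Theta> = "Theta_class (k + 1) L L1"
  let ?risk = "\<lambda>\<epsilon> \<theta> t. (\<integral>\<^sup>+ \<omega>. ennreal (\<bar>thetahat_X \<epsilon> \<theta> t \<omega> - \<theta> t * ode_solution x0 \<theta> t\<bar>\<^sup>2) \<partial>M)
               * ennreal (\<epsilon> powr (- (2 * (real k + 1) / (real k + 2))))"
  have "\<exists>c::real. \<exists>\<delta>>0. \<forall>\<epsilon>. 0 < \<epsilon> \<longrightarrow> \<epsilon> < \<delta> \<longrightarrow> (\<forall>\<theta>\<in>?\<Theta>. \<forall>t\<in>{a..b}. ?risk \<epsilon> \<theta> t \<le> ennreal c)"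
  proof (cases "?\<Theta> = {}")
    case True
    show ?thesis unfolding True by (intro exI[of _ 0] exI[of _ "1::real"]) simp
  next
    case False
    then obtain \<theta>0 where \<theta>0: "\<theta>0 \<in> ?\<Theta>" by blast
    interpret filtered_brownian M "brownian_filtration M W" W
      by (rule filtered_brownian_augmented[OF assms(7)])
    obtain C2 where C2: "\<And>t x. 0 \<le> t \<Longrightarrow> \<bar>\<sigma>2 t x\<bar> \<le> C2"
      using assms(11)[OF \<theta>0] unfolding cond_A1_def by blast
    obtain K1 where K1: "0 < K1" "\<And>t x. 0 \<le> t \<Longrightarrow> \<bar>\<sigma>1 t x\<bar>\<^sup>2 \<le> K1 * (1 + \<bar>x\<bar>\<^sup>2)"
      using assms(11)[OF \<theta>0] unfolding cond_A1_def by blast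
    obtain C where C: "\<And>u. \<bar>G u\<bar> \<le> C" and AB: "A < 0" "0 < B"
      using assms(12) unfolding cond_A2_def by blast
    obtain K where K: "\<And>\<theta>. \<theta> \<in> ?\<Theta> \<Longrightarrow> smooth_bounded {0<..<T} K (Suc k) (\<lambda>t. \<theta> t * ode_solution x0 \<theta> t)"
      using drift_smooth_bounded[OF assms(1), of k L L1 x0] by auto
    define \<kappa> where "\<kappa> = K1 * (C2\<^sup>2 + 1)"
    have \<kappa>: "0 < \<kappa>" using K1(1) by (simp add: \<kappa>_def add_nonneg_pos)
    \<comment> \<open>below this bandwidth the support of the kernel around any \<open>t\<close> in \<open>{a..b}\<close> stays inside \<open>{0<..<T}\<close>\<close>
    define h0 where "h0 = min 1 (min (a / (1 - A)) ((T - b) / (1 + B)))"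
    have h0: "0 < h0" "h0 \<le> 1" using assms(4,6) AB by (auto simp: h0_def)
    define \<delta> where "\<delta> = min \<epsilon>0 (h0 ^ (k + 2))"
    have \<delta>: "0 < \<delta>" using h0 assms(15) by (simp add: \<delta>_def)
    define D where "D = \<kappa> * (2 * (2 + 2 * L\<^sup>2 * (exp (L * T))\<^sup>2 * T * T) * (1 + 2 * (\<bar>x0\<bar> * exp (L * T))\<^sup>2) * T
      * exp (4 * \<kappa> * (2 + 2 * L\<^sup>2 * (exp (L * T))\<^sup>2 * T * T) * T))"
    define c where "c = (2 * (2 * (C\<^sup>2 * (\<kappa> * (1 + 2 * (\<bar>x0\<bar> * exp (L * T))\<^sup>2 + 2 * D)) * (B - A)) + 2 * ((C * (B - A) * L)\<^sup>2 * D))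
       + 2 * (C * K * (max \<bar>A\<bar> \<bar>B\<bar>) ^ Suc k * (B - A))\<^sup>2)"
    have "\<forall>\<epsilon>. 0 < \<epsilon> \<longrightarrow> \<epsilon> < \<delta> \<longrightarrow> (\<forall>\<theta>\<in>?\<Theta>. \<forall>t\<in>{a..b}. ?risk \<epsilon> \<theta> t \<le> ennreal c)"
    proof (intro allI impI ballI)
      fix \<epsilon> \<theta> t assume \<epsilon>: "0 < \<epsilon>" "\<epsilon> < \<delta>" and \<theta>: "\<theta> \<in> ?\<Theta>" and t: "t \<in> {a..b}"
      have \<epsilon>0: "\<epsilon> < \<epsilon>0" using \<epsilon>(2) by (simp add: \<delta>_def)
      define h where "h = \<phi> \<epsilon>"
      have hp: "h ^ (k + 2) = \<epsilon>" unfolding h_def assms(14)[OF \<epsilon>(1)] by (rule root_powr_power[OF \<epsilon>(1)])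
      have h1: "0 < h" unfolding h_def assms(14)[OF \<epsilon>(1)] using \<epsilon>(1) by simp
      have hh: "h < h0"
      proof (rule power_less_imp_less_base)
        show "h ^ (k + 2) < h0 ^ (k + 2)" unfolding hp using \<epsilon>(2) by (simp add: \<delta>_def)
      qed (use h0 in simp)
      have "h < a / (1 - A)" "h < (T - b) / (1 + B)" using hh by (auto simp: h0_def)
      then have "h * (1 - A) < a" "h * (1 + B) < T - b" using AB by (auto simp: field_simps)
      then have lo: "0 < t + h * A" and hi: "t + h * B < T" using t h1 by (auto simp: algebra_simps)
      have tT: "t \<in> {0<..<T}" using t assms(4,6) by auto
      have sol: "AE \<omega> in M. X \<epsilon> \<theta> 0 \<omega> = x0"
        "has_ito_differential M (brownian_filtration M W) W T (X \<epsilon> \<theta>)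
           (\<lambda>t \<omega>. \<theta> t * X \<epsilon> \<theta> t \<omega>) (\<lambda>t \<omega>. \<epsilon> * \<sigma>1 t (X \<epsilon> \<theta> t \<omega>) * \<sigma>2 t (Y t \<omega>))"
        using assms(16)[OF \<epsilon>(1) \<epsilon>0 \<theta>] unfolding linear_sde_solution_def by auto
      obtain J where J: "has_integral_wrt_process M (brownian_filtration M W) W T (X \<epsilon> \<theta>) (\<lambda>\<tau>. G ((\<tau> - t) / h)) J"
        and Z: "thetahat_X \<epsilon> \<theta> t = (\<lambda>\<omega>. 1 / h * J \<omega>)"
        using assms(17)[OF \<epsilon>(1) \<epsilon>0 \<theta> t] unfolding kernel_estimate_def h_def by auto
      have v: "(\<epsilon> * \<sigma>1 s (X \<epsilon> \<theta> s \<omega>) * \<sigma>2 s (Y s \<omega>))\<^sup>2 \<le> (h ^ (k + 2))\<^sup>2 * \<kappa> * (1 + (X \<epsilon> \<theta> s \<omega>)\<^sup>2)"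
        if s: "s \<in> {0..T}" for s \<omega>
      proof -
        have "\<bar>\<sigma>2 s (Y s \<omega>)\<bar>\<^sup>2 \<le> C2\<^sup>2" using s C2 by (intro power_mono) auto
        then have s2: "(\<sigma>2 s (Y s \<omega>))\<^sup>2 \<le> C2\<^sup>2 + 1" by simp
        have "(\<sigma>1 s (X \<epsilon> \<theta> s \<omega>))\<^sup>2 \<le> K1 * (1 + (X \<epsilon> \<theta> s \<omega>)\<^sup>2)" using K1(2)[of s "X \<epsilon> \<theta> s \<omega>"] s by simp
        then have "(\<sigma>1 s (X \<epsilon> \<theta> s \<omega>))\<^sup>2 * (\<sigma>2 s (Y s \<omega>))\<^sup>2 \<le> (K1 * (1 + (X \<epsilon> \<theta> s \<omega>)\<^sup>2)) * (C2\<^sup>2 + 1)"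
          using s2 K1(1) by (intro mult_mono) auto
        then have "\<epsilon>\<^sup>2 * ((\<sigma>1 s (X \<epsilon> \<theta> s \<omega>))\<^sup>2 * (\<sigma>2 s (Y s \<omega>))\<^sup>2) \<le> \<epsilon>\<^sup>2 * ((K1 * (1 + (X \<epsilon> \<theta> s \<omega>)\<^sup>2)) * (C2\<^sup>2 + 1))"
          by (intro mult_left_mono) auto
        then show ?thesis unfolding hp \<kappa>_def by (simp add: power_mult_distrib mult_ac)
      qed
      note mse = kernel_estimator_mean_square_error[OF assms(1) \<theta>[unfolded Suc_eq_plus1[symmetric]] assms(12,13) C
          sol(2,1) v \<kappa> J K[OF \<theta>] tT h1 less_imp_le[OF less_le_trans[OF hh h0(2)]] lo hi]
      have rate: "\<epsilon> powr (- (2 * (real k + 1) / (real k + 2))) = 1 / h ^ (2 * k + 2)"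
        unfolding hp[symmetric] by (rule power_rate[OF h1])
      have scale: "ennreal (h ^ (2 * k + 2) * c) * ennreal (1 / h ^ (2 * k + 2)) = ennreal c" for c
      proof -
        have "ennreal (h ^ (2 * k + 2) * c) * ennreal (1 / h ^ (2 * k + 2)) = ennreal (h ^ (2 * k + 2) * c * (1 / h ^ (2 * k + 2)))"
          using h1 by (intro ennreal_mult''[symmetric]) simp
        also have "h ^ (2 * k + 2) * c * (1 / h ^ (2 * k + 2)) = c" using h1 by simp
        finally show ?thesis .
      qed
      show "?risk \<epsilon> \<theta> t \<le> ennreal c"
        unfolding Z rate power2_abs c_def D_def
        by (rule mult_right_mono[OF mse zero_le, of "ennreal (1 / h ^ (2 * k + 2))", unfolded scale])
    qed
    then show ?thesis using \<delta> by blast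
  qed
  then obtain c :: real and \<delta> :: real where \<delta>: "0 < \<delta>"
    and c: "\<And>\<epsilon> \<theta> t. 0 < \<epsilon> \<Longrightarrow> \<epsilon> < \<delta> \<Longrightarrow> \<theta> \<in> ?\<Theta> \<Longrightarrow> t \<in> {a..b} \<Longrightarrow> ?risk \<epsilon> \<theta> t \<le> ennreal c" by blast
  have "eventually (\<lambda>\<epsilon>. (SUP \<theta>\<in>?\<Theta>. SUP t\<in>{a..b}. ?risk \<epsilon> \<theta> t) \<le> ennreal c) (at_right 0)"
    using eventually_at_right_less[of "0::real"] eventually_at_right_real[OF \<delta>]
  proof eventually_elim
    case (elim \<epsilon>)
    then show ?case by (intro SUP_least c) auto
  qed
  then have "Limsup (at_right 0) (\<lambda>\<epsilon>. SUP \<theta>\<in>?\<Theta>. SUP t\<in>{a..b}. ?risk \<epsilon> \<theta> t) \<le> ennreal c"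
    by (rule Limsup_bounded)
  also have "\<dots> < \<infinity>" by simp
  finally show ?thesis .
qed

end
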